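(* Let $V$ be a vertex operator algebra, $\nu$ an automorphism of $V$ of period $p>0$, $\omega_p\in\mathbb{C}$ a primitive $p$-th root of unity and $M$ a $\mathbb{Q}$-graded $\nu$-twisted $V$-module. For $u_1,v_1,u_2,v_2\in V$, $$[X_M(Y[u_1,y_1]v_1,x_1),X_M(Y[u_2,y_2]v_2,x_2)]=\mathrm{Res}_y\,\frac1p\sum_{r=0}^{p-1}\Big\{$$ $$\delta\Big(\omega_p^r\Big(e^{-y_2-y}\frac{x_1}{x_2}\Big)^{1/p}\Big)X_M\big(Y[u_1,y_1+y]\,Y[\nu^{-r}v_2,-y_2]\,Y[v_1,y]\,\nu^{-r}u_2,\;e^{-y}x_1\big)$$ $$+\,\delta\Big(\omega_p^r\Big(e^{-y}\frac{x_1}{x_2}\Big)^{1/p}\Big)X_M\big(Y[u_1,y_1+y]\,Y[\nu^{-r}u_2,y_2]\,Y[v_1,y]\,\nu^{-r}v_2,\;e^{-y}x_1\big)$$ $$+\,\delta\Big(\omega_p^r\Big(e^{y_1-y_2-y}\frac{x_1}{x_2}\Big)^{1/p}\Big)X_M\big(Y\big[Y[\nu^{-r}v_2,-y_2]\,Y[u_1,y]\,\nu^{-r}u_2,\;y_1-y\big]v_1,\;x_1\big)$$ $$+\,\delta\Big(\omega_p^r\Big(e^{y_1-y}\frac{x_1}{x_2}\Big)^{1/p}\Big)X_M\big(Y\big[Y[\nu^{-r}u_2,y_2]\,Y[u_1,y]\,\nu^{-r}v_2,\;y_1-y\big]v_1,\;x_1\big)\Big\}.$$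
   Context: $V=(V,Y,\mathbf 1,\omega)$ is a vertex operator algebra over $\mathbb{C}$ of central charge $c_V$; an automorphism $\nu$ of period $p$ is a linear automorphism of $V$ preserving $\omega$ and $\mathbf 1$ with $\nu Y(v,x)\nu^{-1}=Y(\nu v,x)$ and $\nu^p=1_V$. A $\mathbb{Q}$-graded $\nu$-twisted $V$-module is a $\mathbb{Q}$-graded space $M=\coprod_{n\in\mathbb{Q}}M_{(n)}$ with $M_{(n)}=0$ for $n$ sufficiently negative and $\dim M_{(n)}<\infty$, with a linear map $v\mapsto Y_M(v,x)=\sum_{n\in\frac1p\mathbb{Z}}v_n^\nu x^{-n-1}\in(\mathrm{End}\,M)[[x^{1/p},x^{-1/p}]]$ such that: $v_n^\nu w=0$ for $n$ sufficiently large ($v\in V,w\in M$); $Y_M(\mathbf 1,x)=1_M$; with $Y_M(\omega,x)=\sum_{n\in\mathbb{Z}}L_M(n)x^{-n-2}$, one has $[L_M(m),L_M(n)]=(m-n)L_M(m+n)+c_V\frac{m^3-m}{12}\delta_{m+n,0}1_M$, $L_M(0)$ acts on $M_{(n)}$ as $n$, and $Y_M(L(-1)u,x)=\frac{d}{dx}Y_M(u,x)$; and for $u,v\in V$ the twisted Jacobi identity $$x_0^{-1}\delta\Big(\frac{x_1-x_2}{x_0}\Big)Y_M(u,x_1)Y_M(v,x_2)-x_0^{-1}\delta\Big(\frac{x_2-x_1}{-x_0}\Big)Y_M(v,x_2)Y_M(u,x_1)=\frac1p x_2^{-1}\sum_{r=0}^{p-1}\delta\Big(\omega_p^r\Big(\frac{x_1-x_0}{x_2}\Big)^{1/p}\Big)Y_M(Y(\nu^ru,x_0)v,x_2)$$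 holds, where $\delta(x)=\sum_{n\in\mathbb{Z}}x^n$. Homogeneous twisted vertex operators: $X_M(u,x)=Y_M(x^{L(0)}u,x)$. Also $Y[u,y]=Y(e^{yL(0)}u,e^y-1)$ for $u\in V$. Here $x_1,x_2,y_1,y_2,y$ are independent commuting formal variables, exponentials of formal variables are expanded in nonnegative powers of those variables, $\mathrm{Res}_y$ is the coefficient of $y^{-1}$, and binomial expressions (e.g. powers of $y_1+y$, $y_1-y$) are expanded in nonnegative integral powers of the second variable. In $X_M(\cdot,e^{-y}x_1)$ a power $(e^{-y}x_1)^{m/p}$ means $e^{-my/p}x_1^{m/p}$. *)

theory Defs
  imports
    Complex_Main
    "HOL-Library.Function_Algebras"
    "HOL-Library.Groups_Big_Fun"
    "HOL-Computational_Algebra.Formal_Laurent_Series"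
begin

section \<open>Formal series\<close>

text \<open>
  A formal series in the commuting variables below is an arbitrary family of coefficients indexed by
  monomials, a monomial being its function of (rational) exponents. Fractional powers of \<open>x\<close> are thus
  monomials \<open>x\<^sup>q\<close> with \<open>q\<close> rational. \<open>Y0\<close> is the variable written \<open>y\<close> in informal notation.

  A scalar series is represented by the operator ``multiply by it''. All infinite sums are
  coefficientwise sums with finitely many nonzero terms (\<^const>\<open>Sum_any\<close>); for the expressions used
  below this finiteness follows from the truncation conditions. Since complex vector spaces are given
  by the locale \<^locale>\<open>vector_space\<close>, the scalar multiplication \<open>s\<close> is an explicit argument.
\<close>

datatype fvar = X0 | X1 | X2 | Y0 | Y1 | Y2

type_synonym 'a fseries = "(fvar \<Rightarrow> rat) \<Rightarrow> 'a"

definition fconst :: "'a::zero \<Rightarrow> 'a fseries"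
  where "fconst a = (\<lambda>e. if e = 0 then a else 0)"

definition fsum :: "('i \<Rightarrow> 'a::comm_monoid_add fseries) \<Rightarrow> 'a fseries"
  where "fsum F = (\<lambda>e. Sum_any (\<lambda>i. F i e))"

definition fscale :: "(complex \<Rightarrow> 'a \<Rightarrow> 'a) \<Rightarrow> complex \<Rightarrow> 'a fseries \<Rightarrow> 'a fseries"
  where "fscale s c F = (\<lambda>e. s c (F e))"

text \<open>Multiplication by \<open>x\<^sup>q\<close>.\<close>

definition fmono :: "fvar \<Rightarrow> rat \<Rightarrow> 'a fseries \<Rightarrow> 'a fseries"
  where "fmono x q F = (\<lambda>e. F (e(x := e x - q)))"

definition fmono_int :: "fvar \<Rightarrow> int \<Rightarrow> 'a fseries \<Rightarrow> 'a fseries"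
  where "fmono_int x k = fmono x (of_int k)"

text \<open>Multiplication by \<open>exp (q x)\<close>, expanded in nonnegative powers of \<open>x\<close>.\<close>

definition fexp ::
    "(complex \<Rightarrow> 'a::comm_monoid_add \<Rightarrow> 'a) \<Rightarrow> rat \<Rightarrow> fvar \<Rightarrow> 'a fseries \<Rightarrow> 'a fseries"
  where "fexp s q x F =
    fsum (\<lambda>j::nat. fscale s (of_rat q ^ j / fact j) (fmono x (of_nat j) F))"

text \<open>Multiplication by \<open>(x + c y)\<^sup>q\<close>, expanded in nonnegative integral powers of the second
  variable \<open>y\<close>.\<close>

definition fbinom ::
    "(complex \<Rightarrow> 'a::comm_monoid_add \<Rightarrow> 'a) \<Rightarrow> fvar \<Rightarrow> complex \<Rightarrow> fvar \<Rightarrow> rat \<Rightarrow> 'a fseries \<Rightarrow> 'a fseries"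
  where "fbinom s x c y q F =
    fsum (\<lambda>i::nat. fscale s ((of_rat q gchoose i) * c ^ i)
      (fmono x (q - of_nat i) (fmono y (of_nat i) F)))"

text \<open>Multiplication by \<open>\<delta>(c z\<^sup>1\<^sup>/\<^sup>p)\<close>, where \<open>\<delta>(t)\<close> is the sum of all \<open>t\<^sup>k\<close>, \<open>k \<in> \<int>\<close>,
  and where \<open>P q\<close> is multiplication by the prescribed expansion of \<open>z\<^sup>q\<close>.\<close>

definition fdelta ::
    "(complex \<Rightarrow> 'a::comm_monoid_add \<Rightarrow> 'a) \<Rightarrow> complex \<Rightarrow> nat \<Rightarrow>
     (rat \<Rightarrow> 'a fseries \<Rightarrow> 'a fseries) \<Rightarrow> 'a fseries \<Rightarrow> 'a fseries"
  where "fdelta s c p P F = fsum (\<lambda>k::int. fscale s (c powi k) (P (of_int k / of_nat p) F))"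

text \<open>The coefficient of \<open>x\<^sup>-\<^sup>1\<close>, as a series not involving \<open>x\<close>.\<close>

definition fres :: "fvar \<Rightarrow> 'a::zero fseries \<Rightarrow> 'a fseries"
  where "fres x F = (\<lambda>e. if e x = 0 then F (e(x := -1)) else 0)"

text \<open>The generating function \<open>\<Sum>\<^sub>n a\<^sub>n z\<^sup>-\<^sup>n\<^sup>-\<^sup>1\<close> of operators \<open>a\<^sub>n\<close> applied to the series \<open>F\<close>, with \<open>P\<close>
  giving the powers of \<open>z\<close>. Substitutions such as \<open>z = x\<close>, \<open>z = y\<^sub>1 + y\<close>, \<open>z = - y\<^sub>2\<close>,
  \<open>z = exp (- y) x\<^sub>1\<close> are expressed by the choice of \<open>P\<close>.\<close>

definition fvertex ::
    "('i::ring_1 \<Rightarrow> 'a \<Rightarrow> 'b) \<Rightarrow> ('i \<Rightarrow> 'b fseries \<Rightarrow> 'b fseries) \<Rightarrow> 'a fseries \<Rightarrow> 'b::comm_monoid_add fseries"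
  where "fvertex a P F = fsum (\<lambda>n. P (- n - 1) (\<lambda>e. a n (F e)))"

text \<open>Extension of a linear map \<open>\<Phi>\<close> with series as values to series \<open>F = \<Sum>\<^sub>d F\<^sub>d x\<^sup>d\<close> (\<open>d\<close> running over
  the monomials): the result is \<open>\<Sum>\<^sub>d x\<^sup>d \<Phi> F\<^sub>d\<close>. This gives the meaning of \<open>Y(F, z)\<close> for a series \<open>F\<close>.\<close>

definition flin :: "('a \<Rightarrow> 'b::comm_monoid_add fseries) \<Rightarrow> 'a fseries \<Rightarrow> 'b fseries"
  where "flin \<Phi> F = fsum (\<lambda>d e. \<Phi> (F d) (e - d))"

section \<open>Gradings\<close>

definition decomposes :: "('i \<Rightarrow> 'a::comm_monoid_add set) \<Rightarrow> 'a \<Rightarrow> ('i \<Rightarrow> 'a) \<Rightarrow> bool"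
  where "decomposes W a f \<longleftrightarrow>
    finite {i. f i \<noteq> 0} \<and> (\<forall>i. f i \<in> W i) \<and> a = (\<Sum>i | f i \<noteq> 0. f i)"

text \<open>The whole type is the direct sum of the subsets \<open>W i\<close>.\<close>

definition direct_sum :: "('i \<Rightarrow> 'a::comm_monoid_add set) \<Rightarrow> bool"
  where "direct_sum W \<longleftrightarrow> (\<forall>a. \<exists>!f. decomposes W a f)"

definition component :: "('i \<Rightarrow> 'a::comm_monoid_add set) \<Rightarrow> 'a \<Rightarrow> 'i \<Rightarrow> 'a"
  where "component W a = (THE f. decomposes W a f)"

locale graded_vector_space = vector_space s
  for s :: "complex \<Rightarrow> 'a::ab_group_add \<Rightarrow> 'a" and W :: "'i::linorder \<Rightarrow> 'a set" +
  assumes graded_subspace: "subspace (W n)"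
    and graded_direct_sum: "direct_sum W"
    and graded_finite_dim: "\<exists>B. finite B \<and> W n = span B"
    and graded_bounded_below: "\<exists>N. \<forall>n<N. W n = {0}"

section \<open>Vertex operator algebras\<close>

text \<open>\<open>vmode V u n v\<close> is \<open>u\<^sub>n v\<close>, the coefficient of \<open>x\<^sup>-\<^sup>n\<^sup>-\<^sup>1\<close> in \<open>Y(u, x) v\<close>.\<close>

record 'v voa =
  vscale :: "complex \<Rightarrow> 'v \<Rightarrow> 'v"
  vgrade :: "int \<Rightarrow> 'v set"
  vmode :: "'v \<Rightarrow> int \<Rightarrow> 'v \<Rightarrow> 'v"
  vacuum :: 'v
  conformal :: 'v
  vcharge :: complex

definition voa_L :: "'v voa \<Rightarrow> int \<Rightarrow> 'v \<Rightarrow> 'v"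
  where "voa_L V n = vmode V (conformal V) (n + 1)"

locale vertex_operator_algebra =
  graded_vector_space "vscale V" "vgrade V" for V :: "'v::ab_group_add voa" +
  assumes vmode_linear_left: "Vector_Spaces.linear (vscale V) (vscale V) (\<lambda>u. vmode V u n w)"
    and vmode_linear_right: "Vector_Spaces.linear (vscale V) (vscale V) (vmode V u n)"
    and vmode_truncation: "\<exists>N. \<forall>n\<ge>N. vmode V u n w = 0"
    and vacuum_grade: "vacuum V \<in> vgrade V 0"
    and vacuum_identity: "vmode V (vacuum V) n w = (if n = -1 then w else 0)"
    and creation: "n \<ge> 0 \<Longrightarrow> vmode V u n (vacuum V) = 0"
      "vmode V u (-1) (vacuum V) = u"
    and conformal_grade: "conformal V \<in> vgrade V 2"
    and virasoro: "voa_L V m (voa_L V n w) - voa_L V n (voa_L V m w) =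
      vscale V (of_int (m - n)) (voa_L V (m + n) w) +
      vscale V (if m + n = 0 then vcharge V * (of_int m ^ 3 - of_int m) / 12 else 0) w"
    and L0_grade: "w \<in> vgrade V n \<Longrightarrow> voa_L V 0 w = vscale V (of_int n) w"
    \<comment> \<open>\<open>Y(L(-1) u, x) = d/dx Y(u, x)\<close>, coefficient of \<open>x\<^sup>-\<^sup>n\<^sup>-\<^sup>1\<close>\<close>
    and L_minus1_derivative:
      "vmode V (voa_L V (-1) u) n w = vscale V (- of_int n) (vmode V u (n - 1) w)"
    \<comment> \<open>\<open>\<delta>((x\<^sub>2 - x\<^sub>1)/(- x\<^sub>0))\<close> is read as \<open>\<delta>(c (x\<^sub>2 - x\<^sub>1)/x\<^sub>0)\<close> with \<open>c = -1\<close>\<close>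
    and jacobi:
      "fmono X0 (-1) (fdelta (vscale V) 1 1
          (\<lambda>q F. fbinom (vscale V) X1 (-1) X2 q (fmono X0 (- q) F))
          (fvertex (vmode V u) (fmono_int X1) (fvertex (vmode V v) (fmono_int X2) (fconst w))))
       - fmono X0 (-1) (fdelta (vscale V) (-1) 1
          (\<lambda>q F. fbinom (vscale V) X2 (-1) X1 q (fmono X0 (- q) F))
          (fvertex (vmode V v) (fmono_int X2) (fvertex (vmode V u) (fmono_int X1) (fconst w))))
       = fmono X2 (-1) (fdelta (vscale V) 1 1
          (\<lambda>q F. fbinom (vscale V) X1 (-1) X0 q (fmono X2 (- q) F))
          (flin (\<lambda>a. fvertex (vmode V a) (fmono_int X2) (fconst w))
            (fvertex (vmode V u) (fmono_int X0) (fconst v))))"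

text \<open>\<open>period p\<close> only requires \<open>\<nu>\<^sup>p = 1\<close>; \<open>p\<close> need not be the exact order of \<open>\<nu>\<close>.\<close>

locale voa_automorphism = vertex_operator_algebra V
  for V :: "'v::ab_group_add voa" and \<nu> :: "'v \<Rightarrow> 'v" and p :: nat +
  assumes aut_linear: "Vector_Spaces.linear (vscale V) (vscale V) \<nu>"
    and aut_bij: "bij \<nu>"
    and aut_conformal: "\<nu> (conformal V) = conformal V"
    and aut_vacuum: "\<nu> (vacuum V) = vacuum V"
    and aut_vmode: "\<nu> \<circ> vmode V v n \<circ> inv \<nu> = vmode V (\<nu> v) n"
    and aut_period: "\<nu> ^^ p = id"

definition primitive_unity_root :: "nat \<Rightarrow> complex \<Rightarrow> bool"
  where "primitive_unity_root p \<zeta> \<longleftrightarrow> \<zeta> ^ p = 1 \<and> (\<forall>k. 0 < k \<and> k < p \<longrightarrow> \<zeta> ^ k \<noteq> 1)"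

section \<open>Twisted modules\<close>

text \<open>\<open>tmode M u n w\<close> is \<open>u\<^sub>n\<^sup>\<nu> w\<close>, the coefficient of \<open>x\<^sup>-\<^sup>n\<^sup>-\<^sup>1\<close> in \<open>Y\<^sub>M(u, x) w\<close>, for rational \<open>n\<close>.\<close>

record ('v, 'm) tmodule =
  mscale :: "complex \<Rightarrow> 'm \<Rightarrow> 'm"
  mgrade :: "rat \<Rightarrow> 'm set"
  tmode :: "'v \<Rightarrow> rat \<Rightarrow> 'm \<Rightarrow> 'm"

definition mod_L :: "'v voa \<Rightarrow> ('v, 'm) tmodule \<Rightarrow> int \<Rightarrow> 'm \<Rightarrow> 'm"
  where "mod_L V M n = tmode M (conformal V) (of_int n + 1)"

locale twisted_module = voa_automorphism V \<nu> p +
  mod: graded_vector_space "mscale M" "mgrade M"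
  for V :: "'v::ab_group_add voa" and \<nu> :: "'v \<Rightarrow> 'v" and p :: nat and \<zeta> :: complex
    and M :: "('v, 'm::ab_group_add) tmodule" +
  assumes tmode_linear_left: "Vector_Spaces.linear (vscale V) (mscale M) (\<lambda>u. tmode M u n w)"
    and tmode_linear_right: "Vector_Spaces.linear (mscale M) (mscale M) (tmode M u n)"
    and tmode_fractional: "of_nat p * n \<notin> \<int> \<Longrightarrow> tmode M u n w = 0"
    and tmode_truncation: "\<exists>N. \<forall>n\<ge>N. tmode M u n w = 0"
    and tmode_vacuum: "tmode M (vacuum V) n w = (if n = -1 then w else 0)"
    and tmode_conformal_integral: "n \<notin> \<int> \<Longrightarrow> tmode M (conformal V) n w = 0"
    and mod_virasoro: "mod_L V M m (mod_L V M k w) - mod_L V M k (mod_L V M m w) =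
      mscale M (of_int (m - k)) (mod_L V M (m + k) w) +
      mscale M (if m + k = 0 then vcharge V * (of_int m ^ 3 - of_int m) / 12 else 0) w"
    and mod_L0_grade: "w \<in> mgrade M n \<Longrightarrow> mod_L V M 0 w = mscale M (of_rat n) w"
    and mod_L_minus1_derivative:
      "tmode M (voa_L V (-1) u) n w = mscale M (- of_rat n) (tmode M u (n - 1) w)"
    and twisted_jacobi:
      "fmono X0 (-1) (fdelta (mscale M) 1 1
          (\<lambda>q F. fbinom (mscale M) X1 (-1) X2 q (fmono X0 (- q) F))
          (fvertex (tmode M u) (fmono X1) (fvertex (tmode M v) (fmono X2) (fconst w))))
       - fmono X0 (-1) (fdelta (mscale M) (-1) 1
          (\<lambda>q F. fbinom (mscale M) X2 (-1) X1 q (fmono X0 (- q) F))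
          (fvertex (tmode M v) (fmono X2) (fvertex (tmode M u) (fmono X1) (fconst w))))
       = fscale (mscale M) (1 / of_nat p) (fmono X2 (-1) (\<Sum>r<p.
          fdelta (mscale M) (\<zeta> ^ r) p
            (\<lambda>q F. fbinom (mscale M) X1 (-1) X0 q (fmono X2 (- q) F))
            (flin (\<lambda>a. fvertex (tmode M a) (fmono X2) (fconst w))
              (fvertex (vmode V ((\<nu> ^^ r) u)) (fmono_int X0) (fconst v)))))"

section \<open>The operators \<open>Y[u, y]\<close> and \<open>X\<^sub>M(u, x)\<close>\<close>

text \<open>\<open>sq_mode V u n w\<close> is the coefficient of \<open>y\<^sup>-\<^sup>n\<^sup>-\<^sup>1\<close> in \<open>Y[u, y] w = Y(exp (y L(0)) u, exp y - 1) w\<close>,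
  that is, in the sum over \<open>m\<close> and \<open>j\<close> of \<open>(y\<^sup>j / j!) (exp y - 1)\<^sup>-\<^sup>m\<^sup>-\<^sup>1 (L(0)\<^sup>j u)\<^sub>m w\<close>.\<close>

definition sq_mode :: "'v::comm_monoid_add voa \<Rightarrow> 'v \<Rightarrow> int \<Rightarrow> 'v \<Rightarrow> 'v"
  where "sq_mode V u n w = Sum_any (\<lambda>(m::int, j::nat).
    vscale V
      (fls_nth ((fps_to_fls (fps_exp 1 - 1) :: complex fls) powi (- m - 1)) (- n - 1 - int j) / fact j)
      (vmode V ((voa_L V 0 ^^ j) u) m w))"

text \<open>\<open>Y[u, z] F\<close>, with \<open>P\<close> giving the integral powers of \<open>z\<close>.\<close>

definition Ysq ::
    "'v::comm_monoid_add voa \<Rightarrow> 'v \<Rightarrow> (int \<Rightarrow> 'v fseries \<Rightarrow> 'v fseries) \<Rightarrow> 'v fseries \<Rightarrow> 'v fseries"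
  where "Ysq V u P F = fvertex (sq_mode V u) P F"

text \<open>\<open>Y[F, z] v\<close> for a series \<open>F\<close>.\<close>

definition Ysq_series ::
    "'v::comm_monoid_add voa \<Rightarrow> 'v fseries \<Rightarrow> (int \<Rightarrow> 'v fseries \<Rightarrow> 'v fseries) \<Rightarrow> 'v \<Rightarrow> 'v fseries"
  where "Ysq_series V F P v = flin (\<lambda>a. Ysq V a P (fconst v)) F"

text \<open>\<open>X\<^sub>M(u, z) G = Y\<^sub>M(z\<^sup>L\<^sup>(\<^sup>0\<^sup>) u, z) G\<close>, with \<open>P\<close> giving the powers of \<open>z\<close>; \<open>z\<^sup>L\<^sup>(\<^sup>0\<^sup>)\<close> acts as \<open>z\<^sup>d\<close> on
  the component of \<open>u\<close> of weight \<open>d\<close>.\<close>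

definition XM ::
    "'v::comm_monoid_add voa \<Rightarrow> ('v, 'm::comm_monoid_add) tmodule \<Rightarrow> 'v \<Rightarrow>
     (rat \<Rightarrow> 'm fseries \<Rightarrow> 'm fseries) \<Rightarrow> 'm fseries \<Rightarrow> 'm fseries"
  where "XM V M u P G =
    fsum (\<lambda>d::int. P (of_int d) (fvertex (tmode M (component (vgrade V) u d)) P G))"

text \<open>\<open>X\<^sub>M(F, z) G\<close> for a series \<open>F\<close>.\<close>

definition XM_series ::
    "'v::comm_monoid_add voa \<Rightarrow> ('v, 'm::comm_monoid_add) tmodule \<Rightarrow> 'v fseries \<Rightarrow>
     (rat \<Rightarrow> 'm fseries \<Rightarrow> 'm fseries) \<Rightarrow> 'm fseries \<Rightarrow> 'm fseries"
  where "XM_series V M F P G = flin (\<lambda>u. XM V M u P G) F"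

end

theory Submission
  imports Defs
begin

text \<open>
  For \<open>u\<close> of weight \<open>d\<close> the mode \<open>u\<^bsub>[n]\<^esub>\<close> of \<open>Y[u, y]\<close> is a combination of the modes \<open>u\<^sub>k\<close> with
  coefficients read off from \<open>e\<^sup>d\<^sup>y (e\<^sup>y - 1)\<^sup>-\<^sup>k\<^sup>-\<^sup>1\<close>. Consequently the series
  \<open>\<Psi>\<^sub>\<lambda>(a) = \<Sum>\<^sub>n (\<lambda>\<^sup>n / n!) a\<^bsub>[n]\<^esub>\<close> over \<open>n \<ge> 0\<close> equals \<open>\<Sum>\<^sub>k binom (d + \<lambda> - 1) k a\<^sub>k\<close>, which is exactly
  the shape of the commutator of the modes of \<open>X\<^sub>M\<close> given by the twisted Jacobi identity:
  \<open>[X\<^sub>\<alpha>(a), X\<^sub>\<beta>(b)]\<close> is the average over \<open>r\<close> of \<open>\<omega>\<^sub>p\<^sup>r\<^sup>p\<^sup>\<alpha> X\<^bsub>\<alpha>+\<beta>\<^esub>(\<Psi>\<^bsub>-\<alpha>\<^esub>(\<nu>\<^sup>r a) b)\<close>.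

  With \<open>D = L(-1) + L(0)\<close> one has \<open>X\<^sub>\<gamma>(D v) = \<gamma> X\<^sub>\<gamma>(v)\<close>, and \<open>D\<close> is a derivation of all products
  \<open>u\<^bsub>[n]\<^esub> v\<close> with skew-symmetry of the usual form. For \<open>a = u\<^sub>1\<^bsub>[i]\<^esub> v\<^sub>1\<close> and \<open>b = u\<^sub>2\<^bsub>[j]\<^esub> v\<^sub>2\<close> the operator
  \<open>\<Psi>(a)\<close> is turned by skew-symmetry into \<open>\<Psi>(b)\<close> acting on \<open>a\<close>; the commutator formula distributes
  \<open>\<Psi>(b)\<close> over \<open>u\<^sub>1\<close> and \<open>v\<^sub>1\<close>, and skew-symmetry followed by the commutator formula expands each half
  into two terms. These are the coefficients of the four summands of the right-hand side, the exponentials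
  \<open>e\<^sup>-\<^sup>y\<close>, \<open>e\<^bsup>y\<^sub>1\<^esup>\<close> and \<open>e\<^bsup>-y\<^sub>2\<^esup>\<close> recording the eigenvalues of \<open>D\<close>.
\<close>

section \<open>The coefficients of the change of coordinates\<close>

text \<open>The commutator formula produces \<open>sq_psi\<close> of the composite vector a, whereas
  \<open>sq_psi_commutator\<close> describes \<open>sq_psi\<close> acting on a composite vector.
  Skew-symmetry exchanges the two roles. Because D acts as the scalar \<alpha> + \<beta> under
  \<open>xmode (\<alpha> + \<beta>)\<close>, the exchange costs only a sign and the replacement of
  -\<alpha> by -\<beta>. The coefficient identities come mostly from expanding one factor e^(ay) in
  two ways: in powers of y, which moves the index n, and in powers of e^y - 1, which moves the index
  k of the ordinary modes. Identities between single modes are then recovered by comparing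
  polynomials in the parameter x. The commutator formula puts \<nu>^r on the first operator, the
  theorem puts \<nu>^(-r) on the second. The discrepancy is a phase under \<open>xmode\<close>,
  extracted from the twisted Jacobi identity with the vacuum as second vector. Since
  \<open>Sum_any\<close> is 0 on infinite support, interchanges of sums rest on explicit finite
  bounds; this is the purpose of the many truncation indices.\<close>

definition fls_expm1 :: "complex fls"
  where "fls_expm1 = fps_to_fls (fps_exp 1 - 1)"

text \<open>The factor of u_k in Y[u, y] for u of weight d, where e^(y L(0)) contributes e^(dy). The
  parameter d ranges over the complex numbers because exponentials e^(xy) with arbitrary x are
  absorbed into it.\<close>

definition zhu_series :: "complex \<Rightarrow> int \<Rightarrow> complex fls"
  where "zhu_series d k = fps_to_fls (fps_exp d) * fls_expm1 powi (- k - 1)"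

definition zhu_coeff :: "complex \<Rightarrow> int \<Rightarrow> int \<Rightarrow> complex"
  where "zhu_coeff d k n = fls_nth (zhu_series d k) (- n - 1)"

lemma subdegree_fps_expm1: "subdegree (fps_exp 1 - 1 :: complex fps) = 1"
  by (rule subdegreeI) auto

lemma fls_expm1_nonzero [simp]: "fls_expm1 \<noteq> 0"
proof
  assume "fls_expm1 = 0"
  then have "fps_exp 1 - 1 = (0 :: complex fps)"
    unfolding fls_expm1_def by (metis fps_to_fls_eq_0_iff)
  then show False using subdegree_fps_expm1 by simp
qed

lemma fls_subdegree_expm1 [simp]: "fls_subdegree fls_expm1 = 1"
  unfolding fls_expm1_def by (simp only: fls_subdegree_fls_to_fps subdegree_fps_expm1)

lemma fls_subdegree_zhu_series: "fls_subdegree (zhu_series d k) = - k - 1"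
proof -
  have "fls_subdegree (fps_to_fls (fps_exp d :: complex fps)) = 0"
    by (simp add: fls_subdegree_fls_to_fps subdegree_eq_0_iff)
  then show ?thesis
    unfolding zhu_series_def
    by (subst fls_subdegree_mult) (auto simp: power_int_eq_0_iff)
qed

text \<open>The leading exponent -k-1 makes the change of modes triangular: only u_k with k >= n
  contribute to the n-th mode of Y[u, y]. Together with truncation in k this bounds the sums
  below.\<close>

lemma zhu_coeff_eq_0: "n > k \<Longrightarrow> zhu_coeff d k n = 0"
  unfolding zhu_coeff_def by (rule fls_eq0_below_subdegree) (simp add: fls_subdegree_zhu_series)

lemma zhu_series_mult: "fls_expm1 ^ l * zhu_series d k = zhu_series d (k - int l)"
proof -
  have "fls_expm1 ^ l * fls_expm1 powi (- k - 1) = fls_expm1 powi (int l + (- k - 1))"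
    by (subst power_int_add) auto
  then show ?thesis by (simp add: zhu_series_def mult.left_commute algebra_simps)
qed

lemma zhu_series_exp_mult: "fps_to_fls (fps_exp a) * zhu_series d k = zhu_series (d + a) k"
  by (simp add: zhu_series_def fps_exp_add_mult fls_times_fps_to_fls mult_ac)

lemma zhu_series_shift: "zhu_series (d + 1) k = zhu_series d k + zhu_series d (k - 1)"
proof -
  have "zhu_series (d + 1) k = fps_to_fls (fps_exp 1) * zhu_series d k"
    by (simp add: zhu_series_exp_mult)
  also have "fps_to_fls (fps_exp 1) = 1 + fls_expm1 ^ 1"
    by (simp add: fls_expm1_def)
  finally show ?thesis
    using zhu_series_mult[of 1 d k] by (simp add: ring_distribs)
qed

text \<open>Negative exponents are reduced to positive ones by differentiating the product of f^n
  and f^(-n).\<close>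

lemma fls_deriv_power_int:
  fixes f :: "'a::field fls"
  assumes "f \<noteq> 0"
  shows "fls_deriv (f powi n) = of_int n * f powi (n - 1) * fls_deriv f"
proof -
  have pos: "fls_deriv (f powi int m) = of_int (int m) * f powi (int m - 1) * fls_deriv f" for m
  proof (cases m)
    case (Suc l)
    then have "f powi (int m - 1) = f ^ l" by simp
    then show ?thesis
      unfolding power_int_of_nat fls_deriv_power by (simp add: Suc del: power_Suc of_nat_Suc)
  qed simp
  show ?thesis
  proof (cases "n \<ge> 0")
    case True
    then show ?thesis using pos[of "nat n"] by simp
  next
    case False
    define m where "m = nat (- n)"
    have n: "n = - int m" using False by (simp add: m_def)
    have "f powi n * f powi int m = 1"
      using assms by (simp add: n power_int_minus)
    then have "fls_deriv (f powi n * f powi int m) = 0" by (simp only: fls_deriv_one)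
    then have "fls_deriv (f powi n) * f powi int m = - (f powi n) * fls_deriv (f powi int m)"
      by (simp add: eq_neg_iff_add_eq_0 add.commute)
    then have "fls_deriv (f powi n) * f powi int m * f powi n = - (f powi n) * fls_deriv (f powi int m) * f powi n"
      by simp
    also have "fls_deriv (f powi n) * f powi int m * f powi n = fls_deriv (f powi n)"
      using assms by (simp add: n power_int_minus)
    also have "- (f powi n) * fls_deriv (f powi int m) * f powi n
        = of_int n * (f powi n * f powi n * f powi (int m - 1)) * fls_deriv f"
      unfolding pos by (simp add: n mult_ac)
    also have "f powi n * f powi n * f powi (int m - 1) = f powi (n + n + (int m - 1))"
      by (simp only: power_int_add[OF disjI1[OF assms]])
    also have "n + n + (int m - 1) = n - 1" by (simp add: n)
    finally show ?thesis .
  qed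
qed

lemma fls_deriv_zhu_series:
  "fls_deriv (zhu_series d k) = fls_const d * zhu_series d k - of_int (k + 1) * zhu_series (d + 1) (k + 1)"
proof -
  have dg: "fls_deriv fls_expm1 = fps_to_fls (fps_exp 1)"
    unfolding fls_expm1_def fls_deriv_fps_to_fls by simp
  have de: "fls_deriv (fps_to_fls (fps_exp d)) = fls_const d * fps_to_fls (fps_exp d)"
    by (simp add: fls_deriv_fps_to_fls fls_times_fps_to_fls)
  have "fls_deriv (zhu_series d k) =
      fps_to_fls (fps_exp d) * (of_int (- k - 1) * fls_expm1 powi (- k - 1 - 1) * fps_to_fls (fps_exp 1))
      + fls_const d * fps_to_fls (fps_exp d) * fls_expm1 powi (- k - 1)"
    unfolding zhu_series_def fls_deriv_mult fls_deriv_power_int[OF fls_expm1_nonzero] dg de ..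
  also have "\<dots> = fls_const d * zhu_series d k + of_int (- (k + 1)) * zhu_series (d + 1) (k + 1)"
    by (simp add: zhu_series_def fps_exp_add_mult fls_times_fps_to_fls mult_ac)
  finally show ?thesis by (simp only: of_int_minus) (simp add: algebra_simps)
qed

text \<open>Both sides are the coefficient of y^(-n-1) in the derivative of the series; on the left
  it comes from y^(-n), hence the factor -n and the index n - 1.\<close>

lemma zhu_coeff_deriv:
  "- of_int n * zhu_coeff d k (n - 1) = d * zhu_coeff d k n - of_int (k + 1) * zhu_coeff (d + 1) (k + 1) n"
proof -
  have "fls_nth (fls_deriv (zhu_series d k)) (- n - 1) =
     fls_nth (fls_const d * zhu_series d k - of_int (k + 1) * zhu_series (d + 1) (k + 1)) (- n - 1)"
    by (simp only: fls_deriv_zhu_series)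
  then show ?thesis by (simp add: zhu_coeff_def fls_of_int del: of_int_add)
qed

lemma zhu_coeff_shift: "zhu_coeff (d + 1) k n = zhu_coeff d k n + zhu_coeff d (k - 1) n"
  by (simp add: zhu_coeff_def zhu_series_shift)

text \<open>At z = e^y - 1 the differential equation (1 + z) b' = c b of (1 + z)^c turns into f' = c
  f, which together with the constant term characterises e^(cy).\<close>

lemma fps_binomial_compose_exp: "fps_binomial c oo (fps_exp 1 - 1) = (fps_exp c :: complex fps)"
proof -
  let ?g = "fps_exp 1 - 1 :: complex fps" and ?b = "fps_binomial c :: complex fps"
  have g0: "?g $ 0 = 0" by simp
  have u: "(1 + fps_X :: complex fps) $ 0 \<noteq> 0" by simp
  have "(1 + fps_X) * fps_deriv ?b = fps_const c * ?b"
    unfolding fps_binomial_deriv fps_divide_unit[OF u]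
    using inverse_mult_eq_1[OF u] by (simp add: mult_ac)
  then have "((1 + fps_X) * fps_deriv ?b) oo ?g = (fps_const c * ?b) oo ?g" by simp
  then have *: "fps_exp 1 * (fps_deriv ?b oo ?g) = fps_const c * (?b oo ?g)"
    by (simp add: fps_compose_mult_distrib[OF g0] fps_compose_add_distrib)
  have "fps_deriv (?b oo ?g) = fps_const c * (?b oo ?g)"
    using * by (subst fps_compose_deriv) (auto simp: mult_ac)
  then show ?thesis
    by (subst (asm) fps_exp_unique_ODE) simp
qed

text \<open>Any sufficiently large L is allowed as summation bound, so that several products can
  later be summed over one common range.\<close>

lemma fls_times_fps_nth:
  fixes F :: "'a::field fls"
  assumes "N - fls_subdegree F \<le> int L"
  shows "fls_nth (fps_to_fls h * F) N = (\<Sum>i\<le>L. fps_nth h i * fls_nth F (N - int i))"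
proof -
  let ?h = "fps_to_fls h"
  have "fls_nth (?h * F) N =
      (\<Sum>i = fls_subdegree ?h..N - fls_subdegree F. fls_nth ?h i * fls_nth F (N - i))"
    by (rule fls_times_nth(2))
  also have "\<dots> = (\<Sum>i\<in>int ` {..L}. fls_nth ?h i * fls_nth F (N - i))"
  proof (rule sum.mono_neutral_left)
    show "{fls_subdegree ?h..N - fls_subdegree F} \<subseteq> int ` {..L}"
    proof
      fix i assume "i \<in> {fls_subdegree ?h..N - fls_subdegree F}"
      then have "i \<ge> 0" "i \<le> int L"
        using assms fls_subdegree_fls_to_fps_gt0[of h] by auto
      then show "i \<in> int ` {..L}" by (intro image_eqI[of _ _ "nat i"]) auto
    qed
  next
    show "\<forall>i\<in>int ` {..L} - {fls_subdegree ?h..N - fls_subdegree F}. fls_nth ?h i * fls_nth F (N - i) = 0"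
    proof
      fix i assume "i \<in> int ` {..L} - {fls_subdegree ?h..N - fls_subdegree F}"
      then have "i < fls_subdegree ?h \<or> N - i < fls_subdegree F" by auto
      then show "fls_nth ?h i * fls_nth F (N - i) = 0"
        using fls_eq0_below_subdegree by (metis mult_zero_left mult_zero_right)
    qed
  qed auto
  also have "\<dots> = (\<Sum>i\<le>L. fps_nth h i * fls_nth F (N - int i))"
    by (subst sum.reindex) auto
  finally show ?thesis .
qed

text \<open>The factor e^(ay) expanded in powers of y: n moves and k stays. In
  \<open>zhu_coeff_binomial_shift\<close> the same factor is expanded so that k moves and n
  stays.\<close>

lemma zhu_coeff_exp_shift:
  assumes "k - n \<le> int L"
  shows "zhu_coeff (d + a) k n = (\<Sum>j\<le>L. a ^ j / fact j * zhu_coeff d k (n + int j))"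
proof -
  have "fls_nth (zhu_series (d + a) k) (- n - 1)
      = (\<Sum>j\<le>L. fps_nth (fps_exp a) j * fls_nth (zhu_series d k) (- n - 1 - int j))"
    unfolding zhu_series_exp_mult[symmetric]
    using assms by (intro fls_times_fps_nth) (simp add: fls_subdegree_zhu_series)
  then show ?thesis by (simp add: zhu_coeff_def algebra_simps)
qed

text \<open>Here e^(ay) is written as (1 + (e^y - 1))^a; each factor e^y - 1 lowers k by
  one.\<close>

lemma zhu_coeff_binomial_shift:
  assumes "k - n \<le> int L"
  shows "zhu_coeff (d + a) k n = (\<Sum>l\<le>L. (a gchoose l) * zhu_coeff d (k - int l) n)"
proof -
  let ?g = "fps_exp 1 - 1 :: complex fps" and ?F = "zhu_series d k"
  let ?N = "- n - 1"
  have L: "?N - fls_subdegree ?F \<le> int L"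
    using assms by (simp add: fls_subdegree_zhu_series)
  have g: "fps_to_fls (?g ^ l) = fls_expm1 ^ l" for l
    unfolding fls_expm1_def fps_to_fls_power ..
  \<comment> \<open>As e^y - 1 has no constant term, its l-th power does not reach y^i for l > i.
    The inner sum may therefore run to L for every i, which permits the exchange of the two
    sums.\<close>
  have exp: "fps_nth (fps_exp a) i = (\<Sum>l\<le>L. (a gchoose l) * fps_nth (?g ^ l) i)" if "i \<le> L" for i
  proof -
    have "fps_nth (fps_exp a) i = fps_nth (fps_binomial a oo ?g) i"
      by (simp only: fps_binomial_compose_exp)
    also have "\<dots> = (\<Sum>l = 0..i. (a gchoose l) * fps_nth (?g ^ l) i)"
      unfolding fps_compose_nth by simp
    also have "\<dots> = (\<Sum>l\<le>L. (a gchoose l) * fps_nth (?g ^ l) i)"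
    proof (rule sum.mono_neutral_left)
      show "\<forall>l\<in>{..L} - {0..i}. (a gchoose l) * fps_nth (?g ^ l) i = 0"
        by (auto intro: startsby_zero_power_prefix[rule_format])
    qed (use that in auto)
    finally show ?thesis .
  qed
  have "fls_nth (zhu_series (d + a) k) ?N
      = (\<Sum>i\<le>L. fps_nth (fps_exp a) i * fls_nth ?F (?N - int i))"
    unfolding zhu_series_exp_mult[symmetric] by (rule fls_times_fps_nth[OF L])
  also have "\<dots> = (\<Sum>i\<le>L. \<Sum>l\<le>L. (a gchoose l) * (fps_nth (?g ^ l) i * fls_nth ?F (?N - int i)))"
    by (intro sum.cong refl) (simp add: exp sum_distrib_right mult.assoc del: fps_exp_nth)
  also have "\<dots> = (\<Sum>l\<le>L. (a gchoose l) * (\<Sum>i\<le>L. fps_nth (?g ^ l) i * fls_nth ?F (?N - int i)))"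
    by (subst sum.swap) (simp add: sum_distrib_left)
  also have "\<dots> = (\<Sum>l\<le>L. (a gchoose l) * fls_nth (fls_expm1 ^ l * ?F) ?N)"
    unfolding fls_times_fps_nth[OF L, symmetric] g ..
  finally show ?thesis by (simp add: zhu_coeff_def zhu_series_mult)
qed

text \<open>With g = e^y - 1 the series is g' / g^(k+1). For k = 0 this is a logarithmic derivative,
  whose residue is the order of g; for other k it is the derivative of a multiple of g^(-k) and has
  residue 0.\<close>

lemma zhu_coeff_1_0: "zhu_coeff 1 k 0 = (if k = 0 then 1 else 0)"
proof (cases "k = 0")
  case True
  have "zhu_series 1 0 = fls_deriv fls_expm1 * inverse fls_expm1"
    by (simp only: fls_expm1_def fls_deriv_fps_to_fls zhu_series_def)
       (simp add: power_int_minus)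
  then show ?thesis
    using fls_residue_deriv_times_inverse_eq_subdegree(1)[of fls_expm1] True
    by (simp add: zhu_coeff_def fls_residue_def)
next
  case False
  then show ?thesis using zhu_coeff_deriv[of 0 0 "k - 1"] by simp
qed

text \<open>The substitution z = e^y - 1 turns the residue into that of (1 + z)^(a-1) z^(-k-1). It
  is carried out by splitting off e^((a-1)y) and expanding it in powers of z, of which only the k-th
  survives.\<close>

lemma zhu_coeff_0:
  "zhu_coeff a (int k) 0 = (a - 1) gchoose k"
proof -
  have "zhu_coeff (1 + (a - 1)) (int k) 0 = (\<Sum>l\<le>k. (a - 1 gchoose l) * zhu_coeff 1 (int k - int l) 0)"
    by (rule zhu_coeff_binomial_shift) simp
  also have "\<dots> = (\<Sum>l\<le>k. if l = k then a - 1 gchoose l else 0)"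
    by (intro sum.cong) (auto simp: zhu_coeff_1_0)
  finally show ?thesis by (simp add: sum.delta)
qed

text \<open>The weights a^n / n! restore a factor e^(ay) under the residue, which merely shifts d by
  a. This is why the exponential sum of square-bracket modes collapses to binomial
  coefficients.\<close>

lemma sum_zhu_coeff:
  assumes "k \<le> L"
  shows "(\<Sum>n\<le>L. a ^ n / fact n * zhu_coeff d (int k) (int n)) = (d + a - 1) gchoose k"
  using zhu_coeff_exp_shift[of "int k" 0 L d a] assms by (simp add: zhu_coeff_0)

lemma fps_exp_neg_power_int:
  "fps_to_fls (fps_exp (-1)) powi m = fps_to_fls (fps_exp (- of_int m :: complex))"
proof (cases m)
  case (nonneg l)
  have "fps_to_fls (fps_exp (-1 :: complex)) ^ l = fps_to_fls (fps_exp (of_nat l * (-1)))"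
    by (simp only: fps_exp_power_mult fps_to_fls_power[symmetric])
  then show ?thesis by (simp add: nonneg)
next
  case (neg l)
  have "fps_to_fls (fps_exp (-1 :: complex)) ^ Suc l = fps_to_fls (fps_exp (of_nat (Suc l) * (-1)))"
    by (simp only: fps_exp_power_mult fps_to_fls_power[symmetric])
  moreover have "inverse (fps_to_fls (fps_exp (of_nat (Suc l) * (-1)))) = fps_to_fls (fps_exp (of_nat (Suc l) :: complex))"
  proof (rule inverse_unique)
    have "fps_exp (of_nat (Suc l) * (-1)) * fps_exp (of_nat (Suc l)) = fps_exp (of_nat (Suc l) * (-1) + of_nat (Suc l) :: complex)"
      by (rule fps_exp_add_mult[symmetric])
    also have "\<dots> = 1" by simp
    finally show "fps_to_fls (fps_exp (of_nat (Suc l) * (-1))) * fps_to_fls (fps_exp (of_nat (Suc l) :: complex)) = 1"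
      by (simp only: fls_times_fps_to_fls[symmetric])simp
  qed
  ultimately show ?thesis
    unfolding neg power_int_minus power_int_of_nat by (simp only: of_int_minus of_int_of_nat_eq minus_minus)
qed

text \<open>The substitution y -> -y sends e^y - 1 to -e^(-y) (e^y - 1). The extra exponential,
  raised to the power -k-1, turns d into k + 1 - d.\<close>

lemma zhu_coeff_reflect:
  "(-1) powi (n + 1) * zhu_coeff d k n = (-1) powi (k + 1) * zhu_coeff (of_int (k + 1) - d) k n"
proof -
  let ?H = "fps_const (-1) * fps_X :: complex fps"
  have H1: "?H \<noteq> 0" by simp
  have H2: "?H $ 0 = 0" by simp
  note H = H1 H2
  have e: "fps_exp c oo ?H = fps_exp (- c)" for c :: complex
    by (simp only: fps_exp_compose_linear) simp
  have "fls_compose_fps fls_expm1 ?H = fps_to_fls (fps_exp (- 1) - 1)"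
    unfolding fls_expm1_def fls_compose_fps_to_fls[OF H] fps_compose_sub_distrib e fps_compose_1 ..
  also have "fps_exp (- 1) - 1 = - fps_exp (- 1) * (fps_exp 1 - 1 :: complex fps)"
    using fps_exp_add_mult[of "- 1 :: complex" 1] by (simp add: right_diff_distrib)
  also have "fps_to_fls \<dots> = (-1) * (fps_to_fls (fps_exp (-1)) * fls_expm1)"
    unfolding fls_expm1_def fls_times_fps_to_fls by simp
  finally have g: "fls_compose_fps fls_expm1 ?H = (-1) * (fps_to_fls (fps_exp (-1)) * fls_expm1)" .
  have "fls_compose_fps (zhu_series d k) ?H
     = fps_to_fls (fps_exp (- d)) * ((-1) * (fps_to_fls (fps_exp (-1)) * fls_expm1)) powi (- k - 1)"
    unfolding zhu_series_def fls_compose_fps_mult[OF H] fls_compose_fps_powi[OF H] fls_compose_fps_to_fls[OF H]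
      g e ..
  also have "\<dots> = (-1) powi (- k - 1) * (fps_to_fls (fps_exp (- d)) * fps_to_fls (fps_exp (- of_int (- k - 1))) * fls_expm1 powi (- k - 1))"
    unfolding power_int_mult_distrib fps_exp_neg_power_int by (simp only: mult_ac)
  also have "\<dots> = fls_const ((-1) powi (- k - 1)) * zhu_series (- d + - of_int (- k - 1)) k"
    unfolding zhu_series_def fps_exp_add_mult fls_times_fps_to_fls fls_const_power_int by simp
  finally have "fls_nth (fls_compose_fps (zhu_series d k) ?H) (- n - 1)
     = (-1) powi (- k - 1) * zhu_coeff (of_int (k + 1) - d) k n"
    by (simp add: zhu_coeff_def add.commute)
  moreover have "fls_nth (fls_compose_fps (zhu_series d k) ?H) (- n - 1) = zhu_coeff d k n * (-1) powi (- n - 1)"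
    unfolding zhu_coeff_def by (rule fls_nth_fls_compose_fps_linear) simp
  moreover have "(-1) powi (- m - 1) = ((-1) powi (m + 1) :: complex)" for m
    by (simp add: power_int_minus_left)
  ultimately show ?thesis by (simp only: mult.commute)
qed

lemma polyfun_coeffs_eqI:
  fixes f g :: "nat \<Rightarrow> complex"
  assumes "\<And>x. (\<Sum>n\<le>N. x ^ n / fact n * f n) = (\<Sum>n\<le>N. x ^ n / fact n * g n)" and "n \<le> N"
  shows "f n = g n"
proof -
  have "\<forall>x. (\<Sum>n\<le>N. (f n / fact n) * x ^ n) = (\<Sum>n\<le>N. (g n / fact n) * x ^ n)"
    using assms(1) by (simp add: field_simps)
  then have "\<forall>i\<le>N. f i / fact i = g i / fact i"
    by (subst (asm) polyfun_eq_coeffs)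
  then show ?thesis using assms(2) by simp
qed

text \<open>Multiply by x^t / t! and sum over t. The second factor becomes the binomial coefficient
  of e + x - 1 over j, so the sum over j is a binomial shift of the first factor to d + e + x - 1;
  expanding that in x as an exponential shift gives the right-hand side.\<close>

lemma zhu_coeff_convolution:
  assumes "s - n \<le> int L"
  shows "(\<Sum>j\<le>L. zhu_coeff d (s - int j) n * zhu_coeff e (int j) (int t)) = zhu_coeff (d + e - 1) s (n + int t)"
proof -
  have z: "zhu_coeff e (int j) (int t) = 0" if "j < t" for j
    using that by (intro zhu_coeff_eq_0) auto
  \<comment> \<open>The degree N must reach the t in question and also every j <= L, so that
    \<open>sum_zhu_coeff\<close> applies to the full sum over t.\<close>
  define N where "N = max L t"
  have "(\<Sum>j\<le>L. zhu_coeff d (s - int j) n * zhu_coeff e (int j) (int t)) = zhu_coeff (d + e - 1) s (n + int t)"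
  proof (rule polyfun_coeffs_eqI[where N = N and f = "\<lambda>t. \<Sum>j\<le>L. zhu_coeff d (s - int j) n * zhu_coeff e (int j) (int t)"
        and g = "\<lambda>t. zhu_coeff (d + e - 1) s (n + int t)"])
    fix x :: complex
    have "(\<Sum>t\<le>N. x ^ t / fact t * (\<Sum>j\<le>L. zhu_coeff d (s - int j) n * zhu_coeff e (int j) (int t)))
       = (\<Sum>t\<le>N. \<Sum>j\<le>L. zhu_coeff d (s - int j) n * (x ^ t / fact t * zhu_coeff e (int j) (int t)))"
      by (simp add: sum_distrib_left mult_ac)
    also have "\<dots> = (\<Sum>j\<le>L. zhu_coeff d (s - int j) n * (\<Sum>t\<le>N. x ^ t / fact t * zhu_coeff e (int j) (int t)))"
      by (subst sum.swap) (simp add: sum_distrib_left)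
    also have "\<dots> = (\<Sum>j\<le>L. (e + x - 1 gchoose j) * zhu_coeff d (s - int j) n)"
      by (intro sum.cong refl, subst sum_zhu_coeff) (auto simp: N_def)
    also have "\<dots> = zhu_coeff (d + (e + x - 1)) s n"
      by (rule zhu_coeff_binomial_shift[symmetric, OF assms])
    also have "\<dots> = zhu_coeff (d + e - 1 + x) s n" by (simp add: algebra_simps)
    also have "\<dots> = (\<Sum>t\<le>N. x ^ t / fact t * zhu_coeff (d + e - 1) s (n + int t))"
      using assms by (intro zhu_coeff_exp_shift) (auto simp: N_def)
    finally show "(\<Sum>t\<le>N. x ^ t / fact t * (\<Sum>j\<le>L. zhu_coeff d (s - int j) n * zhu_coeff e (int j) (int t)))
      = (\<Sum>t\<le>N. x ^ t / fact t * zhu_coeff (d + e - 1) s (n + int t))" .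
  qed (simp add: N_def)
  then show ?thesis .
qed

section \<open>Sums with finite support and formal series\<close>

lemma Sum_any_eq_sum:
  assumes "finite A" and "\<And>x. x \<notin> A \<Longrightarrow> f x = 0"
  shows "Sum_any f = sum f A"
  using assms by (intro Sum_any.expand_superset) auto

lemma Sum_any_single:
  assumes "\<And>x. x \<noteq> a \<Longrightarrow> f x = 0"
  shows "Sum_any f = f a"
  using assms by (subst Sum_any_eq_sum[of "{a}"]) auto

lemma Sum_any_nat_less:
  fixes f :: "nat \<Rightarrow> 'b::comm_monoid_add"
  assumes "\<And>i. i \<ge> N \<Longrightarrow> f i = 0"
  shows "Sum_any f = (\<Sum>i<N. f i)"
  using assms by (intro Sum_any_eq_sum) auto

lemma Sum_any_nat_Suc:
  fixes f :: "nat \<Rightarrow> 'b::comm_monoid_add"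
  assumes "finite {i. f i \<noteq> 0}"
  shows "Sum_any f = f 0 + (\<Sum>i. f (Suc i))"
proof -
  obtain N where N: "{i. f i \<noteq> 0} \<subseteq> {..<N}" using assms finite_nat_iff_bounded by blast
  have "Sum_any f = sum f {..<Suc N}" using N by (intro Sum_any_eq_sum) (auto simp: less_Suc_eq)
  also have "\<dots> = f 0 + (\<Sum>i<N. f (Suc i))" by (rule sum.lessThan_Suc_shift)
  also have "(\<Sum>i<N. f (Suc i)) = (\<Sum>i. f (Suc i))"
    using N by (intro Sum_any_eq_sum[symmetric]) (auto dest: subsetD)
  finally show ?thesis .
qed

lemma Sum_any_reindex:
  fixes f :: "'a \<Rightarrow> 'b::comm_monoid_add"
  assumes "inj g" "\<And>x. x \<notin> range g \<Longrightarrow> f x = 0"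
  shows "Sum_any f = (\<Sum>i. f (g i))"
proof -
  have *: "{x. f x \<noteq> 0} = g ` {i. f (g i) \<noteq> 0}"
  proof
    show "{x. f x \<noteq> 0} \<subseteq> g ` {i. f (g i) \<noteq> 0}"
    proof
      fix x assume x: "x \<in> {x. f x \<noteq> 0}"
      then have "x \<in> range g" using assms(2) by blast
      then show "x \<in> g ` {i. f (g i) \<noteq> 0}" using x by blast
    qed
  qed auto
  show ?thesis unfolding Sum_any.expand_set *
    by (subst sum.reindex[OF inj_on_subset[OF assms(1) subset_UNIV]]) simp
qed

lemma Sum_any_hom:
  assumes "\<And>a b. h (a + b) = h a + h b" "h 0 = 0" "finite {x. f x \<noteq> 0}"
  shows "h (Sum_any f) = Sum_any (\<lambda>x. h (f x))"
proof -
  have "h (sum f A) = sum (\<lambda>x. h (f x)) A" if "finite A" for A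
    using that by induction (auto simp: assms)
  moreover have "Sum_any (\<lambda>x. h (f x)) = sum (\<lambda>x. h (f x)) {x. f x \<noteq> 0}"
    using assms by (intro Sum_any_eq_sum) auto
  ultimately show ?thesis
    using assms(3) by (simp add: Sum_any.expand_set)
qed

text \<open>Used where one exponent is prescribed: the exponent k of a delta function or generating
  function is then a function of the binomial index i.\<close>

lemma Sum_any_graph:
  assumes "\<And>k i. k \<noteq> g i \<Longrightarrow> f k i = 0" and "inj g" and "finite {i. f (g i) i \<noteq> 0}"
  shows "Sum_any (\<lambda>k. Sum_any (f k)) = Sum_any (\<lambda>i. f (g i) i)"
proof -
  let ?A = "{i. f (g i) i \<noteq> 0}"
  have inner: "Sum_any (f (g i)) = f (g i) i" for i
  proof (rule Sum_any_single)
    fix j assume "j \<noteq> i"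
    then have "g i \<noteq> g j" using assms(2) by (auto dest: injD)
    then show "f (g i) j = 0" by (rule assms(1))
  qed
  have "Sum_any (\<lambda>k. Sum_any (f k)) = sum (\<lambda>k. Sum_any (f k)) (g ` ?A)"
  proof (rule Sum_any_eq_sum)
    fix k assume k: "k \<notin> g ` ?A"
    have "f k i = 0" for i
      using assms(1)[of k i] k by (cases "k = g i") auto
    then show "Sum_any (f k) = 0" by simp
  qed (use assms(3) in auto)
  also have "\<dots> = sum (\<lambda>i. f (g i) i) ?A"
    using assms(2) by (subst sum.reindex) (auto simp: inner intro: inj_on_subset)
  also have "\<dots> = Sum_any (\<lambda>i. f (g i) i)"
    by (simp add: Sum_any.expand_set)
  finally show ?thesis .
qed

text \<open>The vanishing conditions confine the support to a triangle; the remaining bounds only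
  ensure that both ranges of summation contain it, with s = l + m.\<close>

lemma sum_diagonal:
  fixes f :: "nat \<Rightarrow> int \<Rightarrow> 'b::comm_monoid_add"
  assumes "\<And>l m. m < a \<Longrightarrow> f l m = 0" "\<And>l m. int l + m \<ge> b \<Longrightarrow> f l m = 0"
    and "b - a \<le> int K" "b - a \<le> int L" "b \<le> c"
  shows "(\<Sum>l<K. \<Sum>m\<in>{a..<c}. f l m) = (\<Sum>s\<in>{a..<b}. \<Sum>l<L. f l (s - int l))"
proof -
  let ?A = "{..<K} \<times> {a..<c}" and ?B = "{a..<b} \<times> {..<L}"
  let ?f = "\<lambda>(l, m). f l m" and ?g = "\<lambda>(s, l). f l (s - int l)"
  have supp: "m \<ge> a \<and> int l + m < b" if "f l m \<noteq> 0" for l m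
    using assms(1,2) that by (metis not_le not_less)
  have "sum ?f ?A = sum ?f {x\<in>?A. ?f x \<noteq> 0}"
    by (rule sum.mono_neutral_right) auto
  also have "\<dots> = sum ?g {x\<in>?B. ?g x \<noteq> 0}"
  proof (rule sum.reindex_bij_witness[of _ "\<lambda>(s, l). (l, s - int l)" "\<lambda>(l, m). (int l + m, l)"])
    fix x assume x: "x \<in> {x\<in>?A. ?f x \<noteq> 0}"
    obtain l m where lm: "x = (l, m)" by (cases x)
    with x have f: "f l m \<noteq> 0" by simp
    show "(case x of (l, m) \<Rightarrow> (int l + m, l)) \<in> {x\<in>?B. ?g x \<noteq> 0}"
      using supp[OF f] f assms(4) by (simp add: lm)
  next
    fix x assume x: "x \<in> {x\<in>?B. ?g x \<noteq> 0}"
    obtain s l where sl: "x = (s, l)" by (cases x)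
    with x have f: "f l (s - int l) \<noteq> 0" by simp
    show "(case x of (s, l) \<Rightarrow> (l, s - int l)) \<in> {x\<in>?A. ?f x \<noteq> 0}"
      using supp[OF f] f assms(3,5) by (simp add: sl)
  qed auto
  also have "\<dots> = sum ?g ?B"
    by (rule sum.mono_neutral_left) auto
  finally have "sum ?f ?A = sum ?g ?B" .
  then show ?thesis by (simp add: sum.cartesian_product)
qed

lemma sum_int_nat:
  "(\<Sum>m\<in>{int a..<int b}. f m) = (\<Sum>k\<in>{a..<b}. f (int k))"
  by (rule sum.reindex_bij_witness[of _ int nat]) auto

lemma sum_triangle_box:
  fixes f :: "nat \<Rightarrow> nat \<Rightarrow> 'b::comm_monoid_add"
  assumes "\<And>n l. n + l \<ge> S \<Longrightarrow> f n l = 0"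
  shows "(\<Sum>s<S. \<Sum>l\<le>s. f (s - l) l) = (\<Sum>n<S. \<Sum>l<S. f n l)"
proof -
  have "(\<Sum>(l, n)\<in>{(l, n). l + n < S}. f n l) = (\<Sum>s<S. \<Sum>l\<le>s. f (s - l) l)"
    by (rule sum.triangle_reindex)
  then have "(\<Sum>s<S. \<Sum>l\<le>s. f (s - l) l) = (\<Sum>(l, n)\<in>{(l, n). l + n < S}. f n l)" ..
  also have "\<dots> = (\<Sum>(l, n)\<in>{..<S} \<times> {..<S}. f n l)"
  proof (rule sum.mono_neutral_left)
    show "\<forall>x\<in>{..<S} \<times> {..<S} - {(l, n). l + n < S}. (case x of (l, n) \<Rightarrow> f n l) = 0"
    proof
      fix x assume "x \<in> {..<S} \<times> {..<S} - {(l, n). l + n < S}"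
      then obtain l n where "x = (l, n)" "n + l \<ge> S" by (auto simp: add.commute)
      then show "(case x of (l, n) \<Rightarrow> f n l) = 0" by (simp add: assms)
    qed
  qed auto
  also have "\<dots> = (\<Sum>n<S. \<Sum>l<S. f n l)"
    by (subst sum.swap) (simp add: sum.cartesian_product)
  finally show ?thesis .
qed

lemma sum_fun_apply: "sum F A x = (\<Sum>i\<in>A. F i x)"
  by (induction A rule: infinite_finite_induct) auto

lemma power_int_root_shift:
  fixes \<zeta> :: "'a::field"
  assumes "\<zeta> ^ p = 1"
  shows "(\<zeta> ^ r) powi (m + int p * k) = (\<zeta> ^ r) powi m"
proof (cases "\<zeta> = 0 \<or> r = 0")
  case True
  then show ?thesis using assms by (cases "p = 0") (auto simp: zero_power)
next
  case False
  have "(\<zeta> ^ r) powi (int p * k) = ((\<zeta> ^ p) ^ r) powi k"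
    by (simp add: power_int_mult flip: power_mult) (simp add: mult.commute)
  then show ?thesis using False assms by (simp add: power_int_add)
qed

section \<open>Coefficients of generating functions and of their compositions\<close>

lemma fvertex_fmono:
  assumes "\<And>e. e x \<noteq> 0 \<Longrightarrow> F e = 0" and "\<And>n. a n 0 = 0"
  shows "fvertex a (fmono x) F e = a (- e x - 1) (F (e(x := 0)))"
proof -
  have "fvertex a (fmono x) F e = (\<Sum>n. a n (F (e(x := e x - (- n - 1)))))"
    by (simp add: fvertex_def fsum_def fmono_def)
  also have "\<dots> = a (- e x - 1) (F (e(x := e x - (- (- e x - 1) - 1))))"
  proof (rule Sum_any_single)
    fix n assume "n \<noteq> - e x - 1"
    then have "F (e(x := e x - (- n - 1))) = 0" by (intro assms(1)) auto
    then show "a n (F (e(x := e x - (- n - 1)))) = 0" by (simp only: assms(2))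
  qed
  finally show ?thesis by simp
qed

lemma Sum_any_of_int:
  fixes g :: "rat \<Rightarrow> 'a::comm_monoid_add"
  assumes "\<And>q. q \<notin> \<int> \<Longrightarrow> g q = 0"
  shows "Sum_any g = (\<Sum>n. g (of_int n))"
proof -
  have *: "{q. g q \<noteq> 0} = of_int ` {n. g (of_int n) \<noteq> 0}"
  proof
    show "{q. g q \<noteq> 0} \<subseteq> of_int ` {n. g (of_int n) \<noteq> 0}"
    proof
      fix q assume q: "q \<in> {q. g q \<noteq> 0}"
      then have "q \<in> \<int>" using assms by blast
      then obtain n where "q = of_int n" by (rule Ints_cases)
      then show "q \<in> of_int ` {n. g (of_int n) \<noteq> 0}" using q by blast
    qed
  qed auto
  have inj: "inj_on (of_int :: int \<Rightarrow> rat) A" for A by (auto simp: inj_on_def)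
  show ?thesis
    unfolding Sum_any.expand_set * by (subst sum.reindex[OF inj]) simp
qed

text \<open>Integer modes extended by zero to rational indices, so that integral and fractional
  powers of a variable are covered by the same lemmas.\<close>

definition rat_mode :: "(int \<Rightarrow> 'a \<Rightarrow> 'b::zero) \<Rightarrow> rat \<Rightarrow> 'a \<Rightarrow> 'b"
  where "rat_mode a q v = (if q \<in> \<int> then a \<lfloor>q\<rfloor> v else 0)"

lemma rat_mode_of_int [simp]: "rat_mode a (of_int n) v = a n v"
  by (simp add: rat_mode_def)

lemma rat_mode_0: "(\<And>n. a n 0 = 0) \<Longrightarrow> rat_mode a q 0 = 0"
  by (simp add: rat_mode_def)

lemma fvertex_of_int:
  fixes P :: "rat \<Rightarrow> 'b::comm_monoid_add fseries \<Rightarrow> 'b fseries"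
  assumes "\<And>q. P q (\<lambda>_. 0) = (\<lambda>_. 0)"
  shows "fvertex a (\<lambda>k. P (of_int k)) F = fvertex (rat_mode a) P F"
proof
  fix e
  let ?g = "\<lambda>q. P (- q - 1) (\<lambda>e. rat_mode a q (F e)) e"
  have "fvertex (rat_mode a) P F e = Sum_any ?g"
    unfolding fvertex_def fsum_def ..
  also have "\<dots> = (\<Sum>n. ?g (of_int n))"
  proof (rule Sum_any_of_int)
    fix q :: rat assume "q \<notin> \<int>"
    then have "(\<lambda>e. rat_mode a q (F e)) = (\<lambda>_. 0)" by (simp add: rat_mode_def)
    then show "?g q = 0" by (simp only: assms)
  qed
  also have "\<dots> = fvertex a (\<lambda>k. P (of_int k)) F e"
    unfolding fvertex_def fsum_def rat_mode_of_int
    by (simp only: of_int_diff of_int_minus of_int_1)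
  finally show "fvertex a (\<lambda>k. P (of_int k)) F e = fvertex (rat_mode a) P F e" ..
qed

lemma fvertex_fmono_int: "fvertex a (fmono_int x) F = fvertex (rat_mode a) (fmono x) F"
  unfolding fmono_int_def[abs_def] by (rule fvertex_of_int) (simp add: fmono_def)

lemma fun_upd_eq_zero_iff: "(e :: 'a \<Rightarrow> rat)(x := 0) = 0 \<longleftrightarrow> (\<forall>z. z \<noteq> x \<longrightarrow> e z = 0)"
  by (auto simp: fun_eq_iff)

lemma fvertex_fmono_fconst:
  assumes "\<And>n. a n 0 = 0"
  shows "fvertex a (fmono x) (fconst w) e = (if \<forall>z. z \<noteq> x \<longrightarrow> e z = 0 then a (- e x - 1) w else 0)"
  using assms by (subst fvertex_fmono) (auto simp: fconst_def fun_upd_eq_zero_iff)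

lemma fvertex_fvertex_fconst:
  assumes "\<And>n. a n 0 = 0" "\<And>n. b n 0 = 0" "x \<noteq> y"
  shows "fvertex a (fmono x) (fvertex b (fmono y) (fconst w)) e =
    (if \<forall>z. z \<noteq> x \<and> z \<noteq> y \<longrightarrow> e z = 0 then a (- e x - 1) (b (- e y - 1) w) else 0)"
proof -
  have "fvertex a (fmono x) (fvertex b (fmono y) (fconst w)) e =
      a (- e x - 1) (fvertex b (fmono y) (fconst w) (e(x := 0)))"
    using assms by (intro fvertex_fmono) (auto simp: fvertex_fmono_fconst)
  also have "\<dots> = (if \<forall>z. z \<noteq> x \<and> z \<noteq> y \<longrightarrow> e z = 0 then a (- e x - 1) (b (- e y - 1) w) else 0)"
    using assms by (auto simp: fvertex_fmono_fconst)
  finally show ?thesis .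
qed

text \<open>The inner series involves only z and the outer one only y, so exactly one splitting of
  the exponent e into an inner and an outer part contributes.\<close>

lemma flin_fvertex_fconst:
  assumes A: "\<And>n. A n 0 = 0" and B: "\<And>n. B 0 n w = 0" "\<And>a n. B a n 0 = 0" and "y \<noteq> z"
  shows "flin (\<lambda>a. fvertex (B a) (fmono y) (fconst w)) (fvertex A (fmono z) (fconst v)) e =
    (if \<forall>x. x \<noteq> y \<and> x \<noteq> z \<longrightarrow> e x = 0 then B (A (- e z - 1) v) (- e y - 1) w else 0)"
proof -
  let ?d = "(\<lambda>_. 0)(z := e z)"
  let ?f = "\<lambda>d. fvertex (B (fvertex A (fmono z) (fconst v) d)) (fmono y) (fconst w) (e - d)"
  have "Sum_any ?f = ?f ?d"
  proof (rule Sum_any_single)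
    fix d assume d: "d \<noteq> ?d"
    show "?f d = 0"
    proof (cases "\<forall>x. x \<noteq> z \<longrightarrow> d x = 0")
      case True
      have "d z \<noteq> e z"
      proof
        assume "d z = e z"
        have "d x = ?d x" for x
        proof (cases "x = z")
          case True
          show ?thesis unfolding True fun_upd_same by (rule \<open>d z = e z\<close>)
        next
          case False
          then have "d x = 0" using \<open>\<forall>x. x \<noteq> z \<longrightarrow> d x = 0\<close> by blast
          then show ?thesis unfolding fun_upd_other[OF False] .
        qed
        then have "d = ?d" by (rule ext)
        with d show False by contradiction
      qed
      then have "(e - d) z \<noteq> 0" by simp
      then have "\<not> (\<forall>x. x \<noteq> y \<longrightarrow> (e - d) x = 0)" using not_sym[OF assms(4)] by blast
      then show ?thesis using B(2) by (simp only: fvertex_fmono_fconst if_False)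
    next
      case False
      then have "fvertex A (fmono z) (fconst v) d = 0" using A by (simp only: fvertex_fmono_fconst if_False)
      then show ?thesis using B by (simp add: fvertex_fmono_fconst)
    qed
  qed
  also have "?f ?d = (if \<forall>x. x \<noteq> y \<and> x \<noteq> z \<longrightarrow> e x = 0 then B (A (- e z - 1) v) (- e y - 1) w else 0)"
  proof -
    have 1: "fvertex A (fmono z) (fconst v) ?d = A (- e z - 1) v"
      unfolding fvertex_fmono_fconst[of A, OF A] by simp
    have 2: "(\<forall>x. x \<noteq> y \<longrightarrow> (e - ?d) x = 0) \<longleftrightarrow> (\<forall>x. x \<noteq> y \<and> x \<noteq> z \<longrightarrow> e x = 0)"
    proof -
      have "(e - ?d) z = 0" and "\<And>x. x \<noteq> z \<Longrightarrow> (e - ?d) x = e x" by simp_all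
      then show ?thesis by metis
    qed
    have 3: "(e - ?d) y = e y" using assms(4) by simp
    show ?thesis
      unfolding 1 fvertex_fmono_fconst[of "B (A (- e z - 1) v)", OF B(2)] 2 3 ..
  qed
  finally show ?thesis by (simp add: flin_def fsum_def)
qed

lemma fexp_eval:
  fixes F :: "'a::comm_monoid_add fseries"
  shows "fexp s q x F e = (\<Sum>j::nat. s (of_rat q ^ j / fact j) (F (e(x := e x - of_nat j))))"
  by (simp add: fexp_def fsum_def fscale_def fmono_def)

text \<open>Both V and M are instances, so the expansions of delta functions and binomials are
  treated once for the two scalar multiplications.\<close>

locale complex_vector_space = vector_space scale
  for scale :: "complex \<Rightarrow> 'a::ab_group_add \<Rightarrow> 'a"  (infixr \<open>*s\<close> 75)
begin

lemma scale_Sum_any: "c *s Sum_any f = (\<Sum>i. c *s f i)"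
proof (cases "c = 0")
  case False
  then have "{i. c *s f i \<noteq> 0} = {i. f i \<noteq> 0}" by auto
  then show ?thesis by (simp add: Sum_any.expand_set scale_sum_right)
qed simp

text \<open>Only the delta function supplies powers of z, so the coefficient of z^(-1-K) selects its
  single K-th term. The case K = 0 gives commutators, the case K = -1 is used with the
  vacuum.\<close>

lemma fmono_delta_diff:
  assumes F: "\<And>e. e z \<noteq> 0 \<Longrightarrow> F e = 0" and e: "e z = - 1 - of_int K"
    and xyz: "x \<noteq> z" "y \<noteq> z" "x \<noteq> y"
  shows "fmono z (- 1) (fdelta scale c 1 (\<lambda>q F. fbinom scale x c' y q (fmono z (- q) F)) F) e =
    (\<Sum>i. (c powi K * (of_int K gchoose i) * c' ^ i) *s
       F (e(z := 0, x := e x - (of_int K - of_nat i), y := e y - of_nat i)))"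
proof -
  let ?e = "\<lambda>k i. e(z := e z + 1 + of_int k, x := e x - (of_int k - of_nat i), y := e y - of_nat i)"
  have "fmono z (- 1) (fdelta scale c 1 (\<lambda>q F. fbinom scale x c' y q (fmono z (- q) F)) F) e =
    (\<Sum>k::int. c powi k *s (\<Sum>i::nat. ((of_int k gchoose i) * c' ^ i) *s F (?e k i)))"
    using xyz
    by (simp add: fmono_def fdelta_def fbinom_def fsum_def fscale_def fun_upd_twist[of z] fun_upd_twist[of y x])
  also have "\<dots> = c powi K *s (\<Sum>i::nat. ((of_int K gchoose i) * c' ^ i) *s F (?e K i))"
  proof (rule Sum_any_single)
    fix k assume "k \<noteq> K"
    then have "F (?e k i) = 0" for i :: nat
      using xyz by (intro F) (simp add: e)
    then show "c powi k *s (\<Sum>i::nat. ((of_int k gchoose i) * c' ^ i) *s F (?e k i)) = 0"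
      by simp
  qed
  finally show ?thesis by (simp add: e scale_Sum_any mult_ac)
qed

text \<open>The series G contains no x, so the whole power of x stems from (x + c' z)^(k/p): from
  k/p - i = e x follows k = m + p i, one k for each binomial index i.\<close>

lemma fmono_delta_iterate:
  assumes G: "\<And>e. e x \<noteq> 0 \<Longrightarrow> G e = 0" and e: "of_nat p * e x = of_int m" and p: "p > 0"
    and xyz: "x \<noteq> z" "y \<noteq> z" "x \<noteq> y"
    and fin: "finite {i. G (e(x := 0, y := e y + 1 + e x + of_nat i, z := e z - of_nat i)) \<noteq> 0}"
  shows "fmono y (- 1) (fdelta scale c p (\<lambda>q F. fbinom scale x c' z q (fmono y (- q) F)) G) e =
    (\<Sum>i. (c powi (m + int p * int i) * (of_rat (e x + of_nat i) gchoose i) * c' ^ i) *s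
       G (e(x := 0, y := e y + 1 + e x + of_nat i, z := e z - of_nat i)))"
proof -
  let ?q = "\<lambda>k. of_int k / of_nat p :: rat"
  let ?e = "\<lambda>k i. e(x := e x - (?q k - of_nat i), y := e y + 1 + ?q k, z := e z - of_nat i)"
  let ?f = "\<lambda>k i. c powi k *s ((of_rat (?q k) gchoose i) * c' ^ i) *s G (?e k i)"
  let ?g = "\<lambda>i. m + int p * int i"
  have q: "?q (?g i) = e x + of_nat i" for i
    using e p by (simp add: field_simps)
  have eg: "?e (?g i) i = e(x := 0, y := e y + 1 + e x + of_nat i, z := e z - of_nat i)" for i
    unfolding q by (simp add: add.assoc)
  have "fmono y (- 1) (fdelta scale c p (\<lambda>q F. fbinom scale x c' z q (fmono y (- q) F)) G) e =
    (\<Sum>k::int. \<Sum>i::nat. ?f k i)"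
    using xyz
    by (simp add: fmono_def fdelta_def fbinom_def fsum_def fscale_def fun_upd_twist[of z] fun_upd_twist[of y x]
        fun_upd_twist[of z x] fun_upd_twist[of z y] scale_Sum_any)
  also have "\<dots> = (\<Sum>i. ?f (?g i) i)"
  proof (rule Sum_any_graph)
    fix k i assume "k \<noteq> ?g i"
    then have "(of_int k :: rat) \<noteq> of_int (?g i)" by (simp only: of_int_eq_iff not_False_eq_True)
    then have "?q k \<noteq> ?q (?g i)" using p by (simp only: divide_cancel_right) simp
    then have "e x - (?q k - of_nat i) \<noteq> 0" unfolding q by simp
    then have "G (?e k i) = 0" using xyz by (intro G) simp
    then show "?f k i = 0" by simp
  next
    show "inj ?g" using p by (auto simp: inj_on_def)
  next
    show "finite {i. ?f (?g i) i \<noteq> 0}"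
      using fin by (rule rev_finite_subset) (auto simp only: eg scale_zero_right mem_Collect_eq)
  qed
  also have "\<dots> = (\<Sum>i. (c powi (m + int p * int i) * (of_rat (e x + of_nat i) gchoose i) * c' ^ i) *s
       G (e(x := 0, y := e y + 1 + e x + of_nat i, z := e z - of_nat i)))"
    by (rule Sum_any.cong) (simp only: eg, simp only: q scale_scale mult.assoc)
  finally show ?thesis .
qed

end

section \<open>Modes of a vertex operator algebra\<close>

sublocale graded_vector_space \<subseteq> complex_vector_space s ..

context vertex_operator_algebra
begin

abbreviation vsc (infixr \<open>\<cdot>\<close> 75)
  where "c \<cdot> v \<equiv> vscale V c v"

lemma vmode_add_left: "vmode V (u + u') n w = vmode V u n w + vmode V u' n w"
  and vmode_scale_left: "vmode V (c \<cdot> u) n w = c \<cdot> vmode V u n w"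
  using vmode_linear_left[of n w] unfolding Vector_Spaces.linear_iff by auto

lemma vmode_add_right: "vmode V u n (w + w') = vmode V u n w + vmode V u n w'"
  and vmode_scale_right: "vmode V u n (c \<cdot> w) = c \<cdot> vmode V u n w"
  using vmode_linear_right[of u n] unfolding Vector_Spaces.linear_iff by auto

lemma vmode_0_left [simp]: "vmode V 0 n w = 0"
  using vmode_scale_left[of 0 0] by simp

lemma vmode_0_right [simp]: "vmode V u n 0 = 0"
  using vmode_scale_right[of u n 0 0] by simp

lemma vmode_commutator:
  "vmode V u m (vmode V v n w) - vmode V v n (vmode V u m w) =
    (\<Sum>i::nat. (of_int m gchoose i) \<cdot> vmode V (vmode V u (int i) v) (m + n - int i) w)"
proof -
  \<comment> \<open>The exponent -1 of x_0 is the residue: it leaves the zeroth power of x_1 - x_2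
    in both products, hence the plain commutator. The exponents -m-1 and -n-1 select the modes m and
    n.\<close>
  define e :: "fvar \<Rightarrow> rat" where "e = (\<lambda>_. 0)(X0 := - 1, X1 := of_int (- m - 1), X2 := of_int (- n - 1))"
  have e: "e X0 = - 1" "e X1 = of_int (- m - 1)" "e X2 = of_int (- n - 1)" "e Y0 = 0" "e Y1 = 0" "e Y2 = 0"
    by (simp_all add: e_def)
  have vars: "(\<forall>z. z \<noteq> X1 \<and> z \<noteq> X2 \<longrightarrow> P z) \<longleftrightarrow> P X0 \<and> P Y0 \<and> P Y1 \<and> P Y2"
     "(\<forall>z. z \<noteq> X2 \<and> z \<noteq> X1 \<longrightarrow> P z) \<longleftrightarrow> P X0 \<and> P Y0 \<and> P Y1 \<and> P Y2"
     "(\<forall>z. z \<noteq> X2 \<and> z \<noteq> X0 \<longrightarrow> P z) \<longleftrightarrow> P X1 \<and> P Y0 \<and> P Y1 \<and> P Y2" for P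
    by (metis fvar.exhaust fvar.distinct)+
  let ?F = "fvertex (vmode V u) (fmono_int X1) (fvertex (vmode V v) (fmono_int X2) (fconst w))"
  let ?G = "fvertex (vmode V v) (fmono_int X2) (fvertex (vmode V u) (fmono_int X1) (fconst w))"
  let ?H = "flin (\<lambda>a. fvertex (vmode V a) (fmono_int X2) (fconst w)) (fvertex (vmode V u) (fmono_int X0) (fconst v))"
  have F: "?F e' = (if \<forall>z. z \<noteq> X1 \<and> z \<noteq> X2 \<longrightarrow> e' z = 0
      then rat_mode (vmode V u) (- e' X1 - 1) (rat_mode (vmode V v) (- e' X2 - 1) w) else 0)" for e'
    unfolding fvertex_fmono_int by (rule fvertex_fvertex_fconst) (simp_all add: rat_mode_def)
  have G: "?G e' = (if \<forall>z. z \<noteq> X2 \<and> z \<noteq> X1 \<longrightarrow> e' z = 0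
      then rat_mode (vmode V v) (- e' X2 - 1) (rat_mode (vmode V u) (- e' X1 - 1) w) else 0)" for e'
    unfolding fvertex_fmono_int by (rule fvertex_fvertex_fconst) (simp_all add: rat_mode_def)
  have H: "?H e' = (if \<forall>z. z \<noteq> X2 \<and> z \<noteq> X0 \<longrightarrow> e' z = 0
      then rat_mode (vmode V (rat_mode (vmode V u) (- e' X0 - 1) v)) (- e' X2 - 1) w else 0)" for e'
    unfolding fvertex_fmono_int by (rule flin_fvertex_fconst) (simp_all add: rat_mode_def)
  have 1: "fmono X0 (- 1) (fdelta (vscale V) 1 1 (\<lambda>q F. fbinom (vscale V) X1 (- 1) X2 q (fmono X0 (- q) F)) ?F) e
      = vmode V u m (vmode V v n w)"
  proof -
    have "fmono X0 (- 1) (fdelta (vscale V) 1 1 (\<lambda>q F. fbinom (vscale V) X1 (- 1) X2 q (fmono X0 (- q) F)) ?F) e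
      = (\<Sum>i. (1 powi 0 * (of_int 0 gchoose i) * (- 1) ^ i) \<cdot>
       ?F (e(X0 := 0, X1 := e X1 - (of_int 0 - of_nat i), X2 := e X2 - of_nat i)))"
      by (rule fmono_delta_diff) (auto simp: F vars e)
    also have "\<dots> = (1 powi 0 * (of_int 0 gchoose 0) * (- 1) ^ 0) \<cdot>
       ?F (e(X0 := 0, X1 := e X1 - (of_int 0 - of_nat 0), X2 := e X2 - of_nat 0))"
      by (rule Sum_any_single) (simp add: gbinomial_0_left)
    also have "\<dots> = vmode V u m (vmode V v n w)"
      using rat_mode_of_int[of "vmode V u" m] rat_mode_of_int[of "vmode V v" n]
      by (simp add: F vars e del: rat_mode_of_int)
    finally show ?thesis .
  qed
  have 2: "fmono X0 (- 1) (fdelta (vscale V) (-1) 1 (\<lambda>q F. fbinom (vscale V) X2 (- 1) X1 q (fmono X0 (- q) F)) ?G) e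
      = vmode V v n (vmode V u m w)"
  proof -
    have "fmono X0 (- 1) (fdelta (vscale V) (-1) 1 (\<lambda>q F. fbinom (vscale V) X2 (- 1) X1 q (fmono X0 (- q) F)) ?G) e
      = (\<Sum>i. ((-1) powi 0 * (of_int 0 gchoose i) * (- 1) ^ i) \<cdot>
       ?G (e(X0 := 0, X2 := e X2 - (of_int 0 - of_nat i), X1 := e X1 - of_nat i)))"
      by (rule fmono_delta_diff) (auto simp: G vars e)
    also have "\<dots> = ((-1) powi 0 * (of_int 0 gchoose 0) * (- 1) ^ 0) \<cdot>
       ?G (e(X0 := 0, X2 := e X2 - (of_int 0 - of_nat 0), X1 := e X1 - of_nat 0))"
      by (rule Sum_any_single) (simp add: gbinomial_0_left)
    also have "\<dots> = vmode V v n (vmode V u m w)"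
      using rat_mode_of_int[of "vmode V u" m] rat_mode_of_int[of "vmode V v" n]
      by (simp add: G vars e del: rat_mode_of_int)
    finally show ?thesis .
  qed
  have H': "?H (e(X1 := 0, X2 := e X2 + 1 + e X1 + of_nat i, X0 := e X0 - of_nat i)) =
      vmode V (vmode V u (int i) v) (m + n - int i) w" for i
    using rat_mode_of_int[of "vmode V u" "int i"] rat_mode_of_int[of "vmode V (vmode V u (int i) v)" "m + n - int i"]
    by (simp add: H vars e algebra_simps del: rat_mode_of_int)
  have 3: "fmono X2 (- 1) (fdelta (vscale V) 1 1 (\<lambda>q F. fbinom (vscale V) X1 (- 1) X0 q (fmono X2 (- q) F)) ?H) e
      = (\<Sum>i::nat. (of_int m gchoose i) \<cdot> vmode V (vmode V u (int i) v) (m + n - int i) w)"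
  proof -
    obtain N where N: "\<And>n. n \<ge> N \<Longrightarrow> vmode V u n v = 0" using vmode_truncation by blast
    have fin: "finite {i. vmode V (vmode V u (int i) v) (m + n - int i) w \<noteq> 0}"
    proof (rule finite_subset)
      show "{i. vmode V (vmode V u (int i) v) (m + n - int i) w \<noteq> 0} \<subseteq> {..<nat N}"
      proof
        fix i assume "i \<in> {i. vmode V (vmode V u (int i) v) (m + n - int i) w \<noteq> 0}"
        then have "vmode V u (int i) v \<noteq> 0" by auto
        then have "int i < N" using N[of "int i"] by linarith
        then show "i \<in> {..<nat N}" by simp
      qed
    qed simp
    have "fmono X2 (- 1) (fdelta (vscale V) 1 1 (\<lambda>q F. fbinom (vscale V) X1 (- 1) X0 q (fmono X2 (- q) F)) ?H) e
      = (\<Sum>i. (1 powi (- m - 1 + int 1 * int i) * (of_rat (e X1 + of_nat i) gchoose i) * (- 1) ^ i) \<cdot>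
       ?H (e(X1 := 0, X2 := e X2 + 1 + e X1 + of_nat i, X0 := e X0 - of_nat i)))"
    proof (rule fmono_delta_iterate)
      show "finite {i. ?H (e(X1 := 0, X2 := e X2 + 1 + e X1 + of_nat i, X0 := e X0 - of_nat i)) \<noteq> 0}"
        using fin by (simp only: H')
    qed (auto simp: H vars e)
    also have "\<dots> = (\<Sum>i::nat. (of_int m gchoose i) \<cdot> vmode V (vmode V u (int i) v) (m + n - int i) w)"
    proof (rule Sum_any.cong)
      fix i
      \<comment> \<open>The upper entry is i - m - 1; upper negation turns it into m and absorbs the
        sign of x_1 - x_0.\<close>
      have "(of_rat (e X1 + of_nat i) gchoose i) * (- 1) ^ i = (of_int m gchoose i :: complex)"
        using gbinomial_minus[of "- of_int m :: complex" i] by (simp add: e of_rat_add of_rat_diff of_rat_minus algebra_simps)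
      then show "(1 powi (- m - 1 + int 1 * int i) * (of_rat (e X1 + of_nat i) gchoose i) * (- 1) ^ i) \<cdot>
       ?H (e(X1 := 0, X2 := e X2 + 1 + e X1 + of_nat i, X0 := e X0 - of_nat i)) =
       (of_int m gchoose i) \<cdot> vmode V (vmode V u (int i) v) (m + n - int i) w"
        unfolding H' by (simp only: power_int_1_left mult_1)
    qed
    finally show ?thesis .
  qed
  show ?thesis
    using fun_cong[OF jacobi[of u v w], of e] unfolding minus_apply 1 2 3 .
qed

lemma vmode_sum_right: "vmode V u n (sum f A) = (\<Sum>i\<in>A. vmode V u n (f i))"
  by (induction A rule: infinite_finite_induct) (auto simp: vmode_add_right)

lemma voa_L_add: "voa_L V n (u + v) = voa_L V n u + voa_L V n v"
  and voa_L_scale: "voa_L V n (c \<cdot> u) = c \<cdot> voa_L V n u"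
  and voa_L_0: "voa_L V n 0 = 0"
  and voa_L_sum: "voa_L V n (sum f A) = (\<Sum>i\<in>A. voa_L V n (f i))"
  by (simp_all add: voa_L_def vmode_add_right vmode_scale_right vmode_sum_right)

section \<open>Weight decomposition and eigenspaces of L(0)\<close>

lemma decompose:
  obtains f where "decomposes (vgrade V) u f"
  using graded_direct_sum unfolding direct_sum_def by blast

lemma decomposes_unique: "decomposes (vgrade V) u f \<Longrightarrow> decomposes (vgrade V) u g \<Longrightarrow> f = g"
  using graded_direct_sum unfolding direct_sum_def by blast

lemma component_eq: "decomposes (vgrade V) u f \<Longrightarrow> component (vgrade V) u = f"
  unfolding component_def by (rule the_equality) (auto intro: decomposes_unique)

lemma zero_grade: "0 \<in> vgrade V d"
  using graded_subspace subspace_0 by blast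

text \<open>Additive statements reduce to homogeneous vectors, for which e^(y L(0)) is a scalar and
  explicit coefficients are available.\<close>

lemma graded_induct:
  assumes "\<And>d u. u \<in> vgrade V d \<Longrightarrow> P u" and "\<And>u v. P u \<Longrightarrow> P v \<Longrightarrow> P (u + v)"
  shows "P u"
proof -
  obtain f where f: "decomposes (vgrade V) u f" by (rule decompose)
  have "P (\<Sum>i\<in>A. f i)" if "finite A" for A
    using that
  proof induction
    case empty
    then show ?case using assms(1)[OF zero_grade] by simp
  next
    case (insert i A)
    moreover have "P (f i)" using f assms(1) unfolding decomposes_def by blast
    ultimately show ?case by (simp add: assms(2))
  qed
  then show ?thesis using f unfolding decomposes_def by metis
qed

text \<open>Decomposing (L(0) - d) u = 0 and using uniqueness of the decomposition forces (i - d)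
  f_i = 0 in every weight i. Weights of products and images under \<nu> then follow from commutation
  with L(0).\<close>

lemma grade_iff: "u \<in> vgrade V d \<longleftrightarrow> voa_L V 0 u = of_int d \<cdot> u"
proof
  assume u: "voa_L V 0 u = of_int d \<cdot> u"
  obtain f where f: "decomposes (vgrade V) u f" by (rule decompose)
  let ?S = "{i. f i \<noteq> 0}"
  have fin: "finite ?S" and mem: "f i \<in> vgrade V i" and sum: "u = (\<Sum>i\<in>?S. f i)" for i
    using f unfolding decomposes_def by blast+
  let ?g = "\<lambda>i. (of_int i - of_int d) \<cdot> f i"
  have "voa_L V 0 u = (\<Sum>i\<in>?S. of_int i \<cdot> f i)"
    by (subst sum) (simp add: voa_L_sum L0_grade[OF mem])
  moreover have "of_int d \<cdot> u = (\<Sum>i\<in>?S. of_int d \<cdot> f i)"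
    by (subst sum) (simp add: scale_sum_right)
  ultimately have "(\<Sum>i\<in>?S. ?g i) = 0"
    using u by (simp add: scale_left_diff_distrib sum_subtractf)
  moreover have "(\<Sum>i\<in>?S. ?g i) = (\<Sum>i\<in>{i. ?g i \<noteq> 0}. ?g i)"
    using fin by (intro sum.mono_neutral_right) auto
  moreover have "finite {i. ?g i \<noteq> 0}"
    using fin by (rule rev_finite_subset) auto
  moreover have "?g i \<in> vgrade V i" for i
    using graded_subspace mem by (simp add: subspace_scale)
  ultimately have "decomposes (vgrade V) 0 ?g"
    unfolding decomposes_def by simp
  moreover have "decomposes (vgrade V) 0 (\<lambda>_. 0)"
    unfolding decomposes_def by (simp add: zero_grade)
  ultimately have "?g = (\<lambda>_. 0)" by (rule decomposes_unique)
  then have g0: "(of_int i - of_int d :: complex) = 0 \<or> f i = 0" for i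
    by (metis scale_eq_0_iff)
  have "f i = 0" if "i \<noteq> d" for i
    using g0[of i] that by simp
  then have "u = (\<Sum>i\<in>{d}. f i)"
    unfolding sum by (intro sum.mono_neutral_left) auto
  then show "u \<in> vgrade V d" using mem by simp
qed (rule L0_grade)

lemma L_minus1_commutator:
  "voa_L V (-1) (vmode V v n w) - vmode V v n (voa_L V (-1) w) = vmode V (voa_L V (-1) v) n w"
proof -
  have "(\<Sum>i::nat. (of_int 0 gchoose i) \<cdot> vmode V (vmode V (conformal V) (int i) v) (0 + n - int i) w) =
    (of_int 0 gchoose 0) \<cdot> vmode V (vmode V (conformal V) (int 0) v) (0 + n - int 0) w"
    by (rule Sum_any_single) (simp add: gbinomial_0_left)
  then show ?thesis
    using vmode_commutator[of "conformal V" 0 v n w] by (simp add: voa_L_def)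
qed

text \<open>The commutator formula for the mode 1 of the conformal vector, where only i = 0 and i =
  1 survive; the L(-1)-derivative property rewrites the first of these terms.\<close>

lemma L0_commutator:
  "voa_L V 0 (vmode V v n w) - vmode V v n (voa_L V 0 w) =
    vmode V (voa_L V 0 v) n w - of_int (n + 1) \<cdot> vmode V v n w"
proof -
  have z: "(1 gchoose i) = (0::complex)" if "i \<noteq> 0" "i \<noteq> 1" for i
    using that binomial_gbinomial[of 1 i, where 'a = complex] by (simp add: binomial_eq_0)
  have "(\<Sum>i::nat. (of_int 1 gchoose i) \<cdot> vmode V (vmode V (conformal V) (int i) v) (1 + n - int i) w) =
    (\<Sum>i\<in>{0, 1}. (of_int 1 gchoose i) \<cdot> vmode V (vmode V (conformal V) (int i) v) (1 + n - int i) w)"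
    by (rule Sum_any_eq_sum) (use z in auto)
  also have "\<dots> = vmode V (voa_L V (-1) v) (n + 1) w + vmode V (voa_L V 0 v) n w"
    by (simp add: voa_L_def algebra_simps)
  also have "vmode V (voa_L V (-1) v) (n + 1) w = - (of_int (n + 1) \<cdot> vmode V v n w)"
    by (simp only: L_minus1_derivative scale_minus_left) simp
  finally show ?thesis
    using vmode_commutator[of "conformal V" 1 v n w] by (simp add: voa_L_def algebra_simps)
qed

lemma vmode_grade:
  assumes "u \<in> vgrade V d" "v \<in> vgrade V e"
  shows "vmode V u n v \<in> vgrade V (d + e - n - 1)"
proof -
  have "voa_L V 0 (vmode V u n v) = vmode V u n (voa_L V 0 v) + vmode V (voa_L V 0 u) n v - of_int (n + 1) \<cdot> vmode V u n v"
    using L0_commutator[of u n v] by (simp add: algebra_simps)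
  also have "\<dots> = of_int (d + e - n - 1) \<cdot> vmode V u n v"
    using assms by (simp add: L0_grade vmode_scale_left vmode_scale_right algebra_simps)
  finally show ?thesis by (simp add: grade_iff)
qed

lemma L_minus1_grade: "u \<in> vgrade V d \<Longrightarrow> voa_L V (-1) u \<in> vgrade V (d + 1)"
  using vmode_grade[OF conformal_grade, of u d 0] by (simp add: voa_L_def add.commute)

lemma L_minus1_power_linear:
  "(voa_L V (-1) ^^ j) (u + v) = (voa_L V (-1) ^^ j) u + (voa_L V (-1) ^^ j) v"
  "(voa_L V (-1) ^^ j) (c \<cdot> u) = c \<cdot> (voa_L V (-1) ^^ j) u"
  "(voa_L V (-1) ^^ j) 0 = 0"
  by (induction j) (auto simp: voa_L_add voa_L_scale voa_L_0)

section \<open>Skew-symmetry of the ordinary modes\<close>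

lemma vmode_vacuum_right:
  "vmode V u (- 1 - int j) (vacuum V) = (1 / fact j) \<cdot> (voa_L V (-1) ^^ j) u"
proof (induction j arbitrary: u)
  case 0
  then show ?case by (simp add: creation)
next
  case (Suc j)
  have "vmode V (voa_L V (-1) u) (- 1 - int j) (vacuum V) = of_nat (Suc j) \<cdot> vmode V u (- 1 - int (Suc j)) (vacuum V)"
    by (simp add: L_minus1_derivative algebra_simps)
  then have "vmode V u (- 1 - int (Suc j)) (vacuum V) = (1 / of_nat (Suc j)) \<cdot> vmode V (voa_L V (-1) u) (- 1 - int j) (vacuum V)"
    by (simp del: of_nat_Suc)
  also have "\<dots> = (1 / fact (Suc j)) \<cdot> (voa_L V (-1) ^^ Suc j) u"
    unfolding Suc.IH by (simp add: funpow_Suc_right del: funpow.simps)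
  finally show ?case .
qed

lemma vmode_finite: "finite {j::nat. vmode V u (k + int j) v \<noteq> 0}"
proof -
  obtain N where N: "\<And>n. n \<ge> N \<Longrightarrow> vmode V u n v = 0" using vmode_truncation by blast
  show ?thesis
  proof (rule finite_subset)
    show "{j. vmode V u (k + int j) v \<noteq> 0} \<subseteq> {..<nat (N - k)}"
    proof
      fix j assume "j \<in> {j. vmode V u (k + int j) v \<noteq> 0}"
      then have "\<not> k + int j \<ge> N" using N by blast
      then show "j \<in> {..<nat (N - k)}" by simp
    qed
  qed simp
qed

text \<open>On the vacuum, [v_(-1), u_k] contains u_k v because v_(-1) 1 = v, while its expansion
  consists of terms (v_i u)_(k-1-i) 1, which are divided powers of L(-1). For k >= -1 the remaining
  vector u_k 1 is u or 0.\<close>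

lemma skew_symmetry_ge:
  assumes "k \<ge> - 1"
  shows "vmode V u k v = (\<Sum>j::nat. ((-1) powi (k + 1 + int j) / fact j) \<cdot> (voa_L V (-1) ^^ j) (vmode V v (k + int j) u))"
proof -
  let ?f = "\<lambda>i::nat. (- ((-1) ^ i)) \<cdot> vmode V (vmode V v (int i) u) (k - 1 - int i) (vacuum V)"
  let ?t = "\<lambda>j::nat. ((-1) powi (k + 1 + int j) / fact j) \<cdot> (voa_L V (-1) ^^ j) (vmode V v (k + int j) u)"
  have fin: "finite {i. ?f i \<noteq> 0}"
    using vmode_finite[of v 0 u] by (rule rev_finite_subset) auto
  have tfin: "finite {i. ?t i \<noteq> 0}"
    using vmode_finite[of v k u] by (rule rev_finite_subset) (auto simp: L_minus1_power_linear)
  have "vmode V v (-1) (vmode V u k (vacuum V)) - vmode V u k (vmode V v (-1) (vacuum V)) =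
    (\<Sum>i::nat. (of_int (-1) gchoose i) \<cdot> vmode V (vmode V v (int i) u) (-1 + k - int i) (vacuum V))"
    by (rule vmode_commutator)
  also have "\<dots> = (\<Sum>i::nat. - ?f i)"
  proof (rule Sum_any.cong)
    fix i :: nat
    have "(of_nat i gchoose i :: complex) = 1"
      by (metis binomial_gbinomial binomial_n_n of_nat_1)
    then have "(of_int (-1) gchoose i) = (- 1 :: complex) ^ i"
      using gbinomial_minus[of "1 :: complex" i] by simp
    then show "(of_int (-1) gchoose i) \<cdot> vmode V (vmode V v (int i) u) (-1 + k - int i) (vacuum V) = - ?f i"
      by (simp add: algebra_simps)
  qed
  also have "\<dots> = - (\<Sum>i. ?f i)"
    using scale_Sum_any[of "-1" ?f] by simp
  finally have *: "vmode V u k v = vmode V v (-1) (vmode V u k (vacuum V)) + (\<Sum>i. ?f i)"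
    by (simp add: creation algebra_simps)
  show ?thesis
  proof (cases "k = -1")
    case True
    \<comment> \<open>The term j = 0 of the claim is v_(-1) u, contributed by v_(-1) u_(-1) 1; the
      commutator sum therefore accounts for the terms from j = 1 on.\<close>
    have "?f i = ?t (Suc i)" for i
    proof -
      have idx: "k - 1 - int i = - 1 - int (Suc i)" "k + int (Suc i) = int i" "k + 1 + int (Suc i) = int (Suc i)"
        by (simp_all add: True)
      have sgn: "- ((-1) ^ i) * (1 / fact (Suc i)) = ((-1) powi int (Suc i) / fact (Suc i) :: complex)"
        by (simp only: power_int_of_nat) simp
      show ?thesis unfolding idx vmode_vacuum_right scale_scale sgn ..
    qed
    then show ?thesis
      using * Sum_any_nat_Suc[OF tfin] by (simp add: True creation)
  next
    case False
    then have k: "k \<ge> 0" using assms by simp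
    \<comment> \<open>For i < k the mode k - 1 - i is nonnegative and annihilates the
      vacuum.\<close>
    have "(\<Sum>i. ?f i) = (\<Sum>j. ?f (nat k + j))"
    proof (rule Sum_any_reindex)
      fix i assume "i \<notin> range ((+) (nat k))"
      then have "\<not> i \<ge> nat k" by (metis le_iff_add rangeI)
      then show "?f i = 0" by (simp add: creation)
    qed (simp add: inj_on_def)
    also have "\<dots> = (\<Sum>j. ?t j)"
    proof (rule Sum_any.cong)
      fix j
      have "- ((-1) ^ (nat k + j)) = ((-1) powi (k + 1 + int j) :: complex)"
      proof -
        have "k + 1 + int j = int (nat k + j + 1)" using k by simp
        then show ?thesis by (simp only: power_int_of_nat) simp
      qed
      then show "?f (nat k + j) = ?t j"
        using vmode_vacuum_right[of "vmode V v (k + int j) u" j] k by (simp add: algebra_simps)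
    qed
    finally show ?thesis using * k by (simp add: creation)
  qed
qed

text \<open>Below -1 the formula descends: applied to L(-1) u at k it determines -k u_(k-1) v, and k
  is nonzero there.\<close>

lemma skew_symmetry:
  "vmode V u k v = (\<Sum>j::nat. ((-1) powi (k + 1 + int j) / fact j) \<cdot> (voa_L V (-1) ^^ j) (vmode V v (k + int j) u))"
proof -
  have "vmode V u (- 1 - int m) v = (\<Sum>j::nat. ((-1) powi ((- 1 - int m) + 1 + int j) / fact j) \<cdot>
      (voa_L V (-1) ^^ j) (vmode V v ((- 1 - int m) + int j) u))" for m
  proof (induction m arbitrary: u)
    case 0
    then show ?case using skew_symmetry_ge[of "-1"] by simp
  next
    case (Suc m)
    define k where "k = - 1 - int m"
    let ?L = "voa_L V (-1)"
    define a where "a j = (-1) powi (k + 1 + int j) / (fact j :: complex)" for j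
    define A where "A j = (?L ^^ j) (vmode V v (k - 1 + int j) u)" for j
    have Lv: "vmode V v n (?L u) = ?L (vmode V v n u) + of_int n \<cdot> vmode V v (n - 1) u" for n
      using L_minus1_commutator[of v n u] by (simp add: L_minus1_derivative algebra_simps)
    have IH: "vmode V (?L u) k v = (\<Sum>j. a j \<cdot> (?L ^^ j) (vmode V v (k + int j) (?L u)))"
      unfolding a_def k_def by (rule Suc.IH)
    have t: "a j \<cdot> (?L ^^ j) (vmode V v (k + int j) (?L u)) =
        a j \<cdot> A (Suc j) + (a j * of_int (k + int j)) \<cdot> A j" for j
      by (simp add: Lv A_def L_minus1_power_linear scale_right_distrib algebra_simps flip: funpow_swap1 del: of_int_add)
    have finA: "finite {j. A j \<noteq> 0}"
      using vmode_finite[of v "k - 1" u] by (rule rev_finite_subset) (auto simp: A_def L_minus1_power_linear)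
    have finAS: "finite {j. A (Suc j) \<noteq> 0}"
      using finite_vimageI[OF finA, of Suc] by (simp add: vimage_def)
    \<comment> \<open>The sequence a shifted by one place, so that the terms with A (Suc j) can be
      collected with those with A j.\<close>
    define b where "b j = (case j of 0 \<Rightarrow> 0 | Suc i \<Rightarrow> a i)" for j
    have "(\<Sum>j. a j \<cdot> A (Suc j)) = (\<Sum>j. b j \<cdot> A j)"
    proof -
      have "finite {j. b j \<cdot> A j \<noteq> 0}" using finA by (rule rev_finite_subset) auto
      from Sum_any_nat_Suc[OF this] show ?thesis by (simp add: b_def)
    qed
    moreover have "(\<Sum>j. a j \<cdot> A (Suc j) + (a j * of_int (k + int j)) \<cdot> A j) =
        (\<Sum>j. a j \<cdot> A (Suc j)) + (\<Sum>j. (a j * of_int (k + int j)) \<cdot> A j)"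
      by (rule Sum_any.distrib) (rule rev_finite_subset[OF finAS] rev_finite_subset[OF finA], force)+
    moreover have "(\<Sum>j. b j \<cdot> A j + (a j * of_int (k + int j)) \<cdot> A j) =
        (\<Sum>j. b j \<cdot> A j) + (\<Sum>j. (a j * of_int (k + int j)) \<cdot> A j)"
      by (rule Sum_any.distrib) (rule rev_finite_subset[OF finA], force)+
    ultimately have "vmode V (?L u) k v = (\<Sum>j. b j \<cdot> A j + (a j * of_int (k + int j)) \<cdot> A j)"
      unfolding IH t by simp
    also have "\<dots> = (\<Sum>j. of_int k \<cdot> (a j \<cdot> A j))"
    proof (rule Sum_any.cong)
      fix j
      have "b j + a j * of_int (k + int j) = of_int k * a j"
      proof (cases j)
        case (Suc i)
        have "a (Suc i) * of_nat (Suc i) = - a i"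
          by (simp add: a_def power_int_add field_simps del: of_nat_Suc)
        then show ?thesis by (simp add: b_def Suc algebra_simps)
      qed (simp add: b_def)
      then show "b j \<cdot> A j + (a j * of_int (k + int j)) \<cdot> A j = of_int k \<cdot> (a j \<cdot> A j)"
        by (simp only: scale_left_distrib[symmetric] scale_scale)
    qed
    also have "\<dots> = of_int k \<cdot> (\<Sum>j. a j \<cdot> A j)" by (rule scale_Sum_any[symmetric])
    finally have "(- of_int k) \<cdot> vmode V u (k - 1) v = of_int k \<cdot> (\<Sum>j. a j \<cdot> A j)"
      by (simp add: L_minus1_derivative)
    then have "of_int k \<cdot> vmode V u (k - 1) v = of_int k \<cdot> (- (\<Sum>j. a j \<cdot> A j))"
      by (metis minus_minus scale_minus_left scale_minus_right)
    moreover have "(of_int k :: complex) \<noteq> 0" unfolding of_int_eq_0_iff by (simp add: k_def)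
    ultimately have "vmode V u (k - 1) v = - (\<Sum>j. a j \<cdot> A j)"
      by (simp only: scale_left_imp_eq)
    also have "\<dots> = (\<Sum>j. (- a j) \<cdot> A j)"
      using scale_Sum_any[of "-1" "\<lambda>j. a j \<cdot> A j"] by simp
    also have "\<dots> = (\<Sum>j. ((-1) powi ((- 1 - int (Suc m)) + 1 + int j) / fact j) \<cdot>
      (voa_L V (-1) ^^ j) (vmode V v ((- 1 - int (Suc m)) + int j) u))"
    proof (rule Sum_any.cong)
      fix j
      have sgn: "- a j = (-1) powi ((- 1 - int (Suc m)) + 1 + int j) / fact j"
      proof -
        have "k + 1 + int j = ((- 1 - int (Suc m)) + 1 + int j) + 1" by (simp add: k_def)
        then have "a j = (-1) powi (((- 1 - int (Suc m)) + 1 + int j) + 1) / fact j"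
          by (simp only: a_def)
        then show ?thesis by (subst (asm) power_int_add) auto
      qed
      have idx: "k - 1 = - 1 - int (Suc m)" by (simp add: k_def)
      show "(- a j) \<cdot> A j = ((-1) powi ((- 1 - int (Suc m)) + 1 + int j) / fact j) \<cdot>
          (voa_L V (-1) ^^ j) (vmode V v ((- 1 - int (Suc m)) + int j) u)"
        unfolding sgn A_def idx ..
    qed
    finally show ?case unfolding k_def by (simp add: algebra_simps)
  qed
  from this[of "nat (- 1 - k)"] show ?thesis
    using skew_symmetry_ge[of k u v] by (cases "k \<ge> -1") auto
qed

end

text \<open>Coordinates with respect to a basis of the whole space, possibly infinite, reduce
  vector-valued polynomials to complex ones.\<close>

lemma (in complex_vector_space) polynomial_coeffs_eq:
  assumes "\<And>x. (\<Sum>n<N. (x ^ n / fact n) *s f n) = (\<Sum>n<N. (x ^ n / fact n) *s g n)" and "n < N"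
  shows "f n = g n"
proof -
  define B where "B = extend_basis {}"
  have B: "independent B" "span B = UNIV"
    by (simp_all add: B_def independent_extend_basis span_extend_basis independent_empty)
  have add: "representation B (u + v) b = representation B u b + representation B v b" for u v b
    using B by (simp add: representation_add)
  have scale: "representation B (c *s u) b = c * representation B u b" for c u b
    using B by (simp add: representation_scale)
  have sum: "representation B (sum h A) b = (\<Sum>i\<in>A. representation B (h i) b)" for h b and A :: "nat set"
    by (induction A rule: infinite_finite_induct) (auto simp: add representation_zero)
  obtain M where M: "N = Suc M" using assms(2) by (cases N) auto
  have "representation B (f n) b = representation B (g n) b" for b
  proof (rule polyfun_coeffs_eqI[where N = M and f = "\<lambda>n. representation B (f n) b" and g = "\<lambda>n. representation B (g n) b"])
    fix x
    have "representation B (\<Sum>n<N. (x ^ n / fact n) *s f n) b = representation B (\<Sum>n<N. (x ^ n / fact n) *s g n) b"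
      by (simp only: assms(1))
    then show "(\<Sum>n\<le>M. x ^ n / fact n * representation B (f n) b) = (\<Sum>n\<le>M. x ^ n / fact n * representation B (g n) b)"
      by (simp only: sum scale M lessThan_Suc_atMost)
  qed (use assms(2) M in simp)
  then have eq: "representation B (f n) = representation B (g n)" by blast
  have inB: "v \<in> span B" for v using B(2) by simp
  have "f n = (\<Sum>b | representation B (f n) b \<noteq> 0. representation B (f n) b *s b)"
    by (rule sum_nonzero_representation_eq[OF B(1) inB, symmetric])
  also have "\<dots> = g n"
    unfolding eq by (rule sum_nonzero_representation_eq[OF B(1) inB])
  finally show ?thesis .
qed

section \<open>Modes of \<open>Y[u, y]\<close>\<close>

context vertex_operator_algebra
begin

lemma vmode_truncation_nat: "\<exists>N::nat. \<forall>n\<ge>int N. vmode V u n w = 0"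
proof -
  obtain N where "\<forall>n\<ge>N. vmode V u n w = 0" using vmode_truncation by blast
  then show ?thesis by (intro exI[of _ "nat N"]) auto
qed

lemma L0_power_grade: "u \<in> vgrade V d \<Longrightarrow> (voa_L V 0 ^^ j) u = of_int d ^ j \<cdot> u"
  by (induction j) (simp_all add: voa_L_scale L0_grade mult.commute)

lemma L0_power_linear:
  "(voa_L V 0 ^^ j) (u + v) = (voa_L V 0 ^^ j) u + (voa_L V 0 ^^ j) v"
  "(voa_L V 0 ^^ j) (c \<cdot> u) = c \<cdot> (voa_L V 0 ^^ j) u"
  by (induction j) (auto simp: voa_L_add voa_L_scale)

text \<open>A single N serves all powers of L(0), since these only rescale the homogeneous
  components. Uniformity in j is needed because \<open>sq_mode\<close> sums over j.\<close>

lemma L0_power_truncation: "\<exists>N::nat. \<forall>j. \<forall>n\<ge>int N. vmode V ((voa_L V 0 ^^ j) u) n w = 0"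
proof (induction u rule: graded_induct)
  case (1 d u)
  then show ?case
    using vmode_truncation_nat[of u w] by (auto simp: L0_power_grade vmode_scale_left)
next
  case (2 u v)
  then obtain N N' :: nat where "\<forall>j. \<forall>n\<ge>int N. vmode V ((voa_L V 0 ^^ j) u) n w = 0"
    "\<forall>j. \<forall>n\<ge>int N'. vmode V ((voa_L V 0 ^^ j) v) n w = 0" by blast
  then show ?case
    by (intro exI[of _ "max N N'"]) (simp add: L0_power_linear vmode_add_left)
qed

definition sq_coeff :: "int \<Rightarrow> int \<Rightarrow> nat \<Rightarrow> complex"
  where "sq_coeff n m j = fls_nth (fls_expm1 powi (- m - 1)) (- n - 1 - int j) / fact j"

lemma sq_coeff_eq_0: "m < n + int j \<Longrightarrow> sq_coeff n m j = 0"
  unfolding sq_coeff_def by (subst fls_eq0_below_subdegree) auto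

text \<open>The coefficient vanishes for m < n + j and the mode for m >= N, which confines the
  double sum to a box. The bounds N and L may be enlarged, so several vectors can share one box;
  linearity of \<open>sq_mode\<close> is obtained this way.\<close>

lemma sq_mode_box:
  assumes "\<And>j m. m \<ge> int N \<Longrightarrow> vmode V ((voa_L V 0 ^^ j) u) m w = 0" and "int N - n \<le> int L"
  shows "sq_mode V u n w = (\<Sum>m\<in>{n..<int N}. \<Sum>j<L. sq_coeff n m j \<cdot> vmode V ((voa_L V 0 ^^ j) u) m w)"
proof -
  let ?f = "\<lambda>(m, j). sq_coeff n m j \<cdot> vmode V ((voa_L V 0 ^^ j) u) m w"
  have "sq_mode V u n w = Sum_any ?f"
    unfolding sq_mode_def sq_coeff_def fls_expm1_def by simp
  also have "\<dots> = sum ?f ({n..<int N} \<times> {..<L})"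
  proof (rule Sum_any_eq_sum)
    fix x assume "x \<notin> {n..<int N} \<times> {..<L}"
    then obtain m j where x: "x = (m, j)" "m < n + int j \<or> m \<ge> int N"
      using assms(2) by (cases x) fastforce
    then show "?f x = 0" using assms(1) sq_coeff_eq_0 by auto
  qed simp
  finally show ?thesis by (simp add: sum.cartesian_product)
qed

lemma sq_mode_truncation: "\<exists>N::nat. \<forall>n\<ge>int N. sq_mode V u n w = 0"
proof -
  obtain N :: nat where N: "\<And>j n. n \<ge> int N \<Longrightarrow> vmode V ((voa_L V 0 ^^ j) u) n w = 0"
    using L0_power_truncation by blast
  have "sq_mode V u n w = 0" if "n \<ge> int N" for n
    using sq_mode_box[OF N, where n = n and L = 0] that by simp
  then show ?thesis by blast
qed

lemma sq_mode_add_left: "sq_mode V (u + v) n w = sq_mode V u n w + sq_mode V v n w"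
proof -
  obtain N :: nat where N: "\<And>j n. n \<ge> int N \<Longrightarrow> vmode V ((voa_L V 0 ^^ j) u) n w = 0"
    using L0_power_truncation by blast
  obtain N' :: nat where N': "\<And>j n. n \<ge> int N' \<Longrightarrow> vmode V ((voa_L V 0 ^^ j) v) n w = 0"
    using L0_power_truncation by blast
  define M where "M = max N N'"
  define L where "L = nat (int M - n)"
  have "sq_mode V x n w = (\<Sum>m\<in>{n..<int M}. \<Sum>j<L. sq_coeff n m j \<cdot> vmode V ((voa_L V 0 ^^ j) x) m w)"
    if "x \<in> {u, v, u + v}" for x
    using that N N' by (intro sq_mode_box) (auto simp: M_def L_def L0_power_linear vmode_add_left)
  then show ?thesis
    by (simp add: L0_power_linear vmode_add_left scale_right_distrib sum.distrib)
qed

lemma sq_mode_scale_left: "sq_mode V (c \<cdot> u) n w = c \<cdot> sq_mode V u n w"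
proof -
  obtain N :: nat where N: "\<And>j n. n \<ge> int N \<Longrightarrow> vmode V ((voa_L V 0 ^^ j) u) n w = 0"
    using L0_power_truncation by blast
  define L where "L = nat (int N - n)"
  have "sq_mode V x n w = (\<Sum>m\<in>{n..<int N}. \<Sum>j<L. sq_coeff n m j \<cdot> vmode V ((voa_L V 0 ^^ j) x) m w)"
    if "x \<in> {u, c \<cdot> u}" for x
    using that N by (intro sq_mode_box) (auto simp: L_def L0_power_linear vmode_scale_left)
  then show ?thesis
    by (simp add: L0_power_linear vmode_scale_left scale_sum_right mult.commute)
qed

lemma sq_mode_add_right: "sq_mode V u n (w + w') = sq_mode V u n w + sq_mode V u n w'"
proof -
  obtain N :: nat where N: "\<And>j n. n \<ge> int N \<Longrightarrow> vmode V ((voa_L V 0 ^^ j) u) n w = 0"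
    using L0_power_truncation by blast
  obtain N' :: nat where N': "\<And>j n. n \<ge> int N' \<Longrightarrow> vmode V ((voa_L V 0 ^^ j) u) n w' = 0"
    using L0_power_truncation by blast
  define M where "M = max N N'"
  define L where "L = nat (int M - n)"
  have "sq_mode V u n x = (\<Sum>m\<in>{n..<int M}. \<Sum>j<L. sq_coeff n m j \<cdot> vmode V ((voa_L V 0 ^^ j) u) m x)"
    if "x \<in> {w, w', w + w'}" for x
    using that N N' by (intro sq_mode_box) (auto simp: M_def L_def vmode_add_right)
  then show ?thesis
    by (simp add: vmode_add_right scale_right_distrib sum.distrib)
qed

lemma sq_mode_scale_right: "sq_mode V u n (c \<cdot> w) = c \<cdot> sq_mode V u n w"
proof -
  obtain N :: nat where N: "\<And>j n. n \<ge> int N \<Longrightarrow> vmode V ((voa_L V 0 ^^ j) u) n w = 0"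
    using L0_power_truncation by blast
  define L where "L = nat (int N - n)"
  have "sq_mode V u n x = (\<Sum>m\<in>{n..<int N}. \<Sum>j<L. sq_coeff n m j \<cdot> vmode V ((voa_L V 0 ^^ j) u) m x)"
    if "x \<in> {w, c \<cdot> w}" for x
    using that N by (intro sq_mode_box) (auto simp: L_def vmode_scale_right)
  then show ?thesis
    by (simp add: vmode_scale_right scale_sum_right mult.commute)
qed

lemma sq_mode_0 [simp]: "sq_mode V 0 n w = 0" "sq_mode V u n 0 = 0"
  using sq_mode_scale_left[of 0 0 n w] sq_mode_scale_right[of u n 0 0] by simp_all

lemma sq_mode_sum_left: "sq_mode V (sum f A) n w = (\<Sum>i\<in>A. sq_mode V (f i) n w)"
  by (induction A rule: infinite_finite_induct) (auto simp: sq_mode_add_left)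

lemma sq_mode_sum_right: "sq_mode V u n (sum f A) = (\<Sum>i\<in>A. sq_mode V u n (f i))"
  by (induction A rule: infinite_finite_induct) (auto simp: sq_mode_add_right)

text \<open>On weight d the sum over j is the expansion of e^(dy). The lower limit n is the
  triangularity of the coefficients, the upper limit the truncation of u on w.\<close>

lemma sq_mode_homogeneous:
  assumes "u \<in> vgrade V d" and "\<And>m. m \<ge> N \<Longrightarrow> vmode V u m w = 0"
  shows "sq_mode V u n w = (\<Sum>m\<in>{n..<N}. zhu_coeff (of_int d) m n \<cdot> vmode V u m w)"
proof -
  define M where "M = nat N"
  define L where "L = nat (int M - n)"
  have M: "vmode V u m w = 0" if "m \<ge> int M" for m
    using that by (intro assms(2)) (auto simp: M_def split: if_splits)
  have "sq_mode V u n w = (\<Sum>m\<in>{n..<int M}. \<Sum>j<Suc L. sq_coeff n m j \<cdot> vmode V ((voa_L V 0 ^^ j) u) m w)"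
    using assms(1) M by (intro sq_mode_box) (auto simp: L_def L0_power_grade vmode_scale_left)
  also have "\<dots> = (\<Sum>m\<in>{n..<int M}. zhu_coeff (of_int d) m n \<cdot> vmode V u m w)"
  proof (rule sum.cong[OF refl])
    fix m assume m: "m \<in> {n..<int M}"
    have "zhu_coeff (of_int d) m n = (\<Sum>j\<le>L. fps_nth (fps_exp (of_int d)) j * fls_nth (fls_expm1 powi (- m - 1)) (- n - 1 - int j))"
      unfolding zhu_coeff_def zhu_series_def using m by (intro fls_times_fps_nth) (simp add: L_def)
    also have "\<dots> = (\<Sum>j<Suc L. sq_coeff n m j * of_int d ^ j)"
      by (simp add: sq_coeff_def mult.commute flip: lessThan_Suc_atMost)
    finally show "(\<Sum>j<Suc L. sq_coeff n m j \<cdot> vmode V ((voa_L V 0 ^^ j) u) m w) = zhu_coeff (of_int d) m n \<cdot> vmode V u m w"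
      using assms(1) by (simp only: L0_power_grade vmode_scale_left scale_scale scale_sum_left)
  qed
  also have "\<dots> = (\<Sum>m\<in>{n..<N}. zhu_coeff (of_int d) m n \<cdot> vmode V u m w)"
    by (rule sum.mono_neutral_right) (auto simp: M_def assms(2))
  finally show ?thesis .
qed

section \<open>The derivation D = L(-1) + L(0) and differentiation of Y[u, y]\<close>

definition sq_deriv :: "'v \<Rightarrow> 'v"
  where "sq_deriv u = voa_L V (-1) u + voa_L V 0 u"

lemma sq_deriv_add: "sq_deriv (u + v) = sq_deriv u + sq_deriv v"
  and sq_deriv_scale: "sq_deriv (c \<cdot> u) = c \<cdot> sq_deriv u"
  and sq_deriv_0 [simp]: "sq_deriv 0 = 0"
  by (simp_all add: sq_deriv_def voa_L_add voa_L_scale voa_L_0 scale_right_distrib algebra_simps)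

text \<open>Differentiating Y(e^(yL(0)) u, e^y - 1) gives an L(0)-term and, by the chain rule, an
  L(-1)-term with an additional e^y. This extra exponential is exactly what the weight d + 1 of
  L(-1) u supplies.\<close>

lemma sq_mode_deriv_homogeneous:
  assumes "u \<in> vgrade V d"
  shows "sq_mode V (sq_deriv u) n w = - (of_int n \<cdot> sq_mode V u (n - 1) w)"
proof -
  let ?L = "voa_L V (-1)"
  obtain N :: nat where N: "\<And>m. m \<ge> int N \<Longrightarrow> vmode V u m w = 0" using vmode_truncation_nat by blast
  have Lu: "?L u \<in> vgrade V (d + 1)" by (rule L_minus1_grade[OF assms])
  have NL: "vmode V (?L u) m w = 0" if "m \<ge> int (Suc N)" for m
    using that N by (simp add: L_minus1_derivative)
  have "sq_mode V (?L u) n w = (\<Sum>m\<in>{n..<int (Suc N)}. zhu_coeff (of_int (d + 1)) m n \<cdot> vmode V (?L u) m w)"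
    by (rule sq_mode_homogeneous[OF Lu NL])
  also have "\<dots> = (\<Sum>m\<in>{n..<int N + 1}. (- of_int m * zhu_coeff (of_int (d + 1)) m n) \<cdot> vmode V u (m - 1) w)"
    by (simp add: L_minus1_derivative mult.commute add.commute)
  also have "\<dots> = (\<Sum>m\<in>{n - 1..<int N}. (- of_int (m + 1) * zhu_coeff (of_int (d + 1)) (m + 1) n) \<cdot> vmode V u m w)"
    by (rule sum.reindex_bij_witness[of _ "\<lambda>m. m + 1" "\<lambda>m. m - 1"]) auto
  finally have 1: "sq_mode V (?L u) n w = \<dots>" .
  have "sq_mode V (voa_L V 0 u) n w = of_int d \<cdot> (\<Sum>m\<in>{n..<int N}. zhu_coeff (of_int d) m n \<cdot> vmode V u m w)"
    using assms by (simp only: L0_grade sq_mode_scale_left sq_mode_homogeneous[OF assms N])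
  also have "(\<Sum>m\<in>{n..<int N}. zhu_coeff (of_int d) m n \<cdot> vmode V u m w) = (\<Sum>m\<in>{n-1..<int N}. zhu_coeff (of_int d) m n \<cdot> vmode V u m w)"
    by (rule sum.mono_neutral_left) (auto simp: zhu_coeff_eq_0)
  finally have 2: "sq_mode V (voa_L V 0 u) n w = (\<Sum>m\<in>{n-1..<int N}. (of_int d * zhu_coeff (of_int d) m n) \<cdot> vmode V u m w)"
    by (simp add: scale_sum_right)
  have "sq_mode V (sq_deriv u) n w = (\<Sum>m\<in>{n-1..<int N}. (of_int d * zhu_coeff (of_int d) m n - of_int (m + 1) * zhu_coeff (of_int d + 1) (m + 1) n) \<cdot> vmode V u m w)"
    unfolding sq_deriv_def sq_mode_add_left 1 2
    by (simp add: sum.distrib[symmetric] scale_left_distrib[symmetric]) (simp add: algebra_simps)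
  also have "\<dots> = (\<Sum>m\<in>{n-1..<int N}. (- of_int n * zhu_coeff (of_int d) m (n - 1)) \<cdot> vmode V u m w)"
    by (simp only: zhu_coeff_deriv)
  also have "\<dots> = (- of_int n) \<cdot> sq_mode V u (n - 1) w"
    by (simp only: sq_mode_homogeneous[OF assms N] scale_sum_right scale_scale)
  finally show ?thesis by simp
qed

lemma sq_mode_deriv: "sq_mode V (sq_deriv u) n w = - (of_int n \<cdot> sq_mode V u (n - 1) w)"
proof (induction u rule: graded_induct)
  case (2 u v)
  then show ?case by (simp add: sq_deriv_add sq_mode_add_left scale_right_distrib)
qed (rule sq_mode_deriv_homogeneous)

lemma sq_deriv_sum: "sq_deriv (sum f A) = (\<Sum>i\<in>A. sq_deriv (f i))"
  by (induction A rule: infinite_finite_induct) (auto simp: sq_deriv_add)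

lemma sq_deriv_vmode:
  "sq_deriv (vmode V u m w) = vmode V u m (sq_deriv w) + vmode V (voa_L V (-1) u) m w
    + vmode V (voa_L V (-1) u) (m + 1) w + vmode V (voa_L V 0 u) m w"
  using L_minus1_commutator[of u m w] L0_commutator[of u m w]
  by (simp add: sq_deriv_def vmode_add_right L_minus1_derivative algebra_simps)

lemma sq_deriv_sq_mode:
  "sq_deriv (sq_mode V u n w) = sq_mode V u n (sq_deriv w) - of_int n \<cdot> sq_mode V u (n - 1) w"
proof -
  have "sq_deriv (sq_mode V u n w) = sq_mode V u n (sq_deriv w) + sq_mode V (sq_deriv u) n w"
  proof (induction u rule: graded_induct)
    case (1 d u)
    let ?L = "voa_L V (-1)" and ?D = "sq_deriv"
    obtain N1 :: nat where N1: "\<And>m. m \<ge> int N1 \<Longrightarrow> vmode V u m w = 0" using vmode_truncation_nat by blast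
    obtain N2 :: nat where N2: "\<And>m. m \<ge> int N2 \<Longrightarrow> vmode V u m (?D w) = 0" using vmode_truncation_nat by blast
    define N where "N = int (max N1 N2) + 1"
    have Nw: "vmode V u m w = 0" and ND: "vmode V u m (?D w) = 0" if "m \<ge> N" for m
      using that N1 N2 by (auto simp: N_def)
    have NL: "vmode V (?L u) m w = 0" if "m \<ge> N" for m
      using that N1 by (simp add: L_minus1_derivative N_def)
    let ?c = "\<lambda>m. zhu_coeff (of_int d) m n"
    have Lu: "?L u \<in> vgrade V (d + 1)" by (rule L_minus1_grade[OF 1])
    have "?D (sq_mode V u n w) = (\<Sum>m\<in>{n..<N}. ?c m \<cdot> vmode V u m (?D w)) + (\<Sum>m\<in>{n..<N}. ?c m \<cdot> vmode V (?L u) m w)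
      + (\<Sum>m\<in>{n..<N}. ?c m \<cdot> vmode V (?L u) (m + 1) w) + of_int d \<cdot> (\<Sum>m\<in>{n..<N}. ?c m \<cdot> vmode V u m w)"
      by (simp add: sq_mode_homogeneous[OF 1 Nw] sq_deriv_sum sq_deriv_scale sq_deriv_vmode L0_grade[OF 1]
          vmode_scale_left scale_right_distrib sum.distrib scale_sum_right mult.commute)
    \<comment> \<open>After the shift the two sums with modes of L(-1) u combine by
      \<open>zhu_coeff_shift\<close>: the coefficients for m and m - 1 at weight d add up to the one
      for weight d + 1, the weight of L(-1) u.\<close>
    also have "(\<Sum>m\<in>{n..<N}. ?c m \<cdot> vmode V (?L u) (m + 1) w) = (\<Sum>m\<in>{n+1..<N+1}. zhu_coeff (of_int d) (m - 1) n \<cdot> vmode V (?L u) m w)"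
      by (rule sum.reindex_bij_witness[of _ "\<lambda>m. m - 1" "\<lambda>m. m + 1"]) auto
    also have "\<dots> = (\<Sum>m\<in>{n+1..<N}. zhu_coeff (of_int d) (m - 1) n \<cdot> vmode V (?L u) m w)"
      by (rule sum.mono_neutral_right) (auto simp: NL)
    also have "\<dots> = (\<Sum>m\<in>{n..<N}. zhu_coeff (of_int d) (m - 1) n \<cdot> vmode V (?L u) m w)"
      by (rule sum.mono_neutral_left) (auto simp: zhu_coeff_eq_0)
    also have "(\<Sum>m\<in>{n..<N}. ?c m \<cdot> vmode V u m (?D w)) + (\<Sum>m\<in>{n..<N}. ?c m \<cdot> vmode V (?L u) m w)
      + (\<Sum>m\<in>{n..<N}. zhu_coeff (of_int d) (m - 1) n \<cdot> vmode V (?L u) m w) + of_int d \<cdot> (\<Sum>m\<in>{n..<N}. ?c m \<cdot> vmode V u m w)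
      = (\<Sum>m\<in>{n..<N}. ?c m \<cdot> vmode V u m (?D w)) + (\<Sum>m\<in>{n..<N}. zhu_coeff (of_int (d + 1)) m n \<cdot> vmode V (?L u) m w)
      + of_int d \<cdot> (\<Sum>m\<in>{n..<N}. ?c m \<cdot> vmode V u m w)"
      by (simp add: zhu_coeff_shift scale_left_distrib sum.distrib)
    also have "\<dots> = sq_mode V u n (?D w) + sq_mode V (?D u) n w"
      by (simp add: sq_mode_homogeneous[OF 1 Nw] sq_mode_homogeneous[OF 1 ND] sq_mode_homogeneous[OF Lu NL]
          sq_deriv_def[of u] sq_mode_add_left L0_grade[OF 1] sq_mode_scale_left del: of_int_add)
    finally show ?case .
  next
    case (2 u v)
    then show ?case by (simp add: sq_deriv_add sq_mode_add_left)
  qed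
  then show ?thesis by (simp add: sq_mode_deriv)
qed

section \<open>Residues of e^(xy) Y[u, y], generating functions of the nonnegative modes\<close>

definition sq_psi :: "complex \<Rightarrow> 'v \<Rightarrow> 'v \<Rightarrow> 'v"
  where "sq_psi x u w = (\<Sum>n::nat. (x ^ n / fact n) \<cdot> sq_mode V u (int n) w)"

lemma sq_psi_eq_sum:
  "(\<And>n. n \<ge> int N \<Longrightarrow> sq_mode V u n w = 0) \<Longrightarrow> sq_psi x u w = (\<Sum>n<N. (x ^ n / fact n) \<cdot> sq_mode V u (int n) w)"
  unfolding sq_psi_def by (rule Sum_any_nat_less) simp

lemma sq_mode_truncation2: "\<exists>N::nat. \<forall>n\<ge>int N. sq_mode V u n w = 0 \<and> sq_mode V u' n w' = 0"
proof -
  obtain N N' :: nat where "\<forall>n\<ge>int N. sq_mode V u n w = 0" "\<forall>n\<ge>int N'. sq_mode V u' n w' = 0"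
    using sq_mode_truncation by meson
  then show ?thesis by (intro exI[of _ "max N N'"]) auto
qed

lemma sq_psi_add_left: "sq_psi x (u + u') w = sq_psi x u w + sq_psi x u' w"
proof -
  obtain N :: nat where N: "\<And>n. n \<ge> int N \<Longrightarrow> sq_mode V u n w = 0 \<and> sq_mode V u' n w = 0"
    using sq_mode_truncation2 by blast
  then show ?thesis
    using sq_psi_eq_sum[of N u w] sq_psi_eq_sum[of N u' w] sq_psi_eq_sum[of N "u + u'" w]
    by (simp add: sq_mode_add_left scale_right_distrib sum.distrib)
qed

lemma sq_psi_add_right: "sq_psi x u (w + w') = sq_psi x u w + sq_psi x u w'"
proof -
  obtain N :: nat where N: "\<And>n. n \<ge> int N \<Longrightarrow> sq_mode V u n w = 0 \<and> sq_mode V u n w' = 0"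
    using sq_mode_truncation2 by blast
  then show ?thesis
    using sq_psi_eq_sum[of N u w] sq_psi_eq_sum[of N u w'] sq_psi_eq_sum[of N u "w + w'"]
    by (simp add: sq_mode_add_right scale_right_distrib sum.distrib)
qed

lemma sq_psi_scale_right: "sq_psi x u (c \<cdot> w) = c \<cdot> sq_psi x u w"
  by (simp add: sq_psi_def sq_mode_scale_right scale_Sum_any mult.commute)

lemma sq_psi_sum_right: "sq_psi x u (sum f A) = (\<Sum>i\<in>A. sq_psi x u (f i))"
proof (induction A rule: infinite_finite_induct)
  case (infinite A)
  then show ?case using sq_psi_scale_right[of x u 0 0] by simp
next
  case empty
  then show ?case using sq_psi_scale_right[of x u 0 0] by simp
qed (auto simp: sq_psi_add_right)

lemma sq_psi_homogeneous:
  assumes "u \<in> vgrade V d" and N: "\<And>m. m \<ge> int N \<Longrightarrow> vmode V u m w = 0"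
  shows "sq_psi x u w = (\<Sum>k<N. (of_int d + x - 1 gchoose k) \<cdot> vmode V u (int k) w)"
proof -
  have sq: "sq_mode V u (int n) w = (\<Sum>k<N. zhu_coeff (of_int d) (int k) (int n) \<cdot> vmode V u (int k) w)" for n
  proof -
    have "sq_mode V u (int n) w = (\<Sum>k\<in>{n..<N}. zhu_coeff (of_int d) (int k) (int n) \<cdot> vmode V u (int k) w)"
      by (simp only: sq_mode_homogeneous[OF assms] sum_int_nat)
    also have "\<dots> = (\<Sum>k<N. zhu_coeff (of_int d) (int k) (int n) \<cdot> vmode V u (int k) w)"
      by (rule sum.mono_neutral_left) (auto simp: zhu_coeff_eq_0)
    finally show ?thesis .
  qed
  have "sq_psi x u w = (\<Sum>n<Suc N. (x ^ n / fact n) \<cdot> sq_mode V u (int n) w)"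
    by (rule sq_psi_eq_sum) (simp add: sq_mode_homogeneous[OF assms])
  also have "\<dots> = (\<Sum>n\<le>N. \<Sum>k<N. (x ^ n / fact n * zhu_coeff (of_int d) (int k) (int n)) \<cdot> vmode V u (int k) w)"
    unfolding sq scale_sum_right scale_scale lessThan_Suc_atMost ..
  also have "\<dots> = (\<Sum>k<N. (\<Sum>n\<le>N. x ^ n / fact n * zhu_coeff (of_int d) (int k) (int n)) \<cdot> vmode V u (int k) w)"
    by (subst sum.swap) (simp add: scale_sum_left)
  also have "\<dots> = (\<Sum>k<N. (of_int d + x - 1 gchoose k) \<cdot> vmode V u (int k) w)"
    by (rule sum.cong[OF refl], subst sum_zhu_coeff) auto
  finally show ?thesis .
qed

lemma vmode_truncation_finite:
  assumes "finite A"
  shows "\<exists>S::nat. \<forall>i\<in>A. \<forall>s\<ge>int S. vmode V (f i) s (g i) = 0"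
  using assms
proof induction
  case (insert i A)
  then obtain S where "\<forall>i\<in>A. \<forall>s\<ge>int S. vmode V (f i) s (g i) = 0" by blast
  moreover obtain S' :: nat where "\<forall>s\<ge>int S'. vmode V (f i) s (g i) = 0"
    using vmode_truncation_nat by blast
  ultimately show ?case by (intro exI[of _ "max S S'"]) auto
qed simp

lemma sq_mode_truncation_finite:
  assumes "finite A"
  shows "\<exists>S::nat. \<forall>i\<in>A. \<forall>s\<ge>int S. sq_mode V (f i) s (g i) = 0"
  using assms
proof induction
  case (insert i A)
  then obtain S where "\<forall>i\<in>A. \<forall>s\<ge>int S. sq_mode V (f i) s (g i) = 0" by blast
  moreover obtain S' :: nat where "\<forall>s\<ge>int S'. sq_mode V (f i) s (g i) = 0"
    using sq_mode_truncation by blast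
  ultimately show ?case by (intro exI[of _ "max S S'"]) auto
qed simp

lemma finite_sq_mode_shift: "finite {l::nat. c l \<cdot> sq_mode V u (n + int l) w \<noteq> 0}"
proof -
  obtain N :: nat where N: "\<forall>m\<ge>int N. sq_mode V u m w = 0" using sq_mode_truncation by blast
  have "c l \<cdot> sq_mode V u (n + int l) w = 0" if "l \<notin> {..<nat (int N - n)}" for l
    using that N by simp
  then have "{l. c l \<cdot> sq_mode V u (n + int l) w \<noteq> 0} \<subseteq> {..<nat (int N - n)}" by blast
  then show ?thesis by (rule finite_subset) simp
qed

text \<open>Coefficient form of [\<Psi>_x(z), Y[u, y]] = e^(xy) Y[\<Psi>_x(z) u, y]. Both sides
  become combinations of the vectors \<open>T i s\<close>. On the left a binomial shift by \<Lambda>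
  - i raises the weight e of u; on the right an exponential shift by x raises the weight d + e - i -
  1. The two results agree.\<close>

lemma sq_psi_commutator_homogeneous:
  assumes z: "z \<in> vgrade V d" and u: "u \<in> vgrade V e"
  shows "sq_psi x z (sq_mode V u j w) - sq_mode V u j (sq_psi x z w) =
    (\<Sum>l::nat. (x ^ l / fact l) \<cdot> sq_mode V (sq_psi x z u) (j + int l) w)"
proof -
  define \<Lambda> where "\<Lambda> = of_int d + x - 1"
  define T where "T i s = vmode V (vmode V z (int i) u) s w" for i :: nat and s
  obtain I :: nat where I: "\<And>i. i \<ge> int I \<Longrightarrow> vmode V z i u = 0" using vmode_truncation_nat by blast
  obtain S :: nat where S0: "\<forall>i\<in>{..<I}. \<forall>s\<ge>int S. vmode V (vmode V z (int i) u) s w = 0"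
    using vmode_truncation_finite[of "{..<I}" "\<lambda>i. vmode V z (int i) u" "\<lambda>_. w"] by blast
  have S: "T i s = 0" if "s \<ge> int S" for i s
    using S0 I[of "int i"] that by (cases "i < I") (auto simp: T_def)
  obtain M0 :: nat where M0: "\<And>m. m \<ge> int M0 \<Longrightarrow> vmode V u m w = 0" using vmode_truncation_nat by blast
  obtain K0 :: nat where K0: "\<And>k. k \<ge> int K0 \<Longrightarrow> vmode V z k w = 0" using vmode_truncation_nat by blast
  obtain M1 :: nat where M1: "\<forall>k\<in>{..<K0}. \<forall>m\<ge>int M1. vmode V u m (vmode V z (int k) w) = 0"
    using vmode_truncation_finite[of "{..<K0}" "\<lambda>_. u" "\<lambda>k. vmode V z (int k) w"] by blast
  define M where "M = int (max (max M0 M1) S)"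
  have Mw: "vmode V u m w = 0" if "m \<ge> M" for m using that M0 by (auto simp: M_def)
  have Mz: "vmode V u m (vmode V z (int k) w) = 0" if "m \<ge> M" for m k
    using that M1 K0[of "int k"] by (cases "k < K0") (auto simp: M_def)
  obtain K1 :: nat where K1: "\<forall>m\<in>{j..<M}. \<forall>k\<ge>int K1. vmode V z k (vmode V u m w) = 0"
    using vmode_truncation_finite[of "{j..<M}" "\<lambda>_. z" "\<lambda>m. vmode V u m w"] by blast
  define L where "L = nat (int S - j)"
  \<comment> \<open>The part L + I leaves room for the diagonal summation after the first i < I
    values of k have been dropped.\<close>
  define K where "K = max (max K0 K1) (L + I)"
  let ?c = "zhu_coeff (of_int e)"
  have "sq_psi x z (sq_mode V u j w) = (\<Sum>m\<in>{j..<M}. ?c m j \<cdot> sq_psi x z (vmode V u m w))"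
    by (simp add: sq_mode_homogeneous[OF u Mw] sq_psi_sum_right sq_psi_scale_right)
  also have "\<dots> = (\<Sum>m\<in>{j..<M}. ?c m j \<cdot> (\<Sum>k<K. (\<Lambda> gchoose k) \<cdot> vmode V z (int k) (vmode V u m w)))"
    unfolding \<Lambda>_def using K1
    by (intro sum.cong refl arg_cong2[where f = "vscale V"] sq_psi_homogeneous[OF z]) (auto simp: K_def)
  finally have 1: "sq_psi x z (sq_mode V u j w) =
    (\<Sum>m\<in>{j..<M}. \<Sum>k<K. (?c m j * (\<Lambda> gchoose k)) \<cdot> vmode V z (int k) (vmode V u m w))"
    by (simp only: scale_sum_right scale_scale)
  have "sq_psi x z w = (\<Sum>k<K. (\<Lambda> gchoose k) \<cdot> vmode V z (int k) w)"
    unfolding \<Lambda>_def by (rule sq_psi_homogeneous[OF z]) (use K0 in \<open>auto simp: K_def\<close>)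
  then have "sq_mode V u j (sq_psi x z w) = (\<Sum>k<K. (\<Lambda> gchoose k) \<cdot> sq_mode V u j (vmode V z (int k) w))"
    by (simp only: sq_mode_sum_right sq_mode_scale_right)
  also have "\<dots> = (\<Sum>k<K. \<Sum>m\<in>{j..<M}. (?c m j * (\<Lambda> gchoose k)) \<cdot> vmode V u m (vmode V z (int k) w))"
    by (simp only: sq_mode_homogeneous[OF u Mz] scale_sum_right scale_scale mult.commute)
  finally have 2: "sq_mode V u j (sq_psi x z w) =
     (\<Sum>m\<in>{j..<M}. \<Sum>k<K. (?c m j * (\<Lambda> gchoose k)) \<cdot> vmode V u m (vmode V z (int k) w))"
    by (subst (asm) sum.swap)
  have comm: "vmode V z (int k) (vmode V u m w) - vmode V u m (vmode V z (int k) w) =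
     (\<Sum>i<I. (of_nat k gchoose i) \<cdot> T i (int k + m - int i))" for k m
  proof -
    have "(\<Sum>i::nat. (of_int (int k) gchoose i) \<cdot> vmode V (vmode V z (int i) u) (int k + m - int i) w)
      = (\<Sum>i<I. (of_int (int k) gchoose i) \<cdot> vmode V (vmode V z (int i) u) (int k + m - int i) w)"
      by (rule Sum_any_nat_less) (simp add: I)
    then show ?thesis unfolding vmode_commutator T_def by simp
  qed
  let ?g = "\<lambda>i k m. ((\<Lambda> gchoose k) * (of_nat k gchoose i) * ?c m j) \<cdot> T i (int k + m - int i)"
  have "sq_psi x z (sq_mode V u j w) - sq_mode V u j (sq_psi x z w) = (\<Sum>m\<in>{j..<M}. \<Sum>k<K. \<Sum>i<I. ?g i k m)"
    unfolding 1 2 sum_subtractf[symmetric] scale_right_diff_distrib[symmetric] comm scale_sum_right scale_scale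
    by (simp only: mult_ac)
  also have "\<dots> = (\<Sum>m\<in>{j..<M}. \<Sum>i<I. \<Sum>k<K. ?g i k m)"
    by (intro sum.cong refl sum.swap)
  also have "\<dots> = (\<Sum>i<I. \<Sum>m\<in>{j..<M}. \<Sum>k<K. ?g i k m)"
    by (rule sum.swap)
  also have "\<dots> = (\<Sum>i<I. (\<Lambda> gchoose i) \<cdot> (\<Sum>s\<in>{j..<int S}. zhu_coeff (of_int e + (\<Lambda> - of_nat i)) s j \<cdot> T i s))"
  proof (rule sum.cong[OF refl])
    fix i assume i: "i \<in> {..<I}"
    then have iK: "i + (K - i) = K" by (auto simp: K_def)
    let ?f = "\<lambda>l m. ((\<Lambda> - of_nat i gchoose l) * ?c m j) \<cdot> T i (int l + m)"
    have inner: "(\<Sum>k<K. ?g i k m) = (\<Lambda> gchoose i) \<cdot> (\<Sum>l<K - i. ?f l m)" for m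
    proof -
      have "(\<Sum>k<K. ?g i k m) = (\<Sum>k\<in>{i..<K}. ?g i k m)"
      proof (rule sum.mono_neutral_right)
        show "\<forall>k\<in>{..<K} - {i..<K}. ?g i k m = 0"
          using binomial_gbinomial[where 'a = complex] by (auto simp: binomial_eq_0 simp flip: binomial_gbinomial)
      qed auto
      also have "\<dots> = (\<Sum>l\<in>{..<K - i}. ?g i (i + l) m)"
        by (rule sum.reindex_bij_witness[of _ "\<lambda>l. i + l" "\<lambda>k. k - i"]) auto
      also have "\<dots> = (\<Sum>l\<in>{..<K - i}. (\<Lambda> gchoose i) \<cdot> ?f l m)"
      proof (rule sum.cong[OF refl])
        fix l
        \<comment> \<open>The regrouping isolates a factor depending on i only and leaves l = k - i
          as the index of a binomial shift by \<Lambda> - i.\<close>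
        have "(\<Lambda> gchoose (i + l)) * (of_nat (i + l) gchoose i) = (\<Lambda> gchoose i) * (\<Lambda> - of_nat i gchoose l)"
          using gbinomial_trinomial_revision[of i "i + l" \<Lambda>] by simp
        then show "?g i (i + l) m = (\<Lambda> gchoose i) \<cdot> ?f l m"
          by (simp only: scale_scale mult.assoc[symmetric]) (simp add: algebra_simps)
      qed
      finally show ?thesis by (simp only: scale_sum_right)
    qed
    have "(\<Sum>m\<in>{j..<M}. \<Sum>k<K. ?g i k m) = (\<Lambda> gchoose i) \<cdot> (\<Sum>m\<in>{j..<M}. \<Sum>l<K - i. ?f l m)"
      unfolding inner scale_sum_right ..
    also have "(\<Sum>m\<in>{j..<M}. \<Sum>l<K - i. ?f l m) = (\<Sum>l<K - i. \<Sum>m\<in>{j..<M}. ?f l m)"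
      by (rule sum.swap)
    also have "\<dots> = (\<Sum>s\<in>{j..<int S}. \<Sum>l<Suc L. ?f l (s - int l))"
      by (rule sum_diagonal) (use i in \<open>auto simp: zhu_coeff_eq_0 S K_def L_def M_def\<close>)
    also have "\<dots> = (\<Sum>s\<in>{j..<int S}. zhu_coeff (of_int e + (\<Lambda> - of_nat i)) s j \<cdot> T i s)"
    proof (rule sum.cong[OF refl])
      fix s assume "s \<in> {j..<int S}"
      then have "zhu_coeff (of_int e + (\<Lambda> - of_nat i)) s j = (\<Sum>l\<le>L. (\<Lambda> - of_nat i gchoose l) * ?c (s - int l) j)"
        by (intro zhu_coeff_binomial_shift) (auto simp: L_def)
      then show "(\<Sum>l<Suc L. ?f l (s - int l)) = zhu_coeff (of_int e + (\<Lambda> - of_nat i)) s j \<cdot> T i s"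
        by (simp add: scale_sum_left lessThan_Suc_atMost)
    qed
    finally show "(\<Sum>m\<in>{j..<M}. \<Sum>k<K. ?g i k m) =
       (\<Lambda> gchoose i) \<cdot> (\<Sum>s\<in>{j..<int S}. zhu_coeff (of_int e + (\<Lambda> - of_nat i)) s j \<cdot> T i s)" .
  qed
  finally have lhs: "sq_psi x z (sq_mode V u j w) - sq_mode V u j (sq_psi x z w) = \<dots>" .
  have psi: "sq_psi x z u = (\<Sum>i<I. (\<Lambda> gchoose i) \<cdot> vmode V z (int i) u)"
    unfolding \<Lambda>_def by (rule sq_psi_homogeneous[OF z I])
  have zi: "sq_mode V (vmode V z (int i) u) (j + int l) w =
      (\<Sum>s\<in>{j..<int S}. zhu_coeff (of_int (d + e - int i - 1)) s (j + int l) \<cdot> T i s)" for i l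
  proof -
    have "sq_mode V (vmode V z (int i) u) (j + int l) w =
      (\<Sum>s\<in>{j + int l..<int S}. zhu_coeff (of_int (d + e - int i - 1)) s (j + int l) \<cdot> T i s)"
      unfolding T_def by (rule sq_mode_homogeneous[OF vmode_grade[OF z u]]) (use S T_def in simp)
    also have "\<dots> = (\<Sum>s\<in>{j..<int S}. zhu_coeff (of_int (d + e - int i - 1)) s (j + int l) \<cdot> T i s)"
      by (rule sum.mono_neutral_left) (auto simp: zhu_coeff_eq_0)
    finally show ?thesis .
  qed
  have mode: "sq_mode V (sq_psi x z u) (j + int l) w =
      (\<Sum>i<I. (\<Lambda> gchoose i) \<cdot> (\<Sum>s\<in>{j..<int S}. zhu_coeff (of_int (d + e - int i - 1)) s (j + int l) \<cdot> T i s))" for l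
    unfolding psi sq_mode_sum_left sq_mode_scale_left zi ..
  have "(\<Sum>l::nat. (x ^ l / fact l) \<cdot> sq_mode V (sq_psi x z u) (j + int l) w) =
    (\<Sum>l<Suc L. (x ^ l / fact l) \<cdot> sq_mode V (sq_psi x z u) (j + int l) w)"
  proof (rule Sum_any_nat_less)
    fix l assume l: "l \<ge> Suc L"
    have "(\<Sum>s\<in>{j..<int S}. zhu_coeff (of_int (d + e - int i - 1)) s (j + int l) \<cdot> T i s) = 0" for i
      using l by (intro sum.neutral) (auto simp: zhu_coeff_eq_0 L_def)
    then show "(x ^ l / fact l) \<cdot> sq_mode V (sq_psi x z u) (j + int l) w = 0"
      unfolding mode by simp
  qed
  also have "\<dots> = (\<Sum>i<I. (\<Lambda> gchoose i) \<cdot> (\<Sum>s\<in>{j..<int S}. (\<Sum>l\<le>L. x ^ l / fact l * zhu_coeff (of_int (d + e - int i - 1)) s (j + int l)) \<cdot> T i s))"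
    (is "_ = ?R")
  proof -
    have "(\<Sum>l<Suc L. (x ^ l / fact l) \<cdot> sq_mode V (sq_psi x z u) (j + int l) w) =
      (\<Sum>l\<le>L. \<Sum>i<I. (\<Lambda> gchoose i) \<cdot> (\<Sum>s\<in>{j..<int S}. (x ^ l / fact l * zhu_coeff (of_int (d + e - int i - 1)) s (j + int l)) \<cdot> T i s))"
      unfolding mode scale_sum_right scale_scale lessThan_Suc_atMost by (simp only: mult_ac)
    also have "\<dots> = (\<Sum>i<I. (\<Lambda> gchoose i) \<cdot> (\<Sum>l\<le>L. \<Sum>s\<in>{j..<int S}. (x ^ l / fact l * zhu_coeff (of_int (d + e - int i - 1)) s (j + int l)) \<cdot> T i s))"
      by (subst sum.swap) (simp only: scale_sum_right)
    also have "\<dots> = ?R"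
      by (subst sum.swap) (simp only: scale_sum_left)
    finally show ?thesis .
  qed
  also have "\<dots> = (\<Sum>i<I. (\<Lambda> gchoose i) \<cdot> (\<Sum>s\<in>{j..<int S}. zhu_coeff (of_int e + (\<Lambda> - of_nat i)) s j \<cdot> T i s))"
  proof (intro sum.cong refl arg_cong2[where f = "vscale V"])
    fix i s assume "s \<in> {j..<int S}"
    then have "zhu_coeff (of_int (d + e - int i - 1) + x) s j = (\<Sum>l\<le>L. x ^ l / fact l * zhu_coeff (of_int (d + e - int i - 1)) s (j + int l))"
      by (intro zhu_coeff_exp_shift) (auto simp: L_def)
    moreover have "of_int (d + e - int i - 1) + x = of_int e + (\<Lambda> - of_nat i)"
      by (simp add: \<Lambda>_def)
    ultimately show "(\<Sum>l\<le>L. x ^ l / fact l * zhu_coeff (of_int (d + e - int i - 1)) s (j + int l)) = zhu_coeff (of_int e + (\<Lambda> - of_nat i)) s j"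
      by (simp only:)
  qed
  finally show ?thesis unfolding lhs ..
qed

lemma sq_psi_commutator:
  "sq_psi x z (sq_mode V u j w) - sq_mode V u j (sq_psi x z w) =
    (\<Sum>l::nat. (x ^ l / fact l) \<cdot> sq_mode V (sq_psi x z u) (j + int l) w)"
proof -
  have add: "(\<Sum>l::nat. (x ^ l / fact l) \<cdot> sq_mode V (a + b) (j + int l) w) =
    (\<Sum>l::nat. (x ^ l / fact l) \<cdot> sq_mode V a (j + int l) w) + (\<Sum>l::nat. (x ^ l / fact l) \<cdot> sq_mode V b (j + int l) w)" for a b
    unfolding sq_mode_add_left scale_right_distrib
    by (rule Sum_any.distrib) (rule finite_sq_mode_shift)+
  show ?thesis
  proof (induction z rule: graded_induct)
    case (1 d z)
    show ?case
    proof (induction u rule: graded_induct)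
      case (1 e u)
      with \<open>z \<in> vgrade V d\<close> show ?case by (rule sq_psi_commutator_homogeneous)
    next
      case (2 u u')
      have "(\<Sum>l::nat. (x ^ l / fact l) \<cdot> sq_mode V (sq_psi x z (u + u')) (j + int l) w) =
        (\<Sum>l::nat. (x ^ l / fact l) \<cdot> sq_mode V (sq_psi x z u) (j + int l) w) +
        (\<Sum>l::nat. (x ^ l / fact l) \<cdot> sq_mode V (sq_psi x z u') (j + int l) w)"
        by (simp only: sq_psi_add_right add)
      then show ?case
        unfolding 2[symmetric] by (simp add: sq_mode_add_left sq_psi_add_right)
    qed
  next
    case (2 z z')
    have "(\<Sum>l::nat. (x ^ l / fact l) \<cdot> sq_mode V (sq_psi x (z + z') u) (j + int l) w) =
      (\<Sum>l::nat. (x ^ l / fact l) \<cdot> sq_mode V (sq_psi x z u) (j + int l) w) +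
      (\<Sum>l::nat. (x ^ l / fact l) \<cdot> sq_mode V (sq_psi x z' u) (j + int l) w)"
      by (simp only: sq_psi_add_left add)
    then show ?case
      unfolding 2[symmetric] by (simp add: sq_mode_add_right sq_psi_add_left)
  qed
qed

text \<open>For fixed vectors both sides of \<open>sq_psi_commutator\<close> are polynomials in x;
  this is the comparison of the coefficients of x^n / n!, which isolates the nonnegative modes of
  z.\<close>

lemma sq_mode_commutator:
  "sq_mode V z (int n) (sq_mode V u j w) - sq_mode V u j (sq_mode V z (int n) w) =
    (\<Sum>l\<le>n. of_nat (n choose l) \<cdot> sq_mode V (sq_mode V z (int (n - l)) u) (j + int l) w)"
proof -
  define B where "B m l = sq_mode V (sq_mode V z (int m) u) (j + int l) w" for m l :: nat
  obtain N1 :: nat where N1: "\<forall>n\<ge>int N1. sq_mode V z n (sq_mode V u j w) = 0 \<and> sq_mode V z n w = 0"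
    using sq_mode_truncation2 by blast
  obtain N2 :: nat where N2: "\<forall>n\<ge>int N2. sq_mode V z n u = 0" using sq_mode_truncation by blast
  obtain N3 :: nat where N3: "\<forall>m\<in>{..<N2}. \<forall>s\<ge>int N3. sq_mode V (sq_mode V z (int m) u) s w = 0"
    using sq_mode_truncation_finite[of "{..<N2}" "\<lambda>m. sq_mode V z (int m) u" "\<lambda>_. w"] by blast
  define L where "L = nat (int N3 - j)"
  \<comment> \<open>Since \<open>B m l\<close> vanishes once m >= N2 or l >= L, it vanishes for m +
    l >= N2 + L, which bounds the degree of the right-hand polynomial.\<close>
  define N where "N = Suc (max n (max N1 (N2 + L)))"
  have B0: "B m l = 0" if "m \<ge> N2 \<or> l \<ge> L" for m l
  proof (cases "m \<ge> N2")
    case True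
    then show ?thesis using N2 by (simp add: B_def)
  next
    case False
    then show ?thesis using N3 that by (auto simp: B_def L_def)
  qed
  have "sq_mode V z (int n) (sq_mode V u j w) - sq_mode V u j (sq_mode V z (int n) w) =
    (\<Sum>l\<le>n. of_nat (n choose l) \<cdot> B (n - l) l)"
  proof (rule polynomial_coeffs_eq[where N = N and
        f = "\<lambda>n. sq_mode V z (int n) (sq_mode V u j w) - sq_mode V u j (sq_mode V z (int n) w)" and
        g = "\<lambda>n. \<Sum>l\<le>n. of_nat (n choose l) \<cdot> B (n - l) l"])
    fix x
    have "(\<Sum>n<N. (x ^ n / fact n) \<cdot> (sq_mode V z (int n) (sq_mode V u j w) - sq_mode V u j (sq_mode V z (int n) w)))
       = sq_psi x z (sq_mode V u j w) - sq_mode V u j (sq_psi x z w)"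
      using N1 sq_psi_eq_sum[of N z "sq_mode V u j w" x] sq_psi_eq_sum[of N z w x]
      by (simp add: N_def scale_right_diff_distrib sum_subtractf sq_mode_sum_right sq_mode_scale_right del: sum.lessThan_Suc)
    also have "\<dots> = (\<Sum>l::nat. (x ^ l / fact l) \<cdot> sq_mode V (sq_psi x z u) (j + int l) w)"
      by (rule sq_psi_commutator)
    also have "\<dots> = (\<Sum>l::nat. (x ^ l / fact l) \<cdot> (\<Sum>m<N. (x ^ m / fact m) \<cdot> B m l))"
    proof (rule Sum_any.cong)
      fix l
      have "sq_psi x z u = (\<Sum>m<N. (x ^ m / fact m) \<cdot> sq_mode V z (int m) u)"
        using N2 by (intro sq_psi_eq_sum) (auto simp: N_def)
      then show "(x ^ l / fact l) \<cdot> sq_mode V (sq_psi x z u) (j + int l) w = (x ^ l / fact l) \<cdot> (\<Sum>m<N. (x ^ m / fact m) \<cdot> B m l)"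
        by (simp only: B_def sq_mode_sum_left sq_mode_scale_left)
    qed
    also have "(\<Sum>l::nat. (x ^ l / fact l) \<cdot> (\<Sum>m<N. (x ^ m / fact m) \<cdot> B m l)) =
        (\<Sum>l<N. (x ^ l / fact l) \<cdot> (\<Sum>m<N. (x ^ m / fact m) \<cdot> B m l))"
    proof (rule Sum_any_nat_less)
      fix l assume "l \<ge> N"
      then have "B m l = 0" for m by (intro B0) (auto simp: N_def)
      then show "(x ^ l / fact l) \<cdot> (\<Sum>m<N. (x ^ m / fact m) \<cdot> B m l) = 0" by simp
    qed
    also have "\<dots> = (\<Sum>(l, m)\<in>{..<N} \<times> {..<N}. (x ^ l / fact l * (x ^ m / fact m)) \<cdot> B m l)"
      by (simp add: scale_sum_right sum.cartesian_product)
    also have "\<dots> = (\<Sum>(l, m)\<in>{(l, m). l + m < N}. (x ^ l / fact l * (x ^ m / fact m)) \<cdot> B m l)"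
    proof (rule sum.mono_neutral_right)
      show "\<forall>i\<in>{..<N} \<times> {..<N} - {(l, m). l + m < N}. (case i of (l, m) \<Rightarrow> (x ^ l / fact l * (x ^ m / fact m)) \<cdot> B m l) = 0"
      proof
        fix i assume "i \<in> {..<N} \<times> {..<N} - {(l, m). l + m < N}"
        then obtain l m where "i = (l, m)" "l + m \<ge> N2 + L" by (auto simp: N_def)
        moreover from this have "m \<ge> N2 \<or> l \<ge> L" by linarith
        ultimately show "(case i of (l, m) \<Rightarrow> (x ^ l / fact l * (x ^ m / fact m)) \<cdot> B m l) = 0"
          by (simp add: B0)
      qed
    qed auto
    also have "\<dots> = (\<Sum>n<N. \<Sum>l\<le>n. (x ^ l / fact l * (x ^ (n - l) / fact (n - l))) \<cdot> B (n - l) l)"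
      by (rule sum.triangle_reindex)
    also have "\<dots> = (\<Sum>n<N. (x ^ n / fact n) \<cdot> (\<Sum>l\<le>n. of_nat (n choose l) \<cdot> B (n - l) l))"
    proof (rule sum.cong[OF refl])
      fix n
      show "(\<Sum>l\<le>n. (x ^ l / fact l * (x ^ (n - l) / fact (n - l))) \<cdot> B (n - l) l) = (x ^ n / fact n) \<cdot> (\<Sum>l\<le>n. of_nat (n choose l) \<cdot> B (n - l) l)"
        unfolding scale_sum_right scale_scale
        by (intro sum.cong refl arg_cong2[where f = "vscale V"])
           (simp add: binomial_fact power_add[symmetric])
    qed
    finally show "(\<Sum>n<N. (x ^ n / fact n) \<cdot> (sq_mode V z (int n) (sq_mode V u j w) - sq_mode V u j (sq_mode V z (int n) w)))
       = (\<Sum>n<N. (x ^ n / fact n) \<cdot> (\<Sum>l\<le>n. of_nat (n choose l) \<cdot> B (n - l) l))" .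
  qed (simp add: N_def)
  then show ?thesis by (simp only: B_def)
qed

section \<open>Skew-symmetry of the square-bracket modes\<close>

lemma sq_deriv_power_linear:
  "(sq_deriv ^^ j) (u + v) = (sq_deriv ^^ j) u + (sq_deriv ^^ j) v"
  "(sq_deriv ^^ j) (c \<cdot> u) = c \<cdot> (sq_deriv ^^ j) u"
  "(sq_deriv ^^ j) 0 = 0"
  by (induction j) (auto simp: sq_deriv_add sq_deriv_scale)

lemma sq_deriv_power_sum: "(sq_deriv ^^ j) (sum f A) = (\<Sum>i\<in>A. (sq_deriv ^^ j) (f i))"
  by (induction A rule: infinite_finite_induct) (auto simp: sq_deriv_power_linear)

lemma L_minus1_power_grade: "u \<in> vgrade V f \<Longrightarrow> (voa_L V (-1) ^^ j) u \<in> vgrade V (f + int j)"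
  by (induction j) (auto dest: L_minus1_grade simp: algebra_simps)

text \<open>On weight f + j one has L(-1) = D - (f + j), so the left side is the binomial
  coefficient of D - f over j applied to u. By \<open>sum_zhu_coeff\<close> its coefficients with
  respect to D^t / t! are the given numbers.\<close>

lemma L_minus1_power_expansion:
  assumes u: "u \<in> vgrade V f"
  shows "(1 / fact j) \<cdot> (voa_L V (-1) ^^ j) u =
    (\<Sum>t\<le>j. (zhu_coeff (1 - of_int f) (int j) (int t) / fact t) \<cdot> (sq_deriv ^^ t) u)"
proof (induction j)
  case 0
  have "zhu_coeff (1 - of_int f) 0 0 = 1" using zhu_coeff_0[of "1 - of_int f" 0] by simp
  then show ?case by simp
next
  case (Suc j)
  let ?L = "voa_L V (-1)" and ?D = sq_deriv
  let ?c = "\<lambda>j t. zhu_coeff (1 - of_int f) (int j) (int t)"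
  have rec: "of_nat (Suc j) * ?c (Suc j) t = of_nat t * zhu_coeff (1 - of_int f) (int j) (int t - 1) - (of_int f + of_nat j) * ?c j t" for t
  proof -
    have "- of_nat t * zhu_coeff (1 - of_int f) (int j) (int t - 1) =
       (1 - of_int f) * ?c j t - of_nat (Suc j) * (?c (Suc j) t + ?c j t)"
      using zhu_coeff_deriv[of "int t" "1 - of_int f" "int j"] zhu_coeff_shift[of "1 - of_int f" "int j + 1" "int t"]
      by (simp add: add.commute)
    then show ?thesis by (simp add: algebra_simps)
  qed
  define X where "X = (1 / fact j) \<cdot> (?L ^^ j) u"
  have X: "X \<in> vgrade V (f + int j)"
    unfolding X_def using L_minus1_power_grade[OF u] graded_subspace by (simp add: subspace_scale)
  have "(1 / fact (Suc j)) \<cdot> (?L ^^ Suc j) u = (1 / of_nat (Suc j)) \<cdot> ?L X"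
    by (simp add: X_def voa_L_scale)
  also have "?L X = ?D X - (of_int f + of_nat j) \<cdot> X"
    using L0_grade[OF X] by (simp add: sq_deriv_def)
  also have "?D X = (\<Sum>t\<le>j. (?c j t / fact t) \<cdot> (?D ^^ Suc t) u)"
    unfolding X_def Suc.IH by (simp add: sq_deriv_sum sq_deriv_scale)
  also have "\<dots> = (\<Sum>t\<le>Suc j. (of_nat t * zhu_coeff (1 - of_int f) (int j) (int t - 1) / fact t) \<cdot> (?D ^^ t) u)"
  proof -
    have "of_nat (Suc t) * zhu_coeff (1 - of_int f) (int j) (int (Suc t) - 1) / fact (Suc t) = ?c j t / fact t" for t
    proof -
      have idx: "int (Suc t) - 1 = int t" by simp
      show ?thesis unfolding idx by (simp del: of_nat_Suc)
    qed
    then show ?thesis by (subst sum.atMost_Suc_shift) (simp only: of_nat_0 mult_zero_left div_0 scale_zero_left add_0_left)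
  qed
  also have "(of_int f + of_nat j) \<cdot> X = (\<Sum>t\<le>Suc j. ((of_int f + of_nat j) * ?c j t / fact t) \<cdot> (?D ^^ t) u)"
    unfolding X_def Suc.IH by (simp add: scale_sum_right zhu_coeff_eq_0)
  also have "(\<Sum>t\<le>Suc j. (of_nat t * zhu_coeff (1 - of_int f) (int j) (int t - 1) / fact t) \<cdot> (?D ^^ t) u) - \<dots> =
      (\<Sum>t\<le>Suc j. (of_nat (Suc j) * ?c (Suc j) t / fact t) \<cdot> (?D ^^ t) u)"
    unfolding rec by (simp only: sum_subtractf[symmetric] scale_left_diff_distrib[symmetric] diff_divide_distrib)
  also have "(1 / of_nat (Suc j)) \<cdot> \<dots> = (\<Sum>t\<le>Suc j. (?c (Suc j) t / fact t) \<cdot> (?D ^^ t) u)"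
    unfolding scale_sum_right scale_scale by (rule sum.cong) (simp_all del: of_nat_Suc)
  finally show ?case .
qed

text \<open>Ordinary skew-symmetry is inserted into the expansion of the mode of a, and each divided
  power of L(-1) is rewritten in powers of D. What remains is an identity of coefficients for every
  fixed vector b_s a.\<close>

lemma sq_skew_symmetry_homogeneous:
  assumes a: "a \<in> vgrade V d" and b: "b \<in> vgrade V e"
  shows "sq_mode V a n b = (\<Sum>t::nat. ((-1) powi (n + 1 + int t) / fact t) \<cdot> (sq_deriv ^^ t) (sq_mode V b (n + int t) a))"
proof -
  obtain S1 :: nat where S1: "\<And>s. s \<ge> int S1 \<Longrightarrow> vmode V a s b = 0" using vmode_truncation_nat by blast
  obtain S2 :: nat where S2: "\<And>s. s \<ge> int S2 \<Longrightarrow> vmode V b s a = 0" using vmode_truncation_nat by blast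
  define S where "S = int (max S1 S2)"
  have Sa: "vmode V a s b = 0" and Sb: "vmode V b s a = 0" if "s \<ge> S" for s
    using that S1 S2 by (auto simp: S_def)
  define L where "L = Suc (nat (S - n))"
  let ?L = "voa_L V (-1)" and ?D = sq_deriv
  let ?c = "\<lambda>s j t. zhu_coeff (of_int s + 2 - of_int d - of_int e) (int j) (int t)"
  let ?sg = "\<lambda>n. (-1) powi (n + 1) :: complex"
  let ?f = "\<lambda>j k. (zhu_coeff (of_int d) k n * ?sg (int j + k)) \<cdot> (1 / fact j) \<cdot> (?L ^^ j) (vmode V b (int j + k) a)"
  have skew: "vmode V a k b = (\<Sum>j<L. ?sg (int j + k) \<cdot> (1 / fact j) \<cdot> (?L ^^ j) (vmode V b (int j + k) a))" if "k \<ge> n" for k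
  proof -
    have "vmode V a k b = (\<Sum>j<L. ((-1) powi (k + 1 + int j) / fact j) \<cdot> (?L ^^ j) (vmode V b (k + int j) a))"
      unfolding skew_symmetry[of a k b] using that
      by (intro Sum_any_nat_less) (simp add: Sb L_minus1_power_linear L_def)
    then show ?thesis by (simp add: algebra_simps)
  qed
  have Lb: "(1 / fact j) \<cdot> (?L ^^ j) (vmode V b s a) = (\<Sum>t<L. (?c s j t / fact t) \<cdot> (?D ^^ t) (vmode V b s a))" if "j < L" for j s
  proof -
    have "(1 / fact j) \<cdot> (?L ^^ j) (vmode V b s a) =
      (\<Sum>t\<le>j. (zhu_coeff (1 - of_int (e + d - s - 1)) (int j) (int t) / fact t) \<cdot> (?D ^^ t) (vmode V b s a))"
      by (rule L_minus1_power_expansion[OF vmode_grade[OF b a]])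
    also have "\<dots> = (\<Sum>t<L. (zhu_coeff (1 - of_int (e + d - s - 1)) (int j) (int t) / fact t) \<cdot> (?D ^^ t) (vmode V b s a))"
      using that by (intro sum.mono_neutral_left) (auto simp: zhu_coeff_eq_0)
    also have "1 - of_int (e + d - s - 1) = of_int s + 2 - of_int d - (of_int e :: complex)" by simp
    finally show ?thesis .
  qed
  have "sq_mode V a n b = (\<Sum>k\<in>{n..<S}. zhu_coeff (of_int d) k n \<cdot> vmode V a k b)"
    by (rule sq_mode_homogeneous[OF a Sa])
  also have "\<dots> = (\<Sum>k\<in>{n..<S}. \<Sum>j<L. ?f j k)"
    by (rule sum.cong[OF refl]) (simp add: skew scale_sum_right)
  also have "\<dots> = (\<Sum>j<L. \<Sum>k\<in>{n..<S}. ?f j k)" by (rule sum.swap)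
  also have "\<dots> = (\<Sum>s\<in>{n..<S}. \<Sum>j<L. ?f j (s - int j))"
    by (rule sum_diagonal) (auto simp: zhu_coeff_eq_0 Sb L_minus1_power_linear L_def)
  also have "\<dots> = (\<Sum>s\<in>{n..<S}. \<Sum>t<L. (?sg (n + int t) * zhu_coeff (of_int e) s (n + int t) / fact t) \<cdot> (?D ^^ t) (vmode V b s a))"
  proof (rule sum.cong[OF refl])
    fix s assume s: "s \<in> {n..<S}"
    have "(\<Sum>j<L. ?f j (s - int j)) =
      (\<Sum>j<L. \<Sum>t<L. (zhu_coeff (of_int d) (s - int j) n * ?sg s * (?c s j t / fact t)) \<cdot> (?D ^^ t) (vmode V b s a))"
      by (rule sum.cong[OF refl]) (simp add: Lb scale_sum_right)
    also have "\<dots> = (\<Sum>t<L. (\<Sum>j<L. zhu_coeff (of_int d) (s - int j) n * ?sg s * (?c s j t / fact t)) \<cdot> (?D ^^ t) (vmode V b s a))"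
      by (subst sum.swap) (simp only: scale_sum_left)
    also have "\<dots> = (\<Sum>t<L. (?sg (n + int t) * zhu_coeff (of_int e) s (n + int t) / fact t) \<cdot> (?D ^^ t) (vmode V b s a))"
    proof (intro sum.cong refl arg_cong2[where f = "vscale V"])
      fix t
      \<comment> \<open>The vector b_s a has weight d + e - s - 1, which enters as s + 2 - d - e.
        Convolution with weight d gives s + 1 - e, and the reflection y -> -y turns this into e, the
        weight of b.\<close>
      have "(\<Sum>j<L. zhu_coeff (of_int d) (s - int j) n * ?sg s * (?c s j t / fact t)) =
          (?sg s / fact t) * (\<Sum>j\<le>nat (S - n). zhu_coeff (of_int d) (s - int j) n * ?c s j t)"
        unfolding L_def lessThan_Suc_atMost by (simp add: sum_distrib_left sum_divide_distrib mult_ac)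
      also have "(\<Sum>j\<le>nat (S - n). zhu_coeff (of_int d) (s - int j) n * ?c s j t) =
          zhu_coeff (of_int d + (of_int s + 2 - of_int d - of_int e) - 1) s (n + int t)"
        using s by (intro zhu_coeff_convolution) auto
      also have "of_int d + (of_int s + 2 - of_int d - of_int e) - 1 = of_int (s + 1) - (of_int e :: complex)"
        by simp
      also have "?sg s / fact t * zhu_coeff (of_int (s + 1) - of_int e) s (n + int t) = ?sg (n + int t) * zhu_coeff (of_int e) s (n + int t) / fact t"
        unfolding zhu_coeff_reflect by simp
      finally show "(\<Sum>j<L. zhu_coeff (of_int d) (s - int j) n * ?sg s * (?c s j t / fact t)) =
        ?sg (n + int t) * zhu_coeff (of_int e) s (n + int t) / fact t" .
    qed
    finally show "(\<Sum>j<L. ?f j (s - int j)) =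
      (\<Sum>t<L. (?sg (n + int t) * zhu_coeff (of_int e) s (n + int t) / fact t) \<cdot> (?D ^^ t) (vmode V b s a))" .
  qed
  also have "\<dots> = (\<Sum>t<L. (?sg (n + int t) / fact t) \<cdot> (?D ^^ t) (sq_mode V b (n + int t) a))"
  proof (subst sum.swap, rule sum.cong[OF refl])
    fix t
    have "sq_mode V b (n + int t) a = (\<Sum>s\<in>{n + int t..<S}. zhu_coeff (of_int e) s (n + int t) \<cdot> vmode V b s a)"
      by (rule sq_mode_homogeneous[OF b Sb])
    also have "\<dots> = (\<Sum>s\<in>{n..<S}. zhu_coeff (of_int e) s (n + int t) \<cdot> vmode V b s a)"
      by (rule sum.mono_neutral_left) (auto simp: zhu_coeff_eq_0)
    finally show "(\<Sum>s\<in>{n..<S}. (?sg (n + int t) * zhu_coeff (of_int e) s (n + int t) / fact t) \<cdot> (?D ^^ t) (vmode V b s a))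
      = (?sg (n + int t) / fact t) \<cdot> (?D ^^ t) (sq_mode V b (n + int t) a)"
      by (simp add: sq_deriv_power_sum sq_deriv_power_linear scale_sum_right)
  qed
  also have "\<dots> = (\<Sum>t::nat. (?sg (n + int t) / fact t) \<cdot> (?D ^^ t) (sq_mode V b (n + int t) a))"
    by (rule Sum_any_nat_less[symmetric]) (simp add: sq_mode_homogeneous[OF b Sb] L_def sq_deriv_power_linear)
  finally show ?thesis by (simp add: algebra_simps)
qed

lemma sq_skew_symmetry:
  "sq_mode V a n b = (\<Sum>t::nat. ((-1) powi (n + 1 + int t) / fact t) \<cdot> (sq_deriv ^^ t) (sq_mode V b (n + int t) a))"
proof -
  have fin: "finite {t. ((-1) powi (n + 1 + int t) / fact t) \<cdot> (sq_deriv ^^ t) (sq_mode V b (n + int t) a) \<noteq> 0}" for a b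
    using finite_sq_mode_shift[of "\<lambda>_. 1" b n a] by (rule rev_finite_subset) (auto simp: sq_deriv_power_linear)
  show ?thesis
  proof (induction a rule: graded_induct)
    case (1 d a)
    show ?case
    proof (induction b rule: graded_induct)
      case (1 e b)
      with \<open>a \<in> vgrade V d\<close> show ?case by (rule sq_skew_symmetry_homogeneous)
    next
      case (2 b b')
      show ?case
        unfolding sq_mode_add_right sq_mode_add_left sq_deriv_power_linear scale_right_distrib
          Sum_any.distrib[OF fin fin] 2[symmetric] ..
    qed
  next
    case (2 a a')
    show ?case
      unfolding sq_mode_add_right sq_mode_add_left sq_deriv_power_linear scale_right_distrib
        Sum_any.distrib[OF fin fin] 2[symmetric] ..
  qed
qed

end

section \<open>Automorphisms and homogeneous components\<close>

context voa_automorphism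
begin

lemma aut_add: "\<nu> (u + v) = \<nu> u + \<nu> v"
  and aut_scale: "\<nu> (c \<cdot> u) = c \<cdot> \<nu> u"
  using aut_linear unfolding Vector_Spaces.linear_iff by auto

lemma aut_mode: "\<nu> (vmode V u n w) = vmode V (\<nu> u) n (\<nu> w)"
  using fun_cong[OF aut_vmode[of u n], of "\<nu> w"] aut_bij by (simp add: bij_is_inj)

lemma aut_L: "\<nu> (voa_L V n u) = voa_L V n (\<nu> u)"
  by (simp add: voa_L_def aut_mode aut_conformal)

lemma aut_grade: "u \<in> vgrade V d \<Longrightarrow> \<nu> u \<in> vgrade V d"
  unfolding grade_iff by (simp add: aut_scale flip: aut_L)

lemma aut_0 [simp]: "\<nu> 0 = 0"
  using aut_scale[of 0 0] by simp

lemma aut_power_linear: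
  "(\<nu> ^^ r) (u + v) = (\<nu> ^^ r) u + (\<nu> ^^ r) v"
  "(\<nu> ^^ r) (c \<cdot> u) = c \<cdot> (\<nu> ^^ r) u"
  "(\<nu> ^^ r) 0 = 0"
  by (induction r) (auto simp: aut_add aut_scale)

lemma aut_power_sum: "(\<nu> ^^ r) (sum f A) = (\<Sum>i\<in>A. (\<nu> ^^ r) (f i))"
  by (induction A rule: infinite_finite_induct) (auto simp: aut_power_linear)

lemma aut_power_grade: "u \<in> vgrade V d \<Longrightarrow> (\<nu> ^^ r) u \<in> vgrade V d"
  by (induction r) (auto intro: aut_grade)

lemma aut_power_mode: "(\<nu> ^^ r) (vmode V u n w) = vmode V ((\<nu> ^^ r) u) n ((\<nu> ^^ r) w)"
  by (induction r) (auto simp: aut_mode)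

lemma aut_power_L0: "(\<nu> ^^ r) ((voa_L V 0 ^^ j) u) = (voa_L V 0 ^^ j) ((\<nu> ^^ r) u)"
proof (induction j)
  case (Suc j)
  have "(\<nu> ^^ r) (voa_L V 0 v) = voa_L V 0 ((\<nu> ^^ r) v)" for v
    by (induction r) (auto simp: aut_L)
  then show ?case using Suc.IH by simp
qed simp

lemma aut_power_sq_mode: "(\<nu> ^^ r) (sq_mode V u n w) = sq_mode V ((\<nu> ^^ r) u) n ((\<nu> ^^ r) w)"
proof -
  obtain N :: nat where N: "\<And>j n. n \<ge> int N \<Longrightarrow> vmode V ((voa_L V 0 ^^ j) u) n w = 0"
    using L0_power_truncation by blast
  have N': "vmode V ((voa_L V 0 ^^ j) ((\<nu> ^^ r) u)) n ((\<nu> ^^ r) w) = 0" if "n \<ge> int N" for j n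
    using arg_cong[OF N[OF that, of j], of "\<nu> ^^ r"] by (simp add: aut_power_mode aut_power_L0 aut_power_linear)
  define L where "L = nat (int N - n)"
  have L: "int N - n \<le> int L" by (simp add: L_def)
  have "sq_mode V u n w = (\<Sum>m\<in>{n..<int N}. \<Sum>j<L. sq_coeff n m j \<cdot> vmode V ((voa_L V 0 ^^ j) u) m w)"
    by (rule sq_mode_box[OF N L])
  moreover have "sq_mode V ((\<nu> ^^ r) u) n ((\<nu> ^^ r) w) =
      (\<Sum>m\<in>{n..<int N}. \<Sum>j<L. sq_coeff n m j \<cdot> vmode V ((voa_L V 0 ^^ j) ((\<nu> ^^ r) u)) m ((\<nu> ^^ r) w))"
    by (rule sq_mode_box[OF N' L])
  ultimately show ?thesis
    by (simp add: aut_power_sum aut_power_linear aut_power_mode aut_power_L0)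
qed

lemma aut_power_inv_power: "(\<nu> ^^ r) ((inv \<nu> ^^ r) u) = u"
proof (induction r arbitrary: u)
  case (Suc r)
  have "(\<nu> ^^ Suc r) ((inv \<nu> ^^ Suc r) u) = (\<nu> ^^ r) (\<nu> (inv \<nu> ((inv \<nu> ^^ r) u)))"
    by (subst funpow_Suc_right) simp
  also have "\<dots> = u"
    using Suc.IH aut_bij by (simp add: bij_is_surj surj_f_inv_f)
  finally show ?case .
qed simp

lemma aut_power_sq_psi: "(\<nu> ^^ r) (sq_psi x u w) = sq_psi x ((\<nu> ^^ r) u) ((\<nu> ^^ r) w)"
proof -
  obtain N :: nat where N: "\<And>n. n \<ge> int N \<Longrightarrow> sq_mode V u n w = 0" using sq_mode_truncation by blast
  have N': "sq_mode V ((\<nu> ^^ r) u) n ((\<nu> ^^ r) w) = 0" if "n \<ge> int N" for n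
    using arg_cong[OF N[OF that], of "\<nu> ^^ r"] by (simp add: aut_power_sq_mode aut_power_linear)
  have "sq_psi x u w = (\<Sum>n<N. (x ^ n / fact n) \<cdot> sq_mode V u (int n) w)"
    by (rule sq_psi_eq_sum[OF N])
  moreover have "sq_psi x ((\<nu> ^^ r) u) ((\<nu> ^^ r) w) =
      (\<Sum>n<N. (x ^ n / fact n) \<cdot> sq_mode V ((\<nu> ^^ r) u) (int n) ((\<nu> ^^ r) w))"
    by (rule sq_psi_eq_sum[OF N'])
  ultimately show ?thesis
    by (simp add: aut_power_sum aut_power_linear aut_power_sq_mode)
qed

end

section \<open>Linearity of the projections onto homogeneous components\<close>

context vertex_operator_algebra
begin

lemma decomposes_sum:
  assumes "decomposes (vgrade V) u f" "finite A" "{i. f i \<noteq> 0} \<subseteq> A"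
  shows "u = (\<Sum>i\<in>A. f i)"
proof -
  have "u = (\<Sum>i | f i \<noteq> 0. f i)" using assms(1) unfolding decomposes_def by blast
  also have "\<dots> = (\<Sum>i\<in>A. f i)" using assms by (intro sum.mono_neutral_left) auto
  finally show ?thesis .
qed

lemma decomposesI:
  assumes "finite A" "\<And>i. i \<notin> A \<Longrightarrow> f i = 0" "\<And>i. f i \<in> vgrade V i" "u = (\<Sum>i\<in>A. f i)"
  shows "decomposes (vgrade V) u f"
proof -
  have sub: "{i. f i \<noteq> 0} \<subseteq> A" using assms(2) by blast
  then have "(\<Sum>i\<in>A. f i) = (\<Sum>i | f i \<noteq> 0. f i)" using assms(1) by (intro sum.mono_neutral_right) auto
  then show ?thesis
    unfolding decomposes_def using finite_subset[OF sub assms(1)] assms(3,4) by simp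
qed

lemma decomposes_component: "decomposes (vgrade V) u (component (vgrade V) u)"
  using decompose[of u] component_eq by metis

lemma component_add: "component (vgrade V) (u + v) i = component (vgrade V) u i + component (vgrade V) v i"
proof -
  let ?f = "component (vgrade V) u" and ?g = "component (vgrade V) v"
  have u: "decomposes (vgrade V) u ?f" and v: "decomposes (vgrade V) v ?g" by (rule decomposes_component)+
  let ?A = "{i. ?f i \<noteq> 0} \<union> {i. ?g i \<noteq> 0}"
  have fin: "finite ?A" using u v unfolding decomposes_def by blast
  have "decomposes (vgrade V) (u + v) (\<lambda>i. ?f i + ?g i)"
  proof (rule decomposesI[OF fin])
    show "?f i + ?g i \<in> vgrade V i" for i
      using u v graded_subspace unfolding decomposes_def by (meson subspace_add)
    have "u = (\<Sum>i\<in>?A. ?f i)" "v = (\<Sum>i\<in>?A. ?g i)"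
      by (rule decomposes_sum[OF u fin] decomposes_sum[OF v fin], blast)+
    then show "u + v = (\<Sum>i\<in>?A. ?f i + ?g i)" by (simp only: sum.distrib)
  qed auto
  then show ?thesis by (simp add: component_eq)
qed

lemma component_homogeneous:
  assumes "u \<in> vgrade V d"
  shows "component (vgrade V) u i = (if i = d then u else 0)"
proof -
  have "decomposes (vgrade V) u (\<lambda>i. if i = d then u else 0)"
    by (rule decomposesI[of "{d}"]) (use assms zero_grade in auto)
  then show ?thesis by (simp add: component_eq)
qed

lemma component_scale: "component (vgrade V) (c \<cdot> u) i = c \<cdot> component (vgrade V) u i"
proof (induction u rule: graded_induct)
  case (1 d u)
  then have "c \<cdot> u \<in> vgrade V d" using graded_subspace by (simp add: subspace_scale)
  then show ?case using 1 by (simp add: component_homogeneous)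
next
  case (2 u v)
  then show ?case by (simp add: scale_right_distrib component_add)
qed

lemma finite_component: "finite {i. component (vgrade V) u i \<noteq> 0}"
  using decomposes_component unfolding decomposes_def by blast

end

section \<open>Modes of \<open>X\<^sub>M(u, x)\<close>\<close>

context twisted_module
begin

abbreviation msc (infixr \<open>\<odot>\<close> 75)
  where "c \<odot> w \<equiv> mscale M c w"

lemma tmode_add_left: "tmode M (u + u') n w = tmode M u n w + tmode M u' n w"
  and tmode_scale_left: "tmode M (c \<cdot> u) n w = c \<odot> tmode M u n w"
  using tmode_linear_left[of n w] unfolding Vector_Spaces.linear_iff by auto

lemma tmode_add_right: "tmode M u n (w + w') = tmode M u n w + tmode M u n w'"
  and tmode_scale_right: "tmode M u n (c \<odot> w) = c \<odot> tmode M u n w"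
  using tmode_linear_right[of u n] unfolding Vector_Spaces.linear_iff by auto

lemma tmode_0_left [simp]: "tmode M 0 n w = 0"
  using tmode_scale_left[of 0 0] by simp

lemma tmode_0_right [simp]: "tmode M u n 0 = 0"
  using tmode_scale_right[of u n 0 0] by simp

section \<open>Mode identities contained in the twisted Jacobi identity\<close>

lemma all_fvar_iff:
  "(\<forall>z. z \<noteq> X1 \<and> z \<noteq> X2 \<longrightarrow> P z) \<longleftrightarrow> P X0 \<and> P Y0 \<and> P Y1 \<and> P Y2"
  "(\<forall>z. z \<noteq> X2 \<and> z \<noteq> X1 \<longrightarrow> P z) \<longleftrightarrow> P X0 \<and> P Y0 \<and> P Y1 \<and> P Y2"
  "(\<forall>z. z \<noteq> X2 \<and> z \<noteq> X0 \<longrightarrow> P z) \<longleftrightarrow> P X1 \<and> P Y0 \<and> P Y1 \<and> P Y2"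
  by (metis fvar.exhaust fvar.distinct)+

lemma twisted_jacobi_lhs:
  "fvertex (tmode M u) (fmono X1) (fvertex (tmode M v) (fmono X2) (fconst w)) e =
    (if \<forall>z. z \<noteq> X1 \<and> z \<noteq> X2 \<longrightarrow> e z = 0 then tmode M u (- e X1 - 1) (tmode M v (- e X2 - 1) w) else 0)"
  "fvertex (tmode M v) (fmono X2) (fvertex (tmode M u) (fmono X1) (fconst w)) e =
    (if \<forall>z. z \<noteq> X2 \<and> z \<noteq> X1 \<longrightarrow> e z = 0 then tmode M v (- e X2 - 1) (tmode M u (- e X1 - 1) w) else 0)"
  by (rule fvertex_fvertex_fconst; simp)+

lemma twisted_jacobi_rhs:
  "flin (\<lambda>a. fvertex (tmode M a) (fmono X2) (fconst w)) (fvertex (vmode V u) (fmono_int X0) (fconst v)) e =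
    (if \<forall>z. z \<noteq> X2 \<and> z \<noteq> X0 \<longrightarrow> e z = 0
      then tmode M (rat_mode (vmode V u) (- e X0 - 1) v) (- e X2 - 1) w else 0)"
  unfolding fvertex_fmono_int by (rule flin_fvertex_fconst) (simp_all add: rat_mode_def)

lemma twisted_jacobi_coeff:
  "(fmono X0 (-1) (fdelta (mscale M) 1 1
          (\<lambda>q F. fbinom (mscale M) X1 (-1) X2 q (fmono X0 (- q) F))
          (fvertex (tmode M u) (fmono X1) (fvertex (tmode M v) (fmono X2) (fconst w))))) e
       - (fmono X0 (-1) (fdelta (mscale M) (-1) 1
          (\<lambda>q F. fbinom (mscale M) X2 (-1) X1 q (fmono X0 (- q) F))
          (fvertex (tmode M v) (fmono X2) (fvertex (tmode M u) (fmono X1) (fconst w))))) e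
       = (1 / of_nat p) \<odot> (\<Sum>r<p. (fmono X2 (-1) (
          fdelta (mscale M) (\<zeta> ^ r) p
            (\<lambda>q F. fbinom (mscale M) X1 (-1) X0 q (fmono X2 (- q) F))
            (flin (\<lambda>a. fvertex (tmode M a) (fmono X2) (fconst w))
              (fvertex (vmode V ((\<nu> ^^ r) u)) (fmono_int X0) (fconst v))))) e)"
proof -
  have "fscale (mscale M) c (fmono X2 (-1) (\<Sum>r<p. F r)) e = c \<odot> (\<Sum>r<p. fmono X2 (-1) (F r) e)" for c F
    by (simp add: fscale_def fmono_def sum_fun_apply)
  then show ?thesis
    using fun_cong[OF twisted_jacobi[of u v w], of e] unfolding minus_apply by simp
qed

text \<open>The residue in x_0, as in the untwisted case. In the r-th delta function the exponent
  -a-1 of x_1 selects k = -\<sigma> + p (i - 1); since \<open>\<zeta> ^ p = 1\<close> the phase does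
  not depend on i.\<close>

lemma tmode_commutator:
  assumes p: "p > 0" and \<zeta>: "\<zeta> ^ p = 1" and a: "of_nat p * a = of_int \<sigma>"
  shows "tmode M u a (tmode M v b w) - tmode M v b (tmode M u a w) =
    (1 / of_nat p) \<odot> (\<Sum>r<p. \<Sum>i::nat. ((\<zeta> ^ r) powi (- \<sigma>) * (of_rat a gchoose i)) \<odot>
      tmode M (vmode V ((\<nu> ^^ r) u) (int i) v) (a + b - of_nat i) w)"
proof -
  define e :: "fvar \<Rightarrow> rat" where "e = (\<lambda>_. 0)(X0 := - 1, X1 := - a - 1, X2 := - b - 1)"
  have e: "e X0 = - 1" "e X1 = - a - 1" "e X2 = - b - 1" "e Y0 = 0" "e Y1 = 0" "e Y2 = 0"
    by (simp_all add: e_def)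
  let ?F = "fvertex (tmode M u) (fmono X1) (fvertex (tmode M v) (fmono X2) (fconst w))"
  let ?G = "fvertex (tmode M v) (fmono X2) (fvertex (tmode M u) (fmono X1) (fconst w))"
  let ?H = "\<lambda>r. flin (\<lambda>a. fvertex (tmode M a) (fmono X2) (fconst w)) (fvertex (vmode V ((\<nu> ^^ r) u)) (fmono_int X0) (fconst v))"
  have 1: "fmono X0 (- 1) (fdelta (mscale M) 1 1 (\<lambda>q F. fbinom (mscale M) X1 (- 1) X2 q (fmono X0 (- q) F)) ?F) e
      = tmode M u a (tmode M v b w)"
  proof -
    have "fmono X0 (- 1) (fdelta (mscale M) 1 1 (\<lambda>q F. fbinom (mscale M) X1 (- 1) X2 q (fmono X0 (- q) F)) ?F) e
      = (\<Sum>i. (1 powi 0 * (of_int 0 gchoose i) * (- 1) ^ i) \<odot>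
       ?F (e(X0 := 0, X1 := e X1 - (of_int 0 - of_nat i), X2 := e X2 - of_nat i)))"
      by (rule mod.fmono_delta_diff) (auto simp: twisted_jacobi_lhs all_fvar_iff e)
    also have "\<dots> = (1 powi 0 * (of_int 0 gchoose 0) * (- 1) ^ 0) \<odot>
       ?F (e(X0 := 0, X1 := e X1 - (of_int 0 - of_nat 0), X2 := e X2 - of_nat 0))"
      by (rule Sum_any_single) (simp add: gbinomial_0_left)
    finally show ?thesis by (simp add: twisted_jacobi_lhs all_fvar_iff e)
  qed
  have 2: "fmono X0 (- 1) (fdelta (mscale M) (-1) 1 (\<lambda>q F. fbinom (mscale M) X2 (- 1) X1 q (fmono X0 (- q) F)) ?G) e
      = tmode M v b (tmode M u a w)"
  proof -
    have "fmono X0 (- 1) (fdelta (mscale M) (-1) 1 (\<lambda>q F. fbinom (mscale M) X2 (- 1) X1 q (fmono X0 (- q) F)) ?G) e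
      = (\<Sum>i. ((-1) powi 0 * (of_int 0 gchoose i) * (- 1) ^ i) \<odot>
       ?G (e(X0 := 0, X2 := e X2 - (of_int 0 - of_nat i), X1 := e X1 - of_nat i)))"
      by (rule mod.fmono_delta_diff) (auto simp: twisted_jacobi_lhs all_fvar_iff e)
    also have "\<dots> = ((-1) powi 0 * (of_int 0 gchoose 0) * (- 1) ^ 0) \<odot>
       ?G (e(X0 := 0, X2 := e X2 - (of_int 0 - of_nat 0), X1 := e X1 - of_nat 0))"
      by (rule Sum_any_single) (simp add: gbinomial_0_left)
    finally show ?thesis by (simp add: twisted_jacobi_lhs all_fvar_iff e)
  qed
  have H: "?H r (e(X1 := 0, X2 := e X2 + 1 + e X1 + of_nat i, X0 := e X0 - of_nat i)) =
      tmode M (vmode V ((\<nu> ^^ r) u) (int i) v) (a + b - of_nat i) w" for r i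
    using rat_mode_of_int[of "vmode V ((\<nu> ^^ r) u)" "int i"]
    by (simp add: twisted_jacobi_rhs all_fvar_iff e algebra_simps del: rat_mode_of_int)
  have 3: "fmono X2 (- 1) (fdelta (mscale M) (\<zeta> ^ r) p (\<lambda>q F. fbinom (mscale M) X1 (- 1) X0 q (fmono X2 (- q) F)) (?H r)) e
      = (\<Sum>i::nat. ((\<zeta> ^ r) powi (- \<sigma>) * (of_rat a gchoose i)) \<odot>
      tmode M (vmode V ((\<nu> ^^ r) u) (int i) v) (a + b - of_nat i) w)" for r
  proof -
    have fin: "finite {i. tmode M (vmode V ((\<nu> ^^ r) u) (int i) v) (a + b - of_nat i) w \<noteq> 0}"
      using vmode_finite[of "(\<nu> ^^ r) u" 0 v] by (rule rev_finite_subset) auto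
    have "fmono X2 (- 1) (fdelta (mscale M) (\<zeta> ^ r) p (\<lambda>q F. fbinom (mscale M) X1 (- 1) X0 q (fmono X2 (- q) F)) (?H r)) e
      = (\<Sum>i. ((\<zeta> ^ r) powi (- \<sigma> - int p + int p * int i) * (of_rat (e X1 + of_nat i) gchoose i) * (- 1) ^ i) \<odot>
       ?H r (e(X1 := 0, X2 := e X2 + 1 + e X1 + of_nat i, X0 := e X0 - of_nat i)))"
    proof (rule mod.fmono_delta_iterate)
      show "finite {i. ?H r (e(X1 := 0, X2 := e X2 + 1 + e X1 + of_nat i, X0 := e X0 - of_nat i)) \<noteq> 0}"
        using fin by (simp only: H)
      show "of_nat p * e X1 = of_int (- \<sigma> - int p)"
        using a by (simp add: e algebra_simps)
    qed (use p in \<open>auto simp: twisted_jacobi_rhs all_fvar_iff e\<close>)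
    also have "\<dots> = (\<Sum>i::nat. ((\<zeta> ^ r) powi (- \<sigma>) * (of_rat a gchoose i)) \<odot>
      tmode M (vmode V ((\<nu> ^^ r) u) (int i) v) (a + b - of_nat i) w)"
    proof (rule Sum_any.cong)
      fix i
      have "(of_rat (e X1 + of_nat i) gchoose i) * (- 1) ^ i = (of_rat a gchoose i :: complex)"
        using gbinomial_minus[of "- of_rat a :: complex" i] by (simp add: e of_rat_add of_rat_diff of_rat_minus algebra_simps)
      moreover have "(\<zeta> ^ r) powi (- \<sigma> - int p + int p * int i) = (\<zeta> ^ r) powi (- \<sigma>)"
        using power_int_root_shift[OF \<zeta>, of r "- \<sigma>" "int i - 1"] by (simp add: algebra_simps)
      ultimately show "((\<zeta> ^ r) powi (- \<sigma> - int p + int p * int i) * (of_rat (e X1 + of_nat i) gchoose i) * (- 1) ^ i) \<odot>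
       ?H r (e(X1 := 0, X2 := e X2 + 1 + e X1 + of_nat i, X0 := e X0 - of_nat i)) =
       ((\<zeta> ^ r) powi (- \<sigma>) * (of_rat a gchoose i)) \<odot> tmode M (vmode V ((\<nu> ^^ r) u) (int i) v) (a + b - of_nat i) w"
        unfolding H by (simp only: mult.assoc)
    qed
    finally show ?thesis .
  qed
  show ?thesis
    using twisted_jacobi_coeff[of u v w e] unfolding 1 2 3 .
qed

text \<open>The twisted Jacobi identity with the vacuum as second vector. It is the source of the
  equivariance of Y_M under \<nu> in \<open>tmode_aut\<close>.\<close>

lemma tmode_average:
  assumes p: "p > 0" and \<zeta>: "\<zeta> ^ p = 1" and m: "of_nat p * m = of_int \<mu>"
  shows "tmode M u m w = (1 / of_nat p) \<odot> (\<Sum>r<p. ((\<zeta> ^ r) powi (- \<mu>)) \<odot> tmode M ((\<nu> ^^ r) u) m w)"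
proof -
  \<comment> \<open>Exponent 0 of x_0 selects the power -1 of x_1 - x_2; its leading term lowers the
    exponent of x_1 by one, which -m-2 instead of -m-1 compensates.\<close>
  define e :: "fvar \<Rightarrow> rat" where "e = (\<lambda>_. 0)(X1 := - m - 2)"
  have e: "e X0 = 0" "e X1 = - m - 2" "e X2 = 0" "e Y0 = 0" "e Y1 = 0" "e Y2 = 0"
    by (simp_all add: e_def)
  let ?v = "vacuum V"
  let ?F = "fvertex (tmode M u) (fmono X1) (fvertex (tmode M ?v) (fmono X2) (fconst w))"
  let ?G = "fvertex (tmode M ?v) (fmono X2) (fvertex (tmode M u) (fmono X1) (fconst w))"
  let ?H = "\<lambda>r. flin (\<lambda>a. fvertex (tmode M a) (fmono X2) (fconst w)) (fvertex (vmode V ((\<nu> ^^ r) u)) (fmono_int X0) (fconst ?v))"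
  have 1: "fmono X0 (- 1) (fdelta (mscale M) 1 1 (\<lambda>q F. fbinom (mscale M) X1 (- 1) X2 q (fmono X0 (- q) F)) ?F) e
      = tmode M u m w"
  proof -
    have "fmono X0 (- 1) (fdelta (mscale M) 1 1 (\<lambda>q F. fbinom (mscale M) X1 (- 1) X2 q (fmono X0 (- q) F)) ?F) e
      = (\<Sum>i. (1 powi (-1) * (of_int (-1) gchoose i) * (- 1) ^ i) \<odot>
       ?F (e(X0 := 0, X1 := e X1 - (of_int (-1) - of_nat i), X2 := e X2 - of_nat i)))"
      by (rule mod.fmono_delta_diff) (auto simp: twisted_jacobi_lhs all_fvar_iff e)
    also have "\<dots> = (1 powi (-1) * (of_int (-1) gchoose 0) * (- 1) ^ 0) \<odot>
       ?F (e(X0 := 0, X1 := e X1 - (of_int (-1) - of_nat 0), X2 := e X2 - of_nat 0))"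
      by (rule Sum_any_single) (simp add: twisted_jacobi_lhs all_fvar_iff e tmode_vacuum)
    finally show ?thesis by (simp add: twisted_jacobi_lhs all_fvar_iff e tmode_vacuum)
  qed
  have 2: "fmono X0 (- 1) (fdelta (mscale M) (-1) 1 (\<lambda>q F. fbinom (mscale M) X2 (- 1) X1 q (fmono X0 (- q) F)) ?G) e
      = 0"
  proof -
    \<comment> \<open>The factor (x_2 - x_1)^(-1) contributes only negative powers of x_2, whereas
      Y_M(1, x_2) is constant and the prescribed exponent of x_2 is 0.\<close>
    have z: "?G (e(X0 := 0, X2 := e X2 - (of_int (-1) - of_nat i), X1 := e X1 - of_nat i)) = 0" for i
    proof -
      have "- (1 + of_nat i) \<noteq> (0 :: rat)" by (metis add.commute neg_equal_0_iff_equal of_nat_Suc of_nat_eq_0_iff Suc_not_Zero nat.distinct(1))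
      then show ?thesis by (simp add: twisted_jacobi_lhs all_fvar_iff e tmode_vacuum)
    qed
    have "fmono X0 (- 1) (fdelta (mscale M) (-1) 1 (\<lambda>q F. fbinom (mscale M) X2 (- 1) X1 q (fmono X0 (- q) F)) ?G) e
      = (\<Sum>i. ((-1) powi (-1) * (of_int (-1) gchoose i) * (- 1) ^ i) \<odot>
       ?G (e(X0 := 0, X2 := e X2 - (of_int (-1) - of_nat i), X1 := e X1 - of_nat i)))"
      by (rule mod.fmono_delta_diff) (auto simp: twisted_jacobi_lhs all_fvar_iff e)
    then show ?thesis unfolding z by simp
  qed
  have H: "?H r (e(X1 := 0, X2 := e X2 + 1 + e X1 + of_nat i, X0 := e X0 - of_nat i)) =
      (if i = 0 then tmode M ((\<nu> ^^ r) u) m w else 0)" for r i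
  proof -
    have "- (e X0 - of_nat i) - 1 = (of_int (int i - 1) :: rat)" by (simp add: e)
    then have "rat_mode (vmode V ((\<nu> ^^ r) u)) (- (e X0 - of_nat i) - 1) ?v = (if i = 0 then (\<nu> ^^ r) u else 0)"
      by (simp only: rat_mode_of_int) (auto simp: creation)
    then show ?thesis by (simp add: twisted_jacobi_rhs all_fvar_iff e)
  qed
  have 3: "fmono X2 (- 1) (fdelta (mscale M) (\<zeta> ^ r) p (\<lambda>q F. fbinom (mscale M) X1 (- 1) X0 q (fmono X2 (- q) F)) (?H r)) e
      = ((\<zeta> ^ r) powi (- \<mu>)) \<odot> tmode M ((\<nu> ^^ r) u) m w" for r
  proof -
    have "fmono X2 (- 1) (fdelta (mscale M) (\<zeta> ^ r) p (\<lambda>q F. fbinom (mscale M) X1 (- 1) X0 q (fmono X2 (- q) F)) (?H r)) e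
      = (\<Sum>i. ((\<zeta> ^ r) powi (- \<mu> - 2 * int p + int p * int i) * (of_rat (e X1 + of_nat i) gchoose i) * (- 1) ^ i) \<odot>
       ?H r (e(X1 := 0, X2 := e X2 + 1 + e X1 + of_nat i, X0 := e X0 - of_nat i)))"
    proof (rule mod.fmono_delta_iterate)
      show "finite {i. ?H r (e(X1 := 0, X2 := e X2 + 1 + e X1 + of_nat i, X0 := e X0 - of_nat i)) \<noteq> 0}"
        unfolding H by (rule finite_subset[of _ "{0}"]) auto
      show "of_nat p * e X1 = of_int (- \<mu> - 2 * int p)"
        using m by (simp add: e algebra_simps)
    qed (use p in \<open>auto simp: twisted_jacobi_rhs all_fvar_iff e\<close>)
    also have "\<dots> = ((\<zeta> ^ r) powi (- \<mu> - 2 * int p + int p * int 0) * (of_rat (e X1 + of_nat 0) gchoose 0) * (- 1) ^ 0) \<odot>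
       ?H r (e(X1 := 0, X2 := e X2 + 1 + e X1 + of_nat 0, X0 := e X0 - of_nat 0))"
      unfolding H by (rule Sum_any_single) simp
    also have "(\<zeta> ^ r) powi (- \<mu> - 2 * int p + int p * int 0) = (\<zeta> ^ r) powi (- \<mu>)"
      using power_int_root_shift[OF \<zeta>, of r "- \<mu>" "- 2"] by (simp add: algebra_simps)
    finally show ?thesis unfolding H by simp
  qed
  show ?thesis
    using twisted_jacobi_coeff[of u ?v w e] unfolding 1 2 3 by simp
qed

text \<open>Replacing u by \<open>\<nu> u\<close> shifts r by one in the average, at the cost of the
  factor \<open>\<zeta> powi \<mu>\<close>. The shifted sum is the same because the terms r = p and
  r = 0 agree.\<close>

lemma tmode_aut:
  assumes p: "p > 0" and \<zeta>: "\<zeta> ^ p = 1" and m: "of_nat p * m = of_int \<mu>"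
  shows "tmode M (\<nu> u) m w = (\<zeta> powi \<mu>) \<odot> tmode M u m w"
proof -
  have \<zeta>0: "\<zeta> \<noteq> 0" using p \<zeta> by (metis power_eq_0_iff zero_neq_one zero_power)
  let ?g = "\<lambda>r. ((\<zeta> ^ r) powi (- \<mu>)) \<odot> tmode M ((\<nu> ^^ r) u) m w"
  have step: "((\<zeta> ^ r) powi (- \<mu>)) \<odot> tmode M ((\<nu> ^^ r) (\<nu> u)) m w = (\<zeta> powi \<mu>) \<odot> ?g (Suc r)" for r
  proof -
    have "(\<zeta> ^ r) powi (- \<mu>) = \<zeta> powi \<mu> * (\<zeta> ^ Suc r) powi (- \<mu>)"
      using \<zeta>0 by (simp add: power_int_mult_distrib power_int_minus)
    moreover have "(\<nu> ^^ r) (\<nu> u) = (\<nu> ^^ Suc r) u" by (simp only: funpow_Suc_right comp_apply)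
    ultimately show ?thesis by (simp only: mod.scale_scale)
  qed
  have "(\<Sum>r<p. ?g (Suc r)) = (\<Sum>r<p. ?g r)"
  proof -
    have "?g p = ?g 0" using \<zeta> aut_period by simp
    then show ?thesis
      using sum.lessThan_Suc_shift[of ?g p] sum.lessThan_Suc[of ?g p] by simp
  qed
  then have "(1 / of_nat p) \<odot> (\<Sum>r<p. ?g (Suc r)) = tmode M u m w"
    by (simp only: tmode_average[OF assms, of u, symmetric])
  moreover have "tmode M (\<nu> u) m w = (1 / of_nat p) \<odot> (\<Sum>r<p. (\<zeta> powi \<mu>) \<odot> ?g (Suc r))"
    by (subst tmode_average[OF assms]) (simp only: step)
  ultimately show ?thesis
    by (simp only: mod.scale_sum_right[symmetric] mod.scale_left_commute[of _ "\<zeta> powi \<mu>"])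
qed

text \<open>The coefficient of x^q in X_M(u, x): on weight d the factor x^(L(0)) contributes x^d, so
  q = d - n - 1. Indexing by the exponent makes D act as q and makes the indices add up in
  commutators, independently of weights.\<close>

definition xmode :: "rat \<Rightarrow> 'v \<Rightarrow> 'm \<Rightarrow> 'm"
  where "xmode q u w = (\<Sum>d::int. tmode M (component (vgrade V) u d) (of_int d - 1 - q) w)"

lemma xmode_homogeneous:
  assumes "u \<in> vgrade V d"
  shows "xmode q u w = tmode M u (of_int d - 1 - q) w"
  unfolding xmode_def using assms
  by (subst Sum_any_single[of d]) (auto simp: component_homogeneous)

lemma finite_xmode: "finite {d. tmode M (component (vgrade V) u d) (of_int d - 1 - q) w \<noteq> 0}"
  by (rule finite_subset[OF _ finite_component[of u]]) auto

lemma xmode_add_left: "xmode q (u + v) w = xmode q u w + xmode q v w"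
  unfolding xmode_def component_add tmode_add_left
  by (rule Sum_any.distrib) (rule finite_xmode)+

lemma xmode_scale_left: "xmode q (c \<cdot> u) w = c \<odot> xmode q u w"
  unfolding xmode_def component_scale tmode_scale_left by (rule mod.scale_Sum_any[symmetric])

lemma xmode_0_left [simp]: "xmode q 0 w = 0"
  using xmode_scale_left[of q 0 0] by simp

lemma xmode_sum_left: "xmode q (sum f A) w = (\<Sum>i\<in>A. xmode q (f i) w)"
  by (induction A rule: infinite_finite_induct) (auto simp: xmode_add_left)

lemma xmode_add_right: "xmode q u (w + w') = xmode q u w + xmode q u w'"
  unfolding xmode_def tmode_add_right
  by (rule Sum_any.distrib) (rule finite_xmode)+

lemma xmode_0_right [simp]: "xmode q u 0 = 0"
  unfolding xmode_def by simp

lemma xmode_fractional: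
  assumes "of_nat p * q \<notin> \<int>"
  shows "xmode q u w = 0"
proof -
  have "of_nat p * (of_int d - 1 - q) \<notin> \<int>" for d
  proof
    assume "of_nat p * (of_int d - 1 - q) \<in> \<int>"
    then have "of_nat p * (of_int d - 1) - of_nat p * (of_int d - 1 - q) \<in> \<int>" by (intro Ints_diff) auto
    then show False using assms by (simp add: algebra_simps)
  qed
  then show ?thesis unfolding xmode_def by (simp add: tmode_fractional)
qed

text \<open>The coefficient of x^q in X_M(Du, x) = x d/dx X_M(u, x).\<close>

lemma xmode_deriv: "xmode q (sq_deriv u) w = of_rat q \<odot> xmode q u w"
proof (induction u rule: graded_induct)
  case (1 d u)
  have "xmode q (sq_deriv u) w = tmode M (voa_L V (-1) u) (of_int (d + 1) - 1 - q) w + of_int d \<odot> tmode M u (of_int d - 1 - q) w"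
    unfolding sq_deriv_def xmode_add_left L0_grade[OF 1] xmode_scale_left
      xmode_homogeneous[OF 1] xmode_homogeneous[OF L_minus1_grade[OF 1]] ..
  also have "tmode M (voa_L V (-1) u) (of_int (d + 1) - 1 - q) w = (of_rat q - of_int d) \<odot> tmode M u (of_int d - 1 - q) w"
    by (simp add: mod_L_minus1_derivative of_rat_diff algebra_simps)
  finally show ?case by (simp add: xmode_homogeneous[OF 1] mod.scale_left_diff_distrib)
next
  case (2 u v)
  then show ?case by (simp add: sq_deriv_add xmode_add_left mod.scale_right_distrib)
qed

text \<open>The mode index d - 1 - q differs from -q by an integer, so the phase is the same for all
  weights d and passes to arbitrary u.\<close>

lemma xmode_aut:
  assumes p: "p > 0" and \<zeta>: "\<zeta> ^ p = 1" and q: "of_nat p * q = of_int \<kappa>"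
  shows "xmode q ((\<nu> ^^ r) u) w = ((\<zeta> ^ r) powi (- \<kappa>)) \<odot> xmode q u w"
proof -
  have 1: "xmode q (\<nu> u) w = (\<zeta> powi (- \<kappa>)) \<odot> xmode q u w" for u
  proof (induction u rule: graded_induct)
    case (1 d u)
    have "of_nat p * (of_int d - 1 - q) = of_int (- \<kappa> + int p * (d - 1))"
      using q by (simp add: algebra_simps)
    from tmode_aut[OF p \<zeta> this, of u w] have "tmode M (\<nu> u) (of_int d - 1 - q) w = (\<zeta> powi (- \<kappa>)) \<odot> tmode M u (of_int d - 1 - q) w"
      using power_int_root_shift[OF \<zeta>, of 1 "- \<kappa>" "d - 1"] by simp
    then show ?case by (simp only: xmode_homogeneous[OF 1] xmode_homogeneous[OF aut_grade[OF 1]])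
  next
    case (2 u v)
    then show ?case by (simp add: aut_add xmode_add_left mod.scale_right_distrib)
  qed
  show ?thesis
    by (induction r) (simp_all add: 1 power_int_mult_distrib)
qed

lemma xmode_commutator:
  assumes p: "p > 0" and \<zeta>: "\<zeta> ^ p = 1" and \<alpha>: "of_nat p * \<alpha> = of_int \<sigma>"
  shows "xmode \<alpha> a (xmode \<beta> b w) - xmode \<beta> b (xmode \<alpha> a w) =
    (1 / of_nat p) \<odot> (\<Sum>r<p. ((\<zeta> ^ r) powi \<sigma>) \<odot> xmode (\<alpha> + \<beta>) (sq_psi (- of_rat \<alpha>) ((\<nu> ^^ r) a) b) w)"
proof (induction a rule: graded_induct)
  case (1 d a)
  show ?case
  proof (induction b rule: graded_induct)
    case (1 e b)
    note a = \<open>a \<in> vgrade V d\<close> and b = \<open>b \<in> vgrade V e\<close>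
    let ?A = "of_int d - 1 - \<alpha>" and ?B = "of_int e - 1 - \<beta>"
    have A: "of_nat p * ?A = of_int (- \<sigma> + int p * (d - 1))" using \<alpha> by (simp add: algebra_simps)
    have "xmode \<alpha> a (xmode \<beta> b w) - xmode \<beta> b (xmode \<alpha> a w) =
      (1 / of_nat p) \<odot> (\<Sum>r<p. \<Sum>i::nat. ((\<zeta> ^ r) powi (- (- \<sigma> + int p * (d - 1))) * (of_rat ?A gchoose i)) \<odot>
      tmode M (vmode V ((\<nu> ^^ r) a) (int i) b) (?A + ?B - of_nat i) w)"
      unfolding xmode_homogeneous[OF a] xmode_homogeneous[OF b] by (rule tmode_commutator[OF p \<zeta> A])
    also have "\<dots> = (1 / of_nat p) \<odot> (\<Sum>r<p. ((\<zeta> ^ r) powi \<sigma>) \<odot> xmode (\<alpha> + \<beta>) (sq_psi (- of_rat \<alpha>) ((\<nu> ^^ r) a) b) w)"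
    proof (intro arg_cong2[where f = "mscale M"] sum.cong refl)
      fix r
      let ?a = "(\<nu> ^^ r) a"
      have a': "?a \<in> vgrade V d" by (rule aut_power_grade[OF a])
      obtain N :: nat where N: "\<And>m. m \<ge> int N \<Longrightarrow> vmode V ?a m b = 0" using vmode_truncation_nat by blast
      have "xmode (\<alpha> + \<beta>) (sq_psi (- of_rat \<alpha>) ?a b) w =
          (\<Sum>i<N. (of_int d + - of_rat \<alpha> - 1 gchoose i) \<odot> xmode (\<alpha> + \<beta>) (vmode V ?a (int i) b) w)"
      proof -
        have "sq_psi (- of_rat \<alpha>) ?a b = (\<Sum>i<N. (of_int d + - of_rat \<alpha> - 1 gchoose i) \<cdot> vmode V ?a (int i) b)"
          by (rule sq_psi_homogeneous[OF a' N])
        then show ?thesis by (simp only: xmode_sum_left xmode_scale_left)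
      qed
      also have "\<dots> = (\<Sum>i<N. (of_rat ?A gchoose i) \<odot> tmode M (vmode V ?a (int i) b) (?A + ?B - of_nat i) w)"
      proof (intro arg_cong2[where f = "mscale M"] sum.cong refl)
        fix i
        have "of_int d + - of_rat \<alpha> - 1 = (of_rat ?A :: complex)" by (simp add: of_rat_diff)
        then show "(of_int d + - of_rat \<alpha> - 1 gchoose i) = (of_rat ?A gchoose i :: complex)"
          by (simp only:)
        show "xmode (\<alpha> + \<beta>) (vmode V ?a (int i) b) w = tmode M (vmode V ?a (int i) b) (?A + ?B - of_nat i) w"
          unfolding xmode_homogeneous[OF vmode_grade[OF a' b]] by (simp add: algebra_simps)
      qed
      also have "\<dots> = (\<Sum>i::nat. (of_rat ?A gchoose i) \<odot> tmode M (vmode V ?a (int i) b) (?A + ?B - of_nat i) w)"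
        by (rule Sum_any_nat_less[symmetric]) (simp add: N)
      finally have *: "xmode (\<alpha> + \<beta>) (sq_psi (- of_rat \<alpha>) ?a b) w = \<dots>" .
      have "(\<zeta> ^ r) powi (- (- \<sigma> + int p * (d - 1))) = (\<zeta> ^ r) powi \<sigma>"
        using power_int_root_shift[OF \<zeta>, of r \<sigma> "1 - d"] by (simp add: algebra_simps)
      then show "(\<Sum>i::nat. ((\<zeta> ^ r) powi (- (- \<sigma> + int p * (d - 1))) * (of_rat ?A gchoose i)) \<odot>
          tmode M (vmode V ?a (int i) b) (?A + ?B - of_nat i) w) = ((\<zeta> ^ r) powi \<sigma>) \<odot> xmode (\<alpha> + \<beta>) (sq_psi (- of_rat \<alpha>) ?a b) w"
        unfolding * mod.scale_Sum_any by simp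
    qed
    finally show ?case .
  next
    case (2 b b')
    have "xmode \<alpha> a (xmode \<beta> (b + b') w) - xmode \<beta> (b + b') (xmode \<alpha> a w) =
      (xmode \<alpha> a (xmode \<beta> b w) - xmode \<beta> b (xmode \<alpha> a w)) + (xmode \<alpha> a (xmode \<beta> b' w) - xmode \<beta> b' (xmode \<alpha> a w))"
      by (simp add: xmode_add_left xmode_add_right)
    then show ?case
      unfolding 2 by (simp add: sq_psi_add_right xmode_add_left mod.scale_right_distrib sum.distrib)
  qed
next
  case (2 a a')
  have "xmode \<alpha> (a + a') (xmode \<beta> b w) - xmode \<beta> b (xmode \<alpha> (a + a') w) =
    (xmode \<alpha> a (xmode \<beta> b w) - xmode \<beta> b (xmode \<alpha> a w)) + (xmode \<alpha> a' (xmode \<beta> b w) - xmode \<beta> b (xmode \<alpha> a' w))"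
    by (simp add: xmode_add_left xmode_add_right)
  then show ?case
    unfolding 2 by (simp add: aut_power_linear sq_psi_add_left xmode_add_left mod.scale_right_distrib sum.distrib)
qed

end

section \<open>Expansion of the commutator into four terms\<close>

context complex_vector_space begin

lemma funpow_binomial:
  assumes f: "\<And>x y. f (x + y) = f x + f y" "\<And>c x. f (c *s x) = c *s f x"
    and g: "\<And>x y. g (x + y) = g x + g y" "\<And>c x. g (c *s x) = c *s g x"
    and fg: "\<And>x. f (g x) = g (f x)"
  shows "((\<lambda>v. f v + g v) ^^ n) v = (\<Sum>k\<le>n. of_nat (n choose k) *s (f ^^ k) ((g ^^ (n - k)) v))"
proof (induction n)
  case (Suc n)
  have f0: "f 0 = 0" using f(2)[of 0 0] by simp
  have g0: "g 0 = 0" using g(2)[of 0 0] by simp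
  have fs: "f (sum h A) = (\<Sum>i\<in>A. f (h i))" and gs: "g (sum h A) = (\<Sum>i\<in>A. g (h i))" for h and A :: "nat set"
    by (induction A rule: infinite_finite_induct) (auto simp: f g f0 g0)
  have gf: "g ((f ^^ k) x) = (f ^^ k) (g x)" for k x
    by (induction k) (auto simp flip: fg)
  let ?t = "\<lambda>k. (f ^^ k) ((g ^^ (Suc n - k)) v)"
  have gt: "g ((f ^^ k) ((g ^^ (n - k)) v)) = ?t k" if "k \<le> n" for k
    using that by (simp add: gf Suc_diff_le)
  have "((\<lambda>v. f v + g v) ^^ Suc n) v =
    (\<Sum>k\<le>n. of_nat (n choose k) *s ?t (Suc k)) + (\<Sum>k\<le>n. of_nat (n choose k) *s ?t k)"
    by (simp add: Suc.IH fs gs f g gt)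
  also have "(\<Sum>k\<le>n. of_nat (n choose k) *s ?t k) = (\<Sum>k\<le>Suc n. of_nat (n choose k) *s ?t k)"
    by simp
  also have "\<dots> = ?t 0 + (\<Sum>k\<le>n. of_nat (n choose Suc k) *s ?t (Suc k))"
    by (subst sum.atMost_Suc_shift) simp
  also have "(\<Sum>k\<le>n. of_nat (n choose k) *s ?t (Suc k)) + \<dots> = ?t 0 + (\<Sum>k\<le>n. of_nat (Suc n choose Suc k) *s ?t (Suc k))"
    by (simp add: sum.distrib[symmetric] scale_left_distrib[symmetric] add.left_commute)
  also have "\<dots> = (\<Sum>k\<le>Suc n. of_nat (Suc n choose k) *s ?t k)"
    by (subst sum.atMost_Suc_shift) simp
  finally show ?case .
qed simp

text \<open>In the applications \<open>a s i\<close> carries s factors x - D next to an i-th mode,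
  and moving D across lowers the mode index with a factor proportional to i. The falling factorials
  so produced yield the binomial coefficients later matched with powers of y_1 + y and y_1 -
  y.\<close>

lemma shift_recurrence:
  fixes a :: "nat \<Rightarrow> int \<Rightarrow> 'a"
  assumes rec: "\<And>s i. a (Suc s) i = x *s a s i + (\<epsilon> * of_int i) *s a s (i - 1)"
  shows "(1 / fact s) *s a s i = (\<Sum>l\<le>s. (x ^ (s - l) / fact (s - l) * (\<epsilon> ^ l * (of_int i gchoose l))) *s a 0 (i - int l))"
proof -
  define c where "c s l i = of_nat (s choose l) * x ^ (s - l) * (\<epsilon> ^ l * (fact l * (of_int i gchoose l)))" for s l :: nat and i :: int
  have main: "a s i = (\<Sum>l\<le>s. c s l i *s a 0 (i - int l))" for s i
  proof (induction s arbitrary: i)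
    case (Suc s)
    have c1: "x * c s (Suc l) i + \<epsilon> * of_int i * c s l (i - 1) = c (Suc s) (Suc l) i" if "l \<le> s" for l
    proof -
      have ab: "of_int i * (of_int (i - 1) gchoose l) = of_nat (Suc l) * (of_int i gchoose Suc l :: complex)"
        using gbinomial_absorption[of l "of_int i :: complex"] by simp
      have "\<epsilon> * of_int i * c s l (i - 1) = of_nat (s choose l) * x ^ (s - l) * (\<epsilon> ^ Suc l * (fact l * (of_int i * (of_int (i - 1) gchoose l))))"
        by (simp add: c_def)
      also have "\<dots> = of_nat (s choose l) * x ^ (s - l) * (\<epsilon> ^ Suc l * (fact (Suc l) * (of_int i gchoose Suc l)))"
        unfolding ab by simp
      finally have 1: "\<epsilon> * of_int i * c s l (i - 1) = \<dots>" .
      have "x * (of_nat (s choose Suc l) * x ^ (s - Suc l)) = of_nat (s choose Suc l) * x ^ (s - l)"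
        using that by (cases "l = s") (auto simp: binomial_eq_0 Suc_diff_Suc simp flip: power_Suc)
      then have 2: "x * c s (Suc l) i = of_nat (s choose Suc l) * x ^ (s - l) * (\<epsilon> ^ Suc l * (fact (Suc l) * (of_int i gchoose Suc l)))"
        unfolding c_def by (simp only: mult.assoc[symmetric])
      show ?thesis unfolding 1 2 by (simp add: c_def ring_distribs)
    qed
    have "a (Suc s) i = (\<Sum>l\<le>Suc s. (x * c s l i) *s a 0 (i - int l)) + (\<Sum>l\<le>s. (\<epsilon> * of_int i * c s l (i - 1)) *s a 0 (i - int (Suc l)))"
      unfolding rec Suc.IH by (simp add: scale_sum_right c_def diff_diff_eq)
    also have "(\<Sum>l\<le>Suc s. (x * c s l i) *s a 0 (i - int l)) = (x * c s 0 i) *s a 0 i + (\<Sum>l\<le>s. (x * c s (Suc l) i) *s a 0 (i - int (Suc l)))"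
      by (subst sum.atMost_Suc_shift) simp
    also have "x * c s 0 i = c (Suc s) 0 i" by (simp add: c_def)
    also have "c (Suc s) 0 i *s a 0 i + (\<Sum>l\<le>s. (x * c s (Suc l) i) *s a 0 (i - int (Suc l))) + (\<Sum>l\<le>s. (\<epsilon> * of_int i * c s l (i - 1)) *s a 0 (i - int (Suc l)))
      = c (Suc s) 0 i *s a 0 i + (\<Sum>l\<le>s. c (Suc s) (Suc l) i *s a 0 (i - int (Suc l)))"
      by (simp add: c1 add.assoc sum.distrib[symmetric] scale_left_distrib[symmetric] del: of_nat_Suc)
    also have "\<dots> = (\<Sum>l\<le>Suc s. c (Suc s) l i *s a 0 (i - int l))"
      by (subst sum.atMost_Suc_shift) simp
    finally show ?case .
  qed (simp add: c_def)
  show ?thesis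
    unfolding main[of s i] scale_sum_right scale_scale
    by (intro sum.cong refl arg_cong2[where f = scale]) (simp add: c_def binomial_fact)
qed

text \<open>Addition of exponents for two exponential sums. It is used from right to left, since the
  theorem keeps two exponentials in y apart.\<close>

lemma exp_merge:
  assumes "\<And>n. n \<ge> S \<Longrightarrow> f n = 0"
  shows "(\<Sum>m::nat. (y ^ m / fact m) *s (\<Sum>n::nat. (x ^ n / fact n) *s f (m + n))) = (\<Sum>n<S. ((x + y) ^ n / fact n) *s f n)"
proof -
  have "(\<Sum>m::nat. (y ^ m / fact m) *s (\<Sum>n::nat. (x ^ n / fact n) *s f (m + n))) =
    (\<Sum>m<S. (y ^ m / fact m) *s (\<Sum>n<S. (x ^ n / fact n) *s f (m + n)))"
    by (subst Sum_any_nat_less[of S]) (auto simp: assms Sum_any_nat_less[of S])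
  also have "\<dots> = (\<Sum>m<S. \<Sum>n<S. (y ^ m / fact m * (x ^ n / fact n)) *s f (m + n))"
    by (simp add: scale_sum_right)
  also have "\<dots> = (\<Sum>s<S. \<Sum>n\<le>s. (y ^ (s - n) / fact (s - n) * (x ^ n / fact n)) *s f (s - n + n))"
    by (rule sum_triangle_box[symmetric]) (simp add: assms)
  also have "\<dots> = (\<Sum>s<S. ((x + y) ^ s / fact s) *s f s)"
  proof (rule sum.cong[OF refl])
    fix s
    have "(x + y) ^ s / fact s = (\<Sum>n\<le>s. y ^ (s - n) / fact (s - n) * (x ^ n / fact n))"
      unfolding binomial_ring sum_divide_distrib by (rule sum.cong) (simp_all add: binomial_fact mult.commute)
    then show "(\<Sum>n\<le>s. (y ^ (s - n) / fact (s - n) * (x ^ n / fact n)) *s f (s - n + n)) = ((x + y) ^ s / fact s) *s f s"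
      by (simp add: scale_sum_left)
  qed
  finally show ?thesis .
qed

end

section \<open>Divided powers of x - D\<close>

context vertex_operator_algebra
begin

text \<open>The coefficient of y^s in e^(y(x - D)), the operator that arises when skew-symmetry is
  used inside a residue against e^(-xy).\<close>

definition exp_deriv :: "complex \<Rightarrow> nat \<Rightarrow> 'v \<Rightarrow> 'v"
  where "exp_deriv x s v = (1 / fact s) \<cdot> ((\<lambda>v. x \<cdot> v - sq_deriv v) ^^ s) v"

lemma sq_deriv_minus: "sq_deriv (- u) = - sq_deriv u"
  using sq_deriv_scale[of "-1" u] by simp

lemma sq_deriv_diff: "sq_deriv (u - v) = sq_deriv u - sq_deriv v"
  using sq_deriv_add[of u "- v"] by (simp add: sq_deriv_minus)

lemma exp_deriv_linear:
  "exp_deriv x s (u + v) = exp_deriv x s u + exp_deriv x s v"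
  "exp_deriv x s (c \<cdot> u) = c \<cdot> exp_deriv x s u"
proof -
  let ?B = "\<lambda>v. x \<cdot> v - sq_deriv v"
  have "(?B ^^ s) (u + v) = (?B ^^ s) u + (?B ^^ s) v" "(?B ^^ s) (c \<cdot> u) = c \<cdot> (?B ^^ s) u"
    by (induction s) (auto simp: sq_deriv_add sq_deriv_scale scale_right_distrib scale_right_diff_distrib mult.commute)
  then show "exp_deriv x s (u + v) = exp_deriv x s u + exp_deriv x s v"
    "exp_deriv x s (c \<cdot> u) = c \<cdot> exp_deriv x s u"
    by (simp_all add: exp_deriv_def scale_right_distrib mult.commute)
qed

lemma exp_deriv_0 [simp]: "exp_deriv x s 0 = 0"
  using exp_deriv_linear(2)[of x s 0 0] by simp

lemma exp_deriv_sum: "exp_deriv x s (sum f A) = (\<Sum>i\<in>A. exp_deriv x s (f i))"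
  by (induction A rule: infinite_finite_induct) (auto simp: exp_deriv_linear)

lemma exp_deriv_mult: "exp_deriv x m (exp_deriv x l v) = of_nat ((m + l) choose l) \<cdot> exp_deriv x (m + l) v"
proof -
  let ?B = "\<lambda>v. x \<cdot> v - sq_deriv v"
  have "(?B ^^ m) (c \<cdot> v) = c \<cdot> (?B ^^ m) v" for c v
    by (induction m) (auto simp: sq_deriv_scale scale_right_diff_distrib mult.commute)
  then show ?thesis
    by (simp add: exp_deriv_def funpow_add binomial_fact mult.commute)
qed

lemma exp_deriv_binomial:
  "exp_deriv x s v = (\<Sum>k\<le>s. (x ^ (s - k) / fact (s - k) * ((-1) ^ k / fact k)) \<cdot> (sq_deriv ^^ k) v)"
proof -
  have D: "((\<lambda>v. - sq_deriv v) ^^ k) v = (-1) ^ k \<cdot> (sq_deriv ^^ k) v" for k v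
    by (induction k) (auto simp: sq_deriv_scale sq_deriv_minus)
  have x: "((\<lambda>v. x \<cdot> v) ^^ k) v = x ^ k \<cdot> v" for k v
    by (induction k) auto
  have "((\<lambda>v. - sq_deriv v + x \<cdot> v) ^^ s) v = (\<Sum>k\<le>s. of_nat (s choose k) \<cdot> ((\<lambda>v. - sq_deriv v) ^^ k) (((\<lambda>v. x \<cdot> v) ^^ (s - k)) v))"
    by (rule funpow_binomial) (auto simp: sq_deriv_add sq_deriv_scale scale_right_distrib mult.commute)
  then have "exp_deriv x s v = (\<Sum>k\<le>s. (1 / fact s * of_nat (s choose k) * (-1) ^ k * x ^ (s - k)) \<cdot> (sq_deriv ^^ k) v)"
    unfolding exp_deriv_def by (simp add: D x sq_deriv_power_linear scale_sum_right mult.assoc)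
  then show ?thesis
    by (simp add: binomial_fact mult_ac)
qed

text \<open>The coefficient of y^s in e^(y(x - D)) e^(yD) = e^(xy).\<close>

lemma exp_deriv_cancel:
  "(\<Sum>k\<le>s. (1 / fact (s - k)) \<cdot> exp_deriv x k ((sq_deriv ^^ (s - k)) v)) = (x ^ s / fact s) \<cdot> v"
proof -
  let ?B = "\<lambda>v. x \<cdot> v - sq_deriv v"
  have "((\<lambda>v. ?B v + sq_deriv v) ^^ s) v = (\<Sum>k\<le>s. of_nat (s choose k) \<cdot> (?B ^^ k) ((sq_deriv ^^ (s - k)) v))"
    by (rule funpow_binomial) (auto simp: sq_deriv_add sq_deriv_scale scale_right_distrib scale_right_diff_distrib mult.commute sq_deriv_diff)
  moreover have "((\<lambda>v. ?B v + sq_deriv v) ^^ s) v = x ^ s \<cdot> v" by (induction s) auto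
  ultimately have eq: "x ^ s \<cdot> v = (\<Sum>k\<le>s. of_nat (s choose k) \<cdot> (?B ^^ k) ((sq_deriv ^^ (s - k)) v))"
    by (simp only:)
  have "(x ^ s / fact s) \<cdot> v = (1 / fact s) \<cdot> (x ^ s \<cdot> v)" by simp
  also have "\<dots> = (\<Sum>k\<le>s. (1 / fact s * of_nat (s choose k)) \<cdot> (?B ^^ k) ((sq_deriv ^^ (s - k)) v))"
    unfolding eq scale_sum_right scale_scale ..
  also have "\<dots> = (\<Sum>k\<le>s. (1 / fact (s - k)) \<cdot> exp_deriv x k ((sq_deriv ^^ (s - k)) v))"
    unfolding exp_deriv_def scale_scale by (intro sum.cong refl) (simp add: binomial_fact mult.commute)
  finally show ?thesis ..
qed

text \<open>Skew-symmetry reads Y[c, y] z = e^(yD) Y[z, -y] c. In the residue against e^(-xy) the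
  substitution y -> -y yields the overall minus sign and the operator e^(y(x - D)).\<close>

lemma sq_psi_skew:
  assumes S: "\<And>s. s \<ge> int S \<Longrightarrow> sq_mode V z s c = 0"
  shows "sq_psi (- x) c z = - (\<Sum>s<S. exp_deriv x s (sq_mode V z (int s) c))"
proof -
  have skew: "sq_mode V c (int n) z = (\<Sum>t<S. ((-1) ^ (n + 1 + t) / fact t) \<cdot> (sq_deriv ^^ t) (sq_mode V z (int (n + t)) c))" for n
  proof -
    have "sq_mode V c (int n) z = (\<Sum>t::nat. ((-1) powi (int n + 1 + int t) / fact t) \<cdot> (sq_deriv ^^ t) (sq_mode V z (int n + int t) c))"
      by (rule sq_skew_symmetry)
    also have "\<dots> = (\<Sum>t<S. ((-1) powi (int n + 1 + int t) / fact t) \<cdot> (sq_deriv ^^ t) (sq_mode V z (int n + int t) c))"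
      by (rule Sum_any_nat_less) (simp add: S sq_deriv_power_linear)
    also have "\<dots> = (\<Sum>t<S. ((-1) ^ (n + 1 + t) / fact t) \<cdot> (sq_deriv ^^ t) (sq_mode V z (int (n + t)) c))"
    proof (rule sum.cong[OF refl])
      fix t
      have idx: "int n + 1 + int t = int (n + 1 + t)" "int n + int t = int (n + t)" by simp_all
      show "((-1) powi (int n + 1 + int t) / fact t) \<cdot> (sq_deriv ^^ t) (sq_mode V z (int n + int t) c) =
        ((-1) ^ (n + 1 + t) / fact t) \<cdot> (sq_deriv ^^ t) (sq_mode V z (int (n + t)) c)"
        unfolding idx power_int_of_nat ..
    qed
    finally show ?thesis .
  qed
  have "sq_mode V c n z = 0" if "n \<ge> int S" for n
    using skew[of "nat n"] that S by (simp add: sq_deriv_power_linear)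
  then have "sq_psi (- x) c z = (\<Sum>n<S. ((- x) ^ n / fact n) \<cdot> sq_mode V c (int n) z)"
    by (rule sq_psi_eq_sum)
  also have "\<dots> = (\<Sum>n<S. \<Sum>t<S. (- (x ^ n / fact n * ((-1) ^ t / fact t))) \<cdot> (sq_deriv ^^ t) (sq_mode V z (int (n + t)) c))"
  proof (rule sum.cong[OF refl])
    fix n
    have "(- x) ^ n * (-1) ^ (n + 1 + t) = - (x ^ n * (-1) ^ t)" for t
      by (cases "even n") (auto simp: power_add)
    then show "((- x) ^ n / fact n) \<cdot> sq_mode V c (int n) z =
      (\<Sum>t<S. (- (x ^ n / fact n * ((-1) ^ t / fact t))) \<cdot> (sq_deriv ^^ t) (sq_mode V z (int (n + t)) c))"
      unfolding skew scale_sum_right scale_scale by simp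
  qed
  also have "\<dots> = (\<Sum>s<S. \<Sum>t\<le>s. (- (x ^ (s - t) / fact (s - t) * ((-1) ^ t / fact t))) \<cdot> (sq_deriv ^^ t) (sq_mode V z (int (s - t + t)) c))"
    by (rule sum_triangle_box[symmetric]) (simp add: S sq_deriv_power_linear)
  also have "\<dots> = - (\<Sum>s<S. exp_deriv x s (sq_mode V z (int s) c))"
    by (simp add: exp_deriv_binomial sum_negf)
  finally show ?thesis .
qed

text \<open>The coefficient of y^(-n-1) in e^(y(x - D)) Y[b, y] c = e^(xy) Y[c, -y] b: the factor
  e^(yD) of skew-symmetry is cancelled.\<close>

lemma exp_deriv_skew:
  assumes N: "\<And>s. s \<ge> n + int N \<Longrightarrow> sq_mode V c s b = 0"
  shows "(\<Sum>l<N. exp_deriv x l (sq_mode V b (n + int l) c)) =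
    (\<Sum>q<N. (x ^ q / fact q * (-1) powi (n + 1 + int q)) \<cdot> sq_mode V c (n + int q) b)"
proof -
  have skew: "sq_mode V b (n + int l) c = (\<Sum>t<N. ((-1) powi (n + 1 + int (l + t)) / fact t) \<cdot> (sq_deriv ^^ t) (sq_mode V c (n + int (l + t)) b))" for l
  proof -
    have "sq_mode V b (n + int l) c = (\<Sum>t::nat. ((-1) powi (n + int l + 1 + int t) / fact t) \<cdot> (sq_deriv ^^ t) (sq_mode V c (n + int l + int t) b))"
      by (rule sq_skew_symmetry)
    also have "\<dots> = (\<Sum>t<N. ((-1) powi (n + int l + 1 + int t) / fact t) \<cdot> (sq_deriv ^^ t) (sq_mode V c (n + int l + int t) b))"
      by (rule Sum_any_nat_less) (simp add: N sq_deriv_power_linear)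
    finally show ?thesis by (simp add: algebra_simps)
  qed
  have "(\<Sum>l<N. exp_deriv x l (sq_mode V b (n + int l) c)) =
    (\<Sum>l<N. \<Sum>t<N. ((-1) powi (n + 1 + int (l + t)) / fact t) \<cdot> exp_deriv x l ((sq_deriv ^^ t) (sq_mode V c (n + int (l + t)) b)))"
    unfolding skew exp_deriv_sum exp_deriv_linear ..
  also have "\<dots> = (\<Sum>t<N. \<Sum>l<N. ((-1) powi (n + 1 + int (l + t)) / fact t) \<cdot> exp_deriv x l ((sq_deriv ^^ t) (sq_mode V c (n + int (l + t)) b)))"
    by (rule sum.swap)
  also have "\<dots> = (\<Sum>s<N. \<Sum>l\<le>s. ((-1) powi (n + 1 + int (l + (s - l))) / fact (s - l)) \<cdot> exp_deriv x l ((sq_deriv ^^ (s - l)) (sq_mode V c (n + int (l + (s - l))) b)))"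
    by (rule sum_triangle_box[symmetric]) (simp add: N sq_deriv_power_linear)
  also have "\<dots> = (\<Sum>s<N. (-1) powi (n + 1 + int s) \<cdot> (\<Sum>l\<le>s. (1 / fact (s - l)) \<cdot> exp_deriv x l ((sq_deriv ^^ (s - l)) (sq_mode V c (n + int s) b))))"
    by (intro sum.cong refl) (simp add: scale_sum_right)
  also have "\<dots> = (\<Sum>q<N. (x ^ q / fact q * (-1) powi (n + 1 + int q)) \<cdot> sq_mode V c (n + int q) b)"
    unfolding exp_deriv_cancel by (simp add: mult.commute)
  finally show ?thesis .
qed

text \<open>Commuting z past u leaves terms with a factor s choose l, which splits the divided power
  of x - D in two. The inner part is consumed by skew-symmetry, which lets v act on z_[m] u; this
  creates the products with -y_2 and the exponentials in y_2. The outer part remains.\<close>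

lemma exp_deriv_sq_mode_expansion:
  assumes S: "\<And>s. s \<ge> S \<Longrightarrow> sq_mode V z (int s) (sq_mode V u j v) = 0 \<and> sq_mode V z (int s) v = 0 \<and> sq_mode V z (int s) u = 0"
    and B: "\<And>m l. m + l \<ge> S \<Longrightarrow> sq_mode V (sq_mode V z (int m) u) (j + int l) v = 0"
    and Q: "\<And>m q. q \<ge> S \<Longrightarrow> sq_mode V v (j + int q) (sq_mode V z (int m) u) = 0"
  shows "(\<Sum>s<S. exp_deriv x s (sq_mode V z (int s) (sq_mode V u j v))) =
    (\<Sum>s<S. exp_deriv x s (sq_mode V u j (sq_mode V z (int s) v))) +
    (\<Sum>q<S. (x ^ q / fact q) \<cdot> (\<Sum>s<S. exp_deriv x s ((-1) powi (j + 1 + int q) \<cdot> sq_mode V v (j + int q) (sq_mode V z (int s) u))))"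
proof -
  define b where "b m l = sq_mode V (sq_mode V z (int m) u) (j + int l) v" for m l :: nat
  have comm: "sq_mode V z (int s) (sq_mode V u j v) = sq_mode V u j (sq_mode V z (int s) v) + (\<Sum>l\<le>s. of_nat (s choose l) \<cdot> b (s - l) l)" for s
  proof -
    have "y = z + x" if "y - z = x" for x y z :: 'v using that by (simp add: algebra_simps)
    from this[OF sq_mode_commutator] show ?thesis unfolding b_def .
  qed
  have "(\<Sum>s<S. exp_deriv x s (\<Sum>l\<le>s. of_nat (s choose l) \<cdot> b (s - l) l)) =
    (\<Sum>s<S. \<Sum>l\<le>s. exp_deriv x (s - l) (exp_deriv x l (b (s - l) l)))"
  proof (rule sum.cong[OF refl])
    fix s
    have "of_nat (s choose l) \<cdot> exp_deriv x s y = exp_deriv x (s - l) (exp_deriv x l y)" if "l \<le> s" for l y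
      using exp_deriv_mult[of x "s - l" l y] that by simp
    then show "exp_deriv x s (\<Sum>l\<le>s. of_nat (s choose l) \<cdot> b (s - l) l) = (\<Sum>l\<le>s. exp_deriv x (s - l) (exp_deriv x l (b (s - l) l)))"
      unfolding exp_deriv_sum exp_deriv_linear by (intro sum.cong) auto
  qed
  also have "\<dots> = (\<Sum>m<S. \<Sum>l<S. exp_deriv x m (exp_deriv x l (b m l)))"
    by (rule sum_triangle_box) (simp add: b_def B)
  also have "\<dots> = (\<Sum>m<S. exp_deriv x m (\<Sum>q<S. (x ^ q / fact q * (-1) powi (j + 1 + int q)) \<cdot> sq_mode V v (j + int q) (sq_mode V z (int m) u)))"
  proof (rule sum.cong[OF refl])
    fix m
    have "(\<Sum>l<S. exp_deriv x l (b m l)) = (\<Sum>q<S. (x ^ q / fact q * (-1) powi (j + 1 + int q)) \<cdot> sq_mode V v (j + int q) (sq_mode V z (int m) u))"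
      unfolding b_def
    proof (rule exp_deriv_skew)
      fix s assume "s \<ge> j + int S"
      then have "s = j + int (nat (s - j))" "nat (s - j) \<ge> S" by auto
      then show "sq_mode V v s (sq_mode V z (int m) u) = 0" using Q by metis
    qed
    then show "(\<Sum>l<S. exp_deriv x m (exp_deriv x l (b m l))) = exp_deriv x m (\<Sum>q<S. (x ^ q / fact q * (-1) powi (j + 1 + int q)) \<cdot> sq_mode V v (j + int q) (sq_mode V z (int m) u))"
      by (simp only: exp_deriv_sum[symmetric])
  qed
  also have "\<dots> = (\<Sum>m<S. \<Sum>q<S. (x ^ q / fact q) \<cdot> exp_deriv x m ((-1) powi (j + 1 + int q) \<cdot> sq_mode V v (j + int q) (sq_mode V z (int m) u)))"
    by (simp only: exp_deriv_sum exp_deriv_linear(2) scale_scale)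
  also have "\<dots> = (\<Sum>q<S. (x ^ q / fact q) \<cdot> (\<Sum>m<S. exp_deriv x m ((-1) powi (j + 1 + int q) \<cdot> sq_mode V v (j + int q) (sq_mode V z (int m) u))))"
    by (subst sum.swap) (simp only: scale_sum_right)
  finally show ?thesis
    unfolding comm exp_deriv_linear(1) sum.distrib by simp
qed

end

section \<open>The four-term expansion inside a mode of X_M\<close>

context twisted_module
begin

lemma xmode_diff_left: "xmode q (u - v) w = xmode q u w - xmode q v w"
  using xmode_add_left[of q u "(-1) \<cdot> v" w] xmode_scale_left[of q "-1" v w] by simp

lemma xmode_exp_deriv: "xmode q (exp_deriv x s v) w = ((x - of_rat q) ^ s / fact s) \<odot> xmode q v w"
proof -
  let ?B = "\<lambda>v. x \<cdot> v - sq_deriv v"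
  have "xmode q ((?B ^^ s) v) w = (x - of_rat q) ^ s \<odot> xmode q v w"
    by (induction s)
       (simp_all add: xmode_diff_left xmode_scale_left xmode_deriv mod.scale_left_diff_distrib left_diff_distrib)
  then show ?thesis by (simp add: exp_deriv_def xmode_scale_left)
qed

text \<open>D is the scalar \<gamma> here, so the divided powers of \<gamma> - x - D from
  \<open>sq_psi_skew\<close> become those of -x. With \<gamma> = \<alpha> + \<beta> and x = \<beta>
  this trades the operator of a at -\<alpha> for that of b at -\<beta>.\<close>

lemma xmode_sq_psi_swap:
  "xmode \<gamma> (sq_psi (- (of_rat \<gamma> - x)) a b) w = - xmode \<gamma> (sq_psi (- x) b a) w"
proof -
  obtain S :: nat where S: "\<And>s. s \<ge> int S \<Longrightarrow> sq_mode V b s a = 0" using sq_mode_truncation by blast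
  have m: "xmode \<gamma> (- u) w = - xmode \<gamma> u w" for u
    using xmode_scale_left[of \<gamma> "-1" u w] by simp
  have "sq_psi (- (of_rat \<gamma> - x)) a b = - (\<Sum>s<S. exp_deriv (of_rat \<gamma> - x) s (sq_mode V b (int s) a))"
    by (rule sq_psi_skew[OF S])
  then have "xmode \<gamma> (sq_psi (- (of_rat \<gamma> - x)) a b) w = - (\<Sum>s<S. ((- x) ^ s / fact s) \<odot> xmode \<gamma> (sq_mode V b (int s) a) w)"
    by (simp add: m xmode_sum_left xmode_exp_deriv)
  moreover have "sq_psi (- x) b a = (\<Sum>s<S. ((- x) ^ s / fact s) \<cdot> sq_mode V b (int s) a)"
    by (rule sq_psi_eq_sum[OF S])
  ultimately show ?thesis by (simp add: xmode_sum_left xmode_scale_left)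
qed

text \<open>D is moved to the left of u_[i], where it is \<gamma>; the commutators lower i and
  produce the expansion in y_1 + y. The difference x - \<gamma> stays split: x belongs to the delta
  function and -\<gamma> to the argument e^(-y) x_1.\<close>

lemma xmode_sq_mode_exp_deriv_right:
  assumes h: "\<And>s. s \<ge> S \<Longrightarrow> h s = 0"
  shows "xmode \<gamma> (sq_mode V u i (\<Sum>s<S. exp_deriv x s (h s))) w =
    (\<Sum>m::nat. (x ^ m / fact m) \<odot> (\<Sum>n::nat. ((- of_rat \<gamma>) ^ n / fact n) \<odot>
      xmode \<gamma> (\<Sum>l::nat. ((-1) ^ l * (of_int i gchoose l)) \<cdot> sq_mode V u (i - int l) (h (m + n + l))) w))"
proof -
  let ?B = "\<lambda>v. x \<cdot> v - sq_deriv v"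
  define y where "y = x - of_rat \<gamma>"
  define f where "f n = xmode \<gamma> (\<Sum>l::nat. ((-1) ^ l * (of_int i gchoose l)) \<cdot> sq_mode V u (i - int l) (h (n + l))) w" for n
  have f: "f n = (\<Sum>l<S. ((-1) ^ l * (of_int i gchoose l)) \<odot> xmode \<gamma> (sq_mode V u (i - int l) (h (n + l))) w)" for n
    unfolding f_def by (subst Sum_any_nat_less[of S]) (auto simp: h xmode_sum_left xmode_scale_left)
  have step: "xmode \<gamma> (sq_mode V u i (exp_deriv x s v)) w =
     (\<Sum>l\<le>s. (y ^ (s - l) / fact (s - l) * ((-1) ^ l * (of_int i gchoose l))) \<odot> xmode \<gamma> (sq_mode V u (i - int l) v) w)" for s v
  proof -
    let ?a = "\<lambda>s i. xmode \<gamma> (sq_mode V u i ((?B ^^ s) v)) w"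
    have minus: "sq_mode V u i (a - b) = sq_mode V u i a - sq_mode V u i b" for i a b
      using sq_mode_add_right[of u i a "(-1) \<cdot> b"] sq_mode_scale_right[of u i "-1" b] by simp
    have "?a (Suc s) i = y \<odot> ?a s i + (- 1 * of_int i) \<odot> ?a s (i - 1)" for s i
    proof -
      let ?v = "(?B ^^ s) v"
      have "sq_mode V u i (sq_deriv ?v) = sq_deriv (sq_mode V u i ?v) + of_int i \<cdot> sq_mode V u (i - 1) ?v"
        using sq_deriv_sq_mode[of u i ?v] by simp
      then have "sq_mode V u i (?B ?v) = x \<cdot> sq_mode V u i ?v - (sq_deriv (sq_mode V u i ?v) + of_int i \<cdot> sq_mode V u (i - 1) ?v)"
        by (simp only: minus sq_mode_scale_right)
      then show ?thesis
        by (simp add: xmode_diff_left xmode_add_left xmode_scale_left xmode_deriv y_def mod.scale_left_diff_distrib)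
    qed
    from mod.shift_recurrence[of ?a, OF this, of s i] show ?thesis
      by (simp add: exp_deriv_def sq_mode_scale_right xmode_scale_left)
  qed
  have "xmode \<gamma> (sq_mode V u i (\<Sum>s<S. exp_deriv x s (h s))) w =
    (\<Sum>s<S. \<Sum>l\<le>s. (y ^ (s - l) / fact (s - l) * ((-1) ^ l * (of_int i gchoose l))) \<odot> xmode \<gamma> (sq_mode V u (i - int l) (h (s - l + l))) w)"
    unfolding sq_mode_sum_right xmode_sum_left step by simp
  also have "\<dots> = (\<Sum>n<S. \<Sum>l<S. (y ^ n / fact n * ((-1) ^ l * (of_int i gchoose l))) \<odot> xmode \<gamma> (sq_mode V u (i - int l) (h (n + l))) w)"
    by (rule sum_triangle_box) (simp add: h)
  also have "\<dots> = (\<Sum>n<S. (y ^ n / fact n) \<odot> f n)"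
    by (simp add: f mod.scale_sum_right)
  also have "y = - of_rat \<gamma> + x" by (simp add: y_def)
  also have "(\<Sum>n<S. ((- of_rat \<gamma> + x) ^ n / fact n) \<odot> f n) =
     (\<Sum>m::nat. (x ^ m / fact m) \<odot> (\<Sum>n::nat. ((- of_rat \<gamma>) ^ n / fact n) \<odot> f (m + n)))"
    by (rule mod.exp_merge[symmetric]) (simp add: f h)
  finally show ?thesis unfolding f_def .
qed

text \<open>D sits inside the left factor and is eliminated by \<open>sq_mode_deriv\<close>. No
  \<gamma> appears, in accordance with the plain argument x_1 in the last two summands of the
  theorem.\<close>

lemma xmode_sq_mode_exp_deriv_left:
  assumes h: "\<And>s. s \<ge> S \<Longrightarrow> h s = 0"
  shows "xmode \<gamma> (sq_mode V (\<Sum>s<S. exp_deriv x s (h s)) i v) w =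
    (\<Sum>n::nat. (x ^ n / fact n) \<odot>
      xmode \<gamma> (\<Sum>l::nat. (of_int i gchoose l) \<cdot> sq_mode V (h (n + l)) (i - int l) v) w)"
proof -
  let ?B = "\<lambda>v. x \<cdot> v - sq_deriv v"
  define f where "f n = xmode \<gamma> (\<Sum>l::nat. (of_int i gchoose l) \<cdot> sq_mode V (h (n + l)) (i - int l) v) w" for n
  have f: "f n = (\<Sum>l<S. (of_int i gchoose l) \<odot> xmode \<gamma> (sq_mode V (h (n + l)) (i - int l) v) w)" for n
    unfolding f_def by (subst Sum_any_nat_less[of S]) (auto simp: h xmode_sum_left xmode_scale_left)
  have step: "xmode \<gamma> (sq_mode V (exp_deriv x s u) i v) w =
     (\<Sum>l\<le>s. (x ^ (s - l) / fact (s - l) * (1 ^ l * (of_int i gchoose l))) \<odot> xmode \<gamma> (sq_mode V u (i - int l) v) w)" for s u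
  proof -
    let ?a = "\<lambda>s i. xmode \<gamma> (sq_mode V ((?B ^^ s) u) i v) w"
    have minus: "sq_mode V (a - b) i v = sq_mode V a i v - sq_mode V b i v" for i a b
      using sq_mode_add_left[of a "(-1) \<cdot> b" i v] sq_mode_scale_left[of "-1" b i v] by simp
    have "?a (Suc s) i = x \<odot> ?a s i + (1 * of_int i) \<odot> ?a s (i - 1)" for s i
      by (simp add: minus sq_mode_scale_left sq_mode_deriv xmode_add_left xmode_scale_left)
    from mod.shift_recurrence[of ?a, OF this, of s i] show ?thesis
      by (simp add: exp_deriv_def sq_mode_scale_left xmode_scale_left)
  qed
  have "xmode \<gamma> (sq_mode V (\<Sum>s<S. exp_deriv x s (h s)) i v) w =
    (\<Sum>s<S. \<Sum>l\<le>s. (x ^ (s - l) / fact (s - l) * (1 ^ l * (of_int i gchoose l))) \<odot> xmode \<gamma> (sq_mode V (h (s - l + l)) (i - int l) v) w)"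
    unfolding sq_mode_sum_left xmode_sum_left step by simp
  also have "\<dots> = (\<Sum>n<S. \<Sum>l<S. (x ^ n / fact n * (1 ^ l * (of_int i gchoose l))) \<odot> xmode \<gamma> (sq_mode V (h (n + l)) (i - int l) v) w)"
    by (rule sum_triangle_box) (simp add: h)
  also have "\<dots> = (\<Sum>n<S. (x ^ n / fact n) \<odot> f n)"
    by (simp add: f mod.scale_sum_right)
  also have "\<dots> = (\<Sum>n::nat. (x ^ n / fact n) \<odot> f n)"
    by (rule Sum_any_nat_less[symmetric]) (simp add: f h)
  finally show ?thesis unfolding f_def .
qed

lemma finite_xmode_sq_mode_shift: "finite {l::nat. c l \<odot> xmode q (sq_mode V u (n + int l) v) w \<noteq> 0}"
  using finite_sq_mode_shift[of "\<lambda>_. 1" u n v] by (rule rev_finite_subset) auto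

text \<open>The functions \<open>h\<close> and \<open>k\<close> are the two halves of
  \<open>exp_deriv_sq_mode_expansion\<close>, with u2 or v2 acting last. \<open>R\<close> places the
  result to the right of u1, \<open>L\<close> to the left of v1. The sums over q and the outer sums
  over l are the exponentials in y_2 and y_1; the four lines follow the order of the
  theorem.\<close>

lemma xmode_sq_psi_sq_mode:
  fixes i j :: int and \<beta> \<gamma> :: rat and u1 v1 u2 v2 :: 'v and w :: 'm
  defines "h \<equiv> \<lambda>z s. sq_mode V u2 j (sq_mode V z (int s) v2)"
    and "k \<equiv> \<lambda>z q s. (-1) powi (j + 1 + int q) \<cdot> sq_mode V v2 (j + int q) (sq_mode V z (int s) u2)"
    and "R \<equiv> \<lambda>g. \<Sum>m::nat. (of_rat \<beta> ^ m / fact m) \<odot> (\<Sum>n::nat. ((- of_rat \<gamma>) ^ n / fact n) \<odot>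
      xmode \<gamma> (\<Sum>l::nat. ((-1) ^ l * (of_int i gchoose l)) \<cdot> sq_mode V u1 (i - int l) (g (m + n + l))) w)"
    and "L \<equiv> \<lambda>g i. \<Sum>n::nat. (of_rat \<beta> ^ n / fact n) \<odot>
      xmode \<gamma> (\<Sum>l::nat. (of_int i gchoose l) \<cdot> sq_mode V (g (n + l)) (i - int l) v1) w"
  shows "xmode \<gamma> (sq_psi (- (of_rat \<gamma> - of_rat \<beta>)) (sq_mode V u1 i v1) (sq_mode V u2 j v2)) w =
    (\<Sum>q::nat. (of_rat \<beta> ^ q / fact q) \<odot> R (k v1 q)) + R (h v1)
    + (\<Sum>l::nat. ((- of_rat \<beta>) ^ l / fact l) \<odot> (\<Sum>q::nat. (of_rat \<beta> ^ q / fact q) \<odot> L (k u1 q) (i + int l)))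
    + (\<Sum>l::nat. ((- of_rat \<beta>) ^ l / fact l) \<odot> L (h u1) (i + int l))"
proof -
  define x :: complex where "x = of_rat \<beta>"
  define c where "c = sq_mode V u2 j v2"
  have "\<exists>S::nat. \<forall>s\<ge>int S. \<forall>z\<in>{u1, v1}. sq_mode V z s c = 0 \<and> sq_mode V z s v2 = 0 \<and> sq_mode V z s u2 = 0"
  proof -
    obtain S where S: "\<forall>p\<in>{u1, v1} \<times> {c, v2, u2}. \<forall>s\<ge>int S. sq_mode V (fst p) s (snd p) = 0"
      using sq_mode_truncation_finite[of "{u1, v1} \<times> {c, v2, u2}" fst snd] by blast
    then show ?thesis by (intro exI[of _ S]) auto
  qed
  then obtain S0 :: nat where S0: "\<And>s z. s \<ge> int S0 \<Longrightarrow> z \<in> {u1, v1} \<Longrightarrow> sq_mode V z s c = 0 \<and> sq_mode V z s v2 = 0 \<and> sq_mode V z s u2 = 0"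
    by blast
  obtain Q1 :: nat where Q1: "\<forall>p\<in>{u1, v1} \<times> {..<S0}. \<forall>s\<ge>int Q1. sq_mode V (sq_mode V (fst p) (int (snd p)) u2) s v2 = 0"
    using sq_mode_truncation_finite[of "{u1, v1} \<times> {..<S0}" "\<lambda>p. sq_mode V (fst p) (int (snd p)) u2" "\<lambda>_. v2"] by blast
  obtain Q2 :: nat where Q2: "\<forall>p\<in>{u1, v1} \<times> {..<S0}. \<forall>s\<ge>int Q2. sq_mode V v2 s (sq_mode V (fst p) (int (snd p)) u2) = 0"
    using sq_mode_truncation_finite[of "{u1, v1} \<times> {..<S0}" "\<lambda>_. v2" "\<lambda>p. sq_mode V (fst p) (int (snd p)) u2"] by blast
  define Q where "Q = nat (int (max Q1 Q2) - j)"
  define S where "S = S0 + Q"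
  have b1: "sq_mode V (sq_mode V z (int m) u2) (j + int l) v2 = 0" if "m + l \<ge> S" "z \<in> {u1, v1}" for m l z
  proof (cases "m < S0")
    case True
    then have "j + int l \<ge> int Q1" using that(1) by (auto simp: S_def Q_def)
    then show ?thesis using Q1 True that(2) by auto
  next
    case False
    then show ?thesis using S0[of "int m" z] that(2) by simp
  qed
  have b2: "sq_mode V v2 (j + int q) (sq_mode V z (int m) u2) = 0" if "q \<ge> S" "z \<in> {u1, v1}" for m q z
  proof (cases "m < S0")
    case True
    have "j + int q \<ge> int Q2" using that(1) by (auto simp: S_def Q_def)
    then show ?thesis using Q2 True that(2) by auto
  next
    case False
    then show ?thesis using S0[of "int m" z] that(2) by simp
  qed
  define H where "H z = (\<Sum>s<S. exp_deriv x s (h z s))" for z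
  define K where "K z q = (\<Sum>s<S. exp_deriv x s (k z q s))" for z q
  have psi: "sq_psi (- x) c z = - (H z + (\<Sum>q<S. (x ^ q / fact q) \<cdot> K z q))" if "z \<in> {u1, v1}" for z
  proof -
    have "sq_psi (- x) c z = - (\<Sum>s<S. exp_deriv x s (sq_mode V z (int s) c))"
      using S0 that by (intro sq_psi_skew) (auto simp: S_def)
    also have "(\<Sum>s<S. exp_deriv x s (sq_mode V z (int s) c)) = H z + (\<Sum>q<S. (x ^ q / fact q) \<cdot> K z q)"
      unfolding H_def K_def h_def k_def c_def
      by (rule exp_deriv_sq_mode_expansion) (use S0 that b1 b2 in \<open>auto simp: S_def c_def\<close>)
    finally show ?thesis .
  qed
  note psi_u = psi[of u1, OF insertI1] and psi_v = psi[of v1, OF insertI2, OF singletonI]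
  have h0: "h z s = 0" and k0: "k z q s = 0" if "s \<ge> S" "z \<in> {u1, v1}" for z q s
    using S0[of "int s" z] that by (auto simp: h_def k_def S_def)
  have kq: "k z q s = 0" if "q \<ge> S" "z \<in> {u1, v1}" for z q s
    using b2 that by (simp add: k_def)
  have R: "xmode \<gamma> (sq_mode V u1 i (H v1)) w = R (h v1)"
      "xmode \<gamma> (sq_mode V u1 i (K v1 q)) w = R (k v1 q)" for q
    unfolding H_def K_def R_def x_def by (rule xmode_sq_mode_exp_deriv_right, simp add: h0 k0)+
  have L: "xmode \<gamma> (sq_mode V (H u1) m v1) w = L (h u1) m"
      "xmode \<gamma> (sq_mode V (K u1 q) m v1) w = L (k u1 q) m" for m q
    unfolding H_def K_def L_def x_def by (rule xmode_sq_mode_exp_deriv_left, simp add: h0 k0)+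
  have K0: "K z q = 0" if "q \<ge> S" "z \<in> {u1, v1}" for z q
    using kq that by (simp add: K_def)
  have xm: "xmode \<gamma> (- u) w = - xmode \<gamma> u w" for u
    using xmode_scale_left[of \<gamma> "-1" u w] by simp
  have sm: "sq_mode V u n (- y) = - sq_mode V u n y" "sq_mode V (- u) n y = - sq_mode V u n y" for u n y
    using sq_mode_scale_right[of u n "-1" y] sq_mode_scale_left[of "-1" u n y] by simp_all
  \<comment> \<open>The sign of this swap cancels against the sign of the second skew-symmetry, the
    one contained in \<open>psi\<close>.\<close>
  have "xmode \<gamma> (sq_psi (- (of_rat \<gamma> - x)) (sq_mode V u1 i v1) c) w = - xmode \<gamma> (sq_psi (- x) c (sq_mode V u1 i v1)) w"
    by (rule xmode_sq_psi_swap)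
  also have "sq_psi (- x) c (sq_mode V u1 i v1) = sq_mode V u1 i (sq_psi (- x) c v1) +
      (\<Sum>l::nat. ((- x) ^ l / fact l) \<cdot> sq_mode V (sq_psi (- x) c u1) (i + int l) v1)"
    using sq_psi_commutator[of "- x" c u1 i v1] by (simp add: algebra_simps)
  also have "xmode \<gamma> \<dots> w = xmode \<gamma> (sq_mode V u1 i (sq_psi (- x) c v1)) w +
      (\<Sum>l::nat. ((- x) ^ l / fact l) \<odot> xmode \<gamma> (sq_mode V (sq_psi (- x) c u1) (i + int l) v1) w)"
  proof -
    have "xmode \<gamma> (\<Sum>l::nat. ((- x) ^ l / fact l) \<cdot> sq_mode V (sq_psi (- x) c u1) (i + int l) v1) w =
      (\<Sum>l::nat. xmode \<gamma> (((- x) ^ l / fact l) \<cdot> sq_mode V (sq_psi (- x) c u1) (i + int l) v1) w)"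
      by (rule Sum_any_hom[where h = "\<lambda>u. xmode \<gamma> u w"]) (rule xmode_add_left xmode_0_left finite_sq_mode_shift)+
    then show ?thesis by (simp only: xmode_add_left xmode_scale_left)
  qed
  also have "xmode \<gamma> (sq_mode V u1 i (sq_psi (- x) c v1)) w = - (R (h v1) + (\<Sum>q::nat. (x ^ q / fact q) \<odot> R (k v1 q)))"
  proof -
    have "(\<Sum>q::nat. (x ^ q / fact q) \<odot> R (k v1 q)) = (\<Sum>q<S. (x ^ q / fact q) \<odot> R (k v1 q))"
      unfolding R(2)[symmetric] by (rule Sum_any_nat_less) (simp add: K0)
    then show ?thesis
      by (simp only: psi_v sm xm sq_mode_add_right sq_mode_sum_right sq_mode_scale_right xmode_add_left xmode_sum_left xmode_scale_left R)
  qed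
  also have "(\<Sum>l::nat. ((- x) ^ l / fact l) \<odot> xmode \<gamma> (sq_mode V (sq_psi (- x) c u1) (i + int l) v1) w) =
    (\<Sum>l::nat. - (((- x) ^ l / fact l) \<odot> (\<Sum>q::nat. (x ^ q / fact q) \<odot> L (k u1 q) (i + int l)) +
     ((- x) ^ l / fact l) \<odot> L (h u1) (i + int l)))"
  proof (rule Sum_any.cong)
    fix l
    have "(\<Sum>q::nat. (x ^ q / fact q) \<odot> L (k u1 q) (i + int l)) = (\<Sum>q<S. (x ^ q / fact q) \<odot> L (k u1 q) (i + int l))"
      unfolding L(2)[symmetric] by (rule Sum_any_nat_less) (simp add: K0)
    then show "((- x) ^ l / fact l) \<odot> xmode \<gamma> (sq_mode V (sq_psi (- x) c u1) (i + int l) v1) w =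
      - (((- x) ^ l / fact l) \<odot> (\<Sum>q::nat. (x ^ q / fact q) \<odot> L (k u1 q) (i + int l)) +
        ((- x) ^ l / fact l) \<odot> L (h u1) (i + int l))"
      by (simp only: psi_u sm xm sq_mode_add_left sq_mode_sum_left sq_mode_scale_left xmode_add_left xmode_sum_left xmode_scale_left
          L mod.scale_right_distrib[symmetric] mod.scale_minus_right add.commute)
  qed
  also have "\<dots> = - (\<Sum>l::nat. ((- x) ^ l / fact l) \<odot> (\<Sum>q::nat. (x ^ q / fact q) \<odot> L (k u1 q) (i + int l)) +
     ((- x) ^ l / fact l) \<odot> L (h u1) (i + int l))"
  proof -
    have "(\<Sum>l. - f l) = - Sum_any f" for f :: "nat \<Rightarrow> 'm"
      using mod.scale_Sum_any[of "-1" f] by simp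
    then show ?thesis by (simp only:)
  qed
  also have "(\<Sum>l::nat. ((- x) ^ l / fact l) \<odot> (\<Sum>q::nat. (x ^ q / fact q) \<odot> L (k u1 q) (i + int l)) +
     ((- x) ^ l / fact l) \<odot> L (h u1) (i + int l)) =
    (\<Sum>l::nat. ((- x) ^ l / fact l) \<odot> (\<Sum>q::nat. (x ^ q / fact q) \<odot> L (k u1 q) (i + int l))) +
     (\<Sum>l::nat. ((- x) ^ l / fact l) \<odot> L (h u1) (i + int l))"
  proof (rule Sum_any.distrib)
    have "(\<Sum>q::nat. (x ^ q / fact q) \<odot> L (k u1 q) m) = xmode \<gamma> (sq_mode V (\<Sum>q<S. (x ^ q / fact q) \<cdot> K u1 q) m v1) w" for m
    proof -
      have "(\<Sum>q::nat. (x ^ q / fact q) \<odot> L (k u1 q) m) = (\<Sum>q<S. (x ^ q / fact q) \<odot> L (k u1 q) m)"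
        unfolding L(2)[symmetric] by (rule Sum_any_nat_less) (simp add: K0)
      then show ?thesis by (simp add: sq_mode_sum_left sq_mode_scale_left xmode_sum_left xmode_scale_left L)
    qed
    then show "finite {l::nat. ((- x) ^ l / fact l) \<odot> (\<Sum>q::nat. (x ^ q / fact q) \<odot> L (k u1 q) (i + int l)) \<noteq> 0}"
      by (simp only: finite_xmode_sq_mode_shift)
    show "finite {l::nat. ((- x) ^ l / fact l) \<odot> L (h u1) (i + int l) \<noteq> 0}"
      unfolding L(1)[symmetric] by (rule finite_xmode_sq_mode_shift)
  qed
  finally show ?thesis
    unfolding x_def c_def by (simp add: algebra_simps)
qed

end

section \<open>Coefficients of the series in the theorem\<close>

context complex_vector_space begin

lemma fbinom_eval:
  assumes "x \<noteq> y"
  shows "fbinom scale x c y q F e =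
    (\<Sum>i::nat. ((of_rat q gchoose i) * c ^ i) *s F (e(x := e x - (q - of_nat i), y := e y - of_nat i)))"
  using assms by (simp add: fbinom_def fsum_def fscale_def fmono_def)

text \<open>F contains no x, so the prescribed exponent of x pairs every binomial index l with
  exactly one mode.\<close>

lemma fvertex_fbinom:
  assumes xy: "x \<noteq> y" and F: "\<And>e. e x \<noteq> 0 \<Longrightarrow> F e = 0" and a: "\<And>n. a n 0 = 0"
    and fin: "finite {l::nat. F (e(x := 0, y := e y - of_nat l)) \<noteq> 0}"
  shows "fvertex a (\<lambda>k. fbinom scale x c y (of_int k)) F e =
    (\<Sum>l::nat. ((of_rat (e x + of_nat l) gchoose l) * c ^ l) *s
      rat_mode a (- e x - of_nat l - 1) (F (e(x := 0, y := e y - of_nat l))))"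
proof -
  let ?e = "\<lambda>n l. e(x := e x - ((- n - 1) - of_nat l), y := e y - of_nat l)"
  let ?f = "\<lambda>n l. ((of_rat (- n - 1) gchoose l) * c ^ l) *s rat_mode a n (F (?e n l))"
  let ?g = "\<lambda>l::nat. - e x - of_nat l - 1"
  have eg: "?e (?g l) l = e(x := 0, y := e y - of_nat l)" for l by simp
  have "fvertex a (\<lambda>k. fbinom scale x c y (of_int k)) F e = fvertex (rat_mode a) (fbinom scale x c y) F e"
    by (subst fvertex_of_int) (auto simp: fbinom_eval[OF xy] fun_eq_iff)
  also have "\<dots> = (\<Sum>n. \<Sum>l. ?f n l)"
    by (simp add: fvertex_def fsum_def fbinom_eval[OF xy])
  also have "\<dots> = (\<Sum>l. ?f (?g l) l)"
  proof (rule Sum_any_graph)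
    fix n l assume "n \<noteq> ?g l"
    then have "F (?e n l) = 0" using xy by (intro F) auto
    then show "?f n l = 0" by (simp add: rat_mode_0 a)
  next
    show "inj ?g" by (auto simp: inj_on_def)
  next
    show "finite {l. ?f (?g l) l \<noteq> 0}"
      unfolding eg using fin by (rule rev_finite_subset) (auto simp: rat_mode_0 a)
  qed
  also have "\<dots> = (\<Sum>l::nat. ((of_rat (e x + of_nat l) gchoose l) * c ^ l) *s
      rat_mode a (- e x - of_nat l - 1) (F (e(x := 0, y := e y - of_nat l))))"
  proof (rule Sum_any.cong)
    fix l
    have gl: "- ?g l - 1 = e x + of_nat l" by simp
    show "?f (?g l) l = ((of_rat (e x + of_nat l) gchoose l) * c ^ l) *s
      rat_mode a (- e x - of_nat l - 1) (F (e(x := 0, y := e y - of_nat l)))"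
      unfolding eg gl by (simp only: add_diff_cancel_right' diff_self)
  qed
  finally show ?thesis .
qed

text \<open>Applied with x = \<open>X2\<close>: the powers of x_2 come from the delta function
  alone, so a single term of it is left.\<close>

lemma fdelta_eval:
  assumes P: "\<And>q. q \<noteq> - e x \<Longrightarrow> P q F e = 0" and p: "p > 0" and k: "of_nat p * e x = of_int \<kappa>"
  shows "fdelta scale c p P F e = (c powi (- \<kappa>)) *s P (- e x) F e"
proof -
  have q: "of_int k / of_nat p = - e x \<longleftrightarrow> k = - \<kappa>" for k
  proof -
    have "of_int k / of_nat p = - e x \<longleftrightarrow> of_int k = - (of_nat p * e x)"
      using p by (simp add: field_simps)
    also have "\<dots> \<longleftrightarrow> of_int k = (of_int (- \<kappa>) :: rat)" by (simp add: k)
    also have "\<dots> \<longleftrightarrow> k = - \<kappa>" by (simp only: of_int_eq_iff)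
    finally show ?thesis .
  qed
  have "fdelta scale c p P F e = (\<Sum>k::int. c powi k *s P (of_int k / of_nat p) F e)"
    by (simp add: fdelta_def fsum_def fscale_def)
  also have "\<dots> = c powi (- \<kappa>) *s P (of_int (- \<kappa>) / of_nat p) F e"
    by (rule Sum_any_single) (simp add: P q)
  also have "of_int (- \<kappa>) / of_nat p = - e x" unfolding q ..
  finally show ?thesis .
qed

lemma fdelta_eq_0:
  assumes P: "\<And>q. q \<noteq> - e x \<Longrightarrow> P q F e = 0" and p: "p > 0" and k: "of_nat p * e x \<notin> \<int>"
  shows "fdelta scale c p P F e = 0"
proof -
  have "of_int k / of_nat p \<noteq> - e x" for k
  proof
    assume "of_int k / of_nat p = - e x"
    then have "of_nat p * e x = of_int (- k)" using p by (simp add: field_simps)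
    then show False using k by (metis Ints_of_int)
  qed
  then show ?thesis
    by (simp add: fdelta_def fsum_def fscale_def P)
qed

end

context twisted_module
begin

abbreviation expP :: "rat \<Rightarrow> 'm fseries \<Rightarrow> 'm fseries"
  where "expP \<equiv> \<lambda>q F. fexp (mscale M) (- q) Y0 (fmono X1 q F)"

section \<open>Coefficients of X_M applied to series\<close>

lemma XM_fmono:
  assumes "\<And>e. e x \<noteq> 0 \<Longrightarrow> G e = 0"
  shows "XM V M u (fmono x) G e = xmode (e x) u (G (e(x := 0)))"
proof -
  have "fmono x (of_int d) (fvertex (tmode M v) (fmono x) G) e = tmode M v (of_int d - 1 - e x) (G (e(x := 0)))" for d v
    unfolding fmono_def[of x "of_int d"] by (subst fvertex_fmono[OF assms]) (simp_all add: algebra_simps)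
  then show ?thesis by (simp add: XM_def fsum_def xmode_def)
qed

lemma XM_series_single:
  assumes F: "\<And>d. F d = (if \<forall>z. z \<noteq> y \<longrightarrow> d z = 0 then f (d y) else 0)"
    and G: "\<And>e. e x \<noteq> 0 \<or> e y \<noteq> 0 \<Longrightarrow> G e = 0" and xy: "x \<noteq> y"
  shows "XM_series V M F (fmono x) G e = xmode (e x) (f (e y)) (G (e(x := 0, y := 0)))"
proof -
  let ?d = "(\<lambda>_. 0)(y := e y)"
  let ?f = "\<lambda>d. xmode ((e - d) x) (F d) (G ((e - d)(x := 0)))"
  have "XM_series V M F (fmono x) G e = Sum_any ?f"
    unfolding XM_series_def flin_def fsum_def by (subst XM_fmono) (auto simp: G)
  also have "\<dots> = ?f ?d"
  proof (rule Sum_any_single)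
    fix d assume d: "d \<noteq> ?d"
    show "?f d = 0"
    proof (cases "\<forall>z. z \<noteq> y \<longrightarrow> d z = 0")
      case True
      have "d y \<noteq> e y"
      proof
        assume *: "d y = e y"
        have "d = ?d"
        proof
          fix z show "d z = ?d z" using True * by (cases "z = y") auto
        qed
        then show False using d by contradiction
      qed
      then have "((e - d)(x := 0)) y \<noteq> 0" using xy by simp
      then have "G ((e - d)(x := 0)) = 0" by (intro G) blast
      then show ?thesis by simp
    next
      case False
      then show ?thesis by (simp only: F if_False xmode_0_left)
    qed
  qed
  also have "F ?d = f (e y)" unfolding F by simp
  also have "(e - ?d)(x := 0) = e(x := 0, y := 0)" using xy by (auto simp: fun_eq_iff)
  also have "(e - ?d) x = e x" using xy by simp
  finally show ?thesis .
qed

lemma XM_series_fmono: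
  assumes F: "\<And>d. d X1 \<noteq> 0 \<Longrightarrow> F d = 0"
  shows "XM_series V M F (fmono X1) (fconst w) e = xmode (e X1) (F (e(X1 := 0))) w"
proof -
  let ?d = "e(X1 := 0)"
  let ?f = "\<lambda>d. xmode ((e - d) X1) (F d) (if \<forall>z. z \<noteq> X1 \<longrightarrow> (e - d) z = 0 then w else 0)"
  have fc: "fconst w (d(X1 := 0)) = (if \<forall>z. z \<noteq> X1 \<longrightarrow> d z = 0 then w else 0)" for d
    by (simp add: fconst_def fun_upd_eq_zero_iff)
  have "XM_series V M F (fmono X1) (fconst w) e = Sum_any ?f"
    unfolding XM_series_def flin_def fsum_def
    by (subst XM_fmono, force simp: fconst_def, simp only: fc)
  also have "\<dots> = ?f ?d"
  proof (rule Sum_any_single)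
    fix d assume d: "d \<noteq> ?d"
    show "?f d = 0"
    proof (cases "d X1 = 0")
      case True
      have "\<not> (\<forall>z. z \<noteq> X1 \<longrightarrow> (e - d) z = 0)"
      proof
        assume *: "\<forall>z. z \<noteq> X1 \<longrightarrow> (e - d) z = 0"
        have "d = ?d"
        proof
          fix z show "d z = ?d z"
          proof (cases "z = X1")
            case False
            then have "(e - d) z = 0" using * by blast
            then show ?thesis using False by simp
          qed (use True in simp)
        qed
        then show False using d by contradiction
      qed
      then show ?thesis by (simp only: if_False xmode_0_right)
    next
      case False
      then show ?thesis by (simp only: F xmode_0_left not_False_eq_True)
    qed
  qed
  also have "\<dots> = xmode (e X1) (F ?d) w"
  proof -
    have 1: "\<forall>z. z \<noteq> X1 \<longrightarrow> (e - ?d) z = 0" and 2: "(e - ?d) X1 = e X1" by simp_all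
    show ?thesis unfolding if_P[OF 1] 2 ..
  qed
  finally show ?thesis .
qed

text \<open>For z = e^(-y) x_1 the factors z^d and z^(-n-1) each contribute an exponential in y.
  Their product depends only on the total exponent of x_1.\<close>

lemma XM_expP:
  "XM V M u expP (fconst w) e =
    (if e X0 = 0 \<and> e X2 = 0 \<and> e Y1 = 0 \<and> e Y2 = 0 \<and> e Y0 \<in> \<nat>
     then ((- of_rat (e X1)) ^ nat \<lfloor>e Y0\<rfloor> / fact (nat \<lfloor>e Y0\<rfloor>)) \<odot> xmode (e X1) u w else 0)"
proof -
  define Z where "Z e \<longleftrightarrow> e X0 = 0 \<and> e X2 = 0 \<and> e Y1 = 0 \<and> e Y2 = (0::rat)" for e
  have fc: "fconst w e = (if Z e \<and> e X1 = 0 \<and> e Y0 = 0 then w else 0)" for e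
  proof -
    have "e = 0 \<longleftrightarrow> Z e \<and> e X1 = 0 \<and> e Y0 = 0"
      unfolding Z_def fun_eq_iff zero_fun_def by (metis fvar.exhaust)
    then show ?thesis by (simp add: fconst_def)
  qed
  have vert: "fvertex (tmode M v) expP (fconst w) e =
    (if Z e \<and> e Y0 \<in> \<nat> then ((- of_rat (e X1)) ^ nat \<lfloor>e Y0\<rfloor> / fact (nat \<lfloor>e Y0\<rfloor>)) \<odot> tmode M v (- e X1 - 1) w else 0)" for v e
  proof -
    have "fvertex (tmode M v) expP (fconst w) e =
      (\<Sum>n. \<Sum>j::nat. (of_rat (n + 1) ^ j / fact j) \<odot>
         (if Z e \<and> e X1 + n + 1 = 0 \<and> e Y0 = of_nat j then tmode M v n w else 0))"
      unfolding fvertex_def fsum_def fexp_eval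
      by (intro Sum_any.cong) (simp add: fmono_def fc Z_def add.commute add.left_commute)
    also have "\<dots> = (\<Sum>j::nat. (of_rat ((- e X1 - 1) + 1) ^ j / fact j) \<odot>
         (if Z e \<and> e X1 + (- e X1 - 1) + 1 = 0 \<and> e Y0 = of_nat j then tmode M v (- e X1 - 1) w else 0))"
      by (rule Sum_any_single) (auto simp: algebra_simps eq_neg_iff_add_eq_0)
    also have "\<dots> = (\<Sum>j::nat. if Z e \<and> e Y0 = of_nat j then ((- of_rat (e X1)) ^ j / fact j) \<odot> tmode M v (- e X1 - 1) w else 0)"
      by (rule Sum_any.cong) (simp add: of_rat_minus)
    also have "\<dots> = (if Z e \<and> e Y0 \<in> \<nat> then ((- of_rat (e X1)) ^ nat \<lfloor>e Y0\<rfloor> / fact (nat \<lfloor>e Y0\<rfloor>)) \<odot> tmode M v (- e X1 - 1) w else 0)"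
    proof (cases "Z e \<and> e Y0 \<in> \<nat>")
      case True
      then obtain J where J: "e Y0 = of_nat J" by (auto elim: Nats_cases)
      then have "(\<Sum>j::nat. if Z e \<and> e Y0 = of_nat j then ((- of_rat (e X1)) ^ j / fact j) \<odot> tmode M v (- e X1 - 1) w else 0) =
        (if Z e \<and> e Y0 = of_nat J then ((- of_rat (e X1)) ^ J / fact J) \<odot> tmode M v (- e X1 - 1) w else 0)"
        by (intro Sum_any_single) auto
      then show ?thesis using True J by simp
    next
      case False
      then have "\<not> (Z e \<and> e Y0 = of_nat j)" for j by auto
      then show ?thesis unfolding if_not_P[OF False] by (simp only: if_False) simp
    qed
    finally show ?thesis .
  qed
  have "XM V M u expP (fconst w) e =
    (\<Sum>d::int. \<Sum>i::nat. (of_rat (- of_int d) ^ i / fact i) \<odot>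
      fvertex (tmode M (component (vgrade V) u d)) expP (fconst w) (e(Y0 := e Y0 - of_nat i, X1 := e X1 - of_int d)))"
    unfolding XM_def fsum_def fexp_eval[of _ _ _ "fmono X1 (of_int _) _"] by (simp add: fmono_def)
  also have "\<dots> = (\<Sum>d::int. if Z e \<and> e Y0 \<in> \<nat> then ((- of_rat (e X1)) ^ nat \<lfloor>e Y0\<rfloor> / fact (nat \<lfloor>e Y0\<rfloor>)) \<odot>
      tmode M (component (vgrade V) u d) (of_int d - 1 - e X1) w else 0)"
  proof (rule Sum_any.cong)
    fix d :: int
    let ?t = "tmode M (component (vgrade V) u d) (of_int d - 1 - e X1) w"
    let ?v = "\<lambda>i::nat. fvertex (tmode M (component (vgrade V) u d)) expP (fconst w) (e(Y0 := e Y0 - of_nat i, X1 := e X1 - of_int d))"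
    let ?x = "of_int d - of_rat (e X1) :: complex"
    have v: "?v i = (if Z e \<and> e Y0 - of_nat i \<in> \<nat> then (?x ^ nat \<lfloor>e Y0 - of_nat i\<rfloor> / fact (nat \<lfloor>e Y0 - of_nat i\<rfloor>)) \<odot> ?t else 0)" for i
      by (simp add: vert Z_def of_rat_diff algebra_simps)
    show "(\<Sum>i::nat. (of_rat (- of_int d) ^ i / fact i) \<odot> ?v i) =
      (if Z e \<and> e Y0 \<in> \<nat> then ((- of_rat (e X1)) ^ nat \<lfloor>e Y0\<rfloor> / fact (nat \<lfloor>e Y0\<rfloor>)) \<odot> ?t else 0)"
    proof (cases "Z e \<and> e Y0 \<in> \<nat>")
      case True
      then obtain J where J: "e Y0 = of_nat J" by (auto elim: Nats_cases)
      have mem: "e Y0 - of_nat i \<in> \<nat> \<longleftrightarrow> i \<le> J" for i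
      proof
        assume "e Y0 - of_nat i \<in> \<nat>"
        then obtain k where "e Y0 - of_nat i = of_nat k" by (rule Nats_cases)
        then have "of_nat J = (of_nat (i + k) :: rat)" by (simp add: J algebra_simps)
        then have "J = i + k" by (simp only: of_nat_eq_iff)
        then show "i \<le> J" by simp
      next
        assume "i \<le> J"
        then have "e Y0 - of_nat i = of_nat (J - i)" by (simp add: J of_nat_diff)
        then show "e Y0 - of_nat i \<in> \<nat>" by simp
      qed
      have "(\<Sum>i::nat. (of_rat (- of_int d) ^ i / fact i) \<odot> ?v i) = (\<Sum>i\<le>J. (of_rat (- of_int d) ^ i / fact i) \<odot> ?v i)"
        by (rule Sum_any_eq_sum) (auto simp: v mem)
      also have "\<dots> = (\<Sum>i\<le>J. ((- of_int d) ^ i / fact i * (?x ^ (J - i) / fact (J - i))) \<odot> ?t)"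
      proof (rule sum.cong[OF refl])
        fix i assume "i \<in> {..J}"
        then have "e Y0 - of_nat i = of_nat (J - i)" "e Y0 - of_nat i \<in> \<nat>" using mem by (simp_all add: J of_nat_diff)
        then have "(if Z e \<and> e Y0 - of_nat i \<in> \<nat> then (?x ^ nat \<lfloor>e Y0 - of_nat i\<rfloor> / fact (nat \<lfloor>e Y0 - of_nat i\<rfloor>)) \<odot> ?t else 0) =
            (?x ^ (J - i) / fact (J - i)) \<odot> ?t"
          using True by simp
        then have "?v i = (?x ^ (J - i) / fact (J - i)) \<odot> ?t" by (rule trans[OF v])
        then show "(of_rat (- of_int d) ^ i / fact i) \<odot> ?v i = ((- of_int d) ^ i / fact i * (?x ^ (J - i) / fact (J - i))) \<odot> ?t"
          by (simp only: of_rat_minus of_rat_of_int_eq mod.scale_scale)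
      qed
      also have "\<dots> = (\<Sum>i\<le>J. (- of_int d) ^ i / fact i * (?x ^ (J - i) / fact (J - i))) \<odot> ?t"
        by (simp only: mod.scale_sum_left)
      \<comment> \<open>The weight d cancels here, so the homogeneous components recombine into a
        single \<open>xmode\<close>.\<close>
      also have "(\<Sum>i\<le>J. (- of_int d) ^ i / fact i * (?x ^ (J - i) / fact (J - i))) = (- of_int d + ?x) ^ J / fact J"
        unfolding binomial_ring sum_divide_distrib by (rule sum.cong) (simp_all add: binomial_fact)
      finally have "(\<Sum>i::nat. (of_rat (- of_int d) ^ i / fact i) \<odot> ?v i) = ((- of_int d + ?x) ^ J / fact J) \<odot> ?t" .
      moreover have "- of_int d + ?x = - of_rat (e X1)" by simp
      moreover have "nat \<lfloor>e Y0\<rfloor> = J" by (simp add: J)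
      ultimately show ?thesis unfolding if_P[OF True] by (simp only:)
    next
      case False
      have "e Y0 - of_nat i \<notin> \<nat>" if "e Y0 \<notin> \<nat>" for i
      proof
        assume "e Y0 - of_nat i \<in> \<nat>"
        then have "(e Y0 - of_nat i) + of_nat i \<in> \<nat>" by (intro Nats_add) auto
        then show False using that by simp
      qed
      then have "?v i = 0" for i using False by (auto simp: v)
      then show ?thesis unfolding if_not_P[OF False] by simp
    qed
  qed
  also have "\<dots> = (if Z e \<and> e Y0 \<in> \<nat> then ((- of_rat (e X1)) ^ nat \<lfloor>e Y0\<rfloor> / fact (nat \<lfloor>e Y0\<rfloor>)) \<odot> xmode (e X1) u w else 0)"
  proof (cases "Z e \<and> e Y0 \<in> \<nat>")
    case True
    show ?thesis unfolding if_P[OF True] xmode_def mod.scale_Sum_any ..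
  next
    case False
    show ?thesis unfolding if_not_P[OF False] by (rule Sum_any.neutral)
  qed
  finally show ?thesis unfolding Z_def by (simp only: conj_assoc)
qed

lemma XM_expP_0: "XM V M 0 expP (fconst w) e = 0"
  by (simp only: XM_expP xmode_0_left mod.scale_zero_right if_cancel)

lemma XM_series_expP:
  assumes W: "\<And>d. d X0 \<noteq> 0 \<or> d X1 \<noteq> 0 \<or> d X2 \<noteq> 0 \<Longrightarrow> W d = 0"
  shows "XM_series V M W expP (fconst w) e =
    (if e X0 = 0 \<and> e X2 = 0 then
      (\<Sum>n::nat. ((- of_rat (e X1)) ^ n / fact n) \<odot> xmode (e X1) (W (e(X1 := 0, Y0 := e Y0 - of_nat n))) w)
     else 0)"
proof -
  let ?f = "\<lambda>d. XM V M (W d) expP (fconst w) (e - d)"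
  have S: "XM_series V M W expP (fconst w) e = Sum_any ?f"
    unfolding XM_series_def flin_def fsum_def ..
  show ?thesis
  proof (cases "e X0 = 0 \<and> e X2 = 0")
    case True
    let ?g = "\<lambda>n::nat. e(X1 := 0, Y0 := e Y0 - of_nat n)"
    have "Sum_any ?f = (\<Sum>n. ?f (?g n))"
    proof (rule Sum_any_reindex)
      show "inj ?g"
      proof (rule injI)
        fix m n assume "?g m = ?g n"
        then have "?g m Y0 = ?g n Y0" by (rule fun_cong)
        then show "m = n" by simp
      qed
    next
      fix d assume d: "d \<notin> range ?g"
      show "?f d = 0"
      proof (rule ccontr)
        assume nz: "?f d \<noteq> 0"
        have "W d \<noteq> 0" using nz XM_expP_0 by metis
        then have "d X1 = 0" using W by blast
        have "(e - d) X0 = 0 \<and> (e - d) X2 = 0 \<and> (e - d) Y1 = 0 \<and> (e - d) Y2 = 0 \<and> (e - d) Y0 \<in> \<nat>"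
          using nz unfolding XM_expP by meson
        moreover from this obtain n where "(e - d) Y0 = of_nat n" by (auto elim: Nats_cases)
        ultimately have "d z = ?g n z" for z
          using \<open>d X1 = 0\<close> by (cases z) auto
        then have "d = ?g n" by (rule ext)
        then show False using d by blast
      qed
    qed
    also have "\<dots> = (\<Sum>n::nat. ((- of_rat (e X1)) ^ n / fact n) \<odot> xmode (e X1) (W (?g n)) w)"
    proof (rule Sum_any.cong)
      fix n
      have "(e - ?g n) X0 = 0" "(e - ?g n) X2 = 0" "(e - ?g n) Y1 = 0" "(e - ?g n) Y2 = 0" "(e - ?g n) Y0 = of_nat n" "(e - ?g n) X1 = e X1"
        by simp_all
      then show "?f (?g n) = ((- of_rat (e X1)) ^ n / fact n) \<odot> xmode (e X1) (W (?g n)) w"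
        unfolding XM_expP by simp
    qed
    finally show ?thesis using True S by simp
  next
    case False
    have "?f d = 0" for d
    proof (cases "d X0 = 0 \<and> d X2 = 0")
      case True
      then have "\<not> ((e - d) X0 = 0 \<and> (e - d) X2 = 0)" using False by simp
      then show ?thesis unfolding XM_expP by meson
    next
      case False
      then have "W d = 0" using W by blast
      then show ?thesis by (simp only: XM_expP_0)
    qed
    then show ?thesis unfolding S if_not_P[OF False] by simp
  qed
qed

section \<open>Coefficients of nested square-bracket products\<close>

lemma Ysq_series_eval:
  assumes U: "\<And>d. d Y1 \<noteq> 0 \<Longrightarrow> U d = 0"
  shows "Ysq_series V U (\<lambda>k. fbinom (vscale V) Y1 c Y0 (of_int k)) v e =
    (\<Sum>t::nat. ((of_rat (e Y1 + of_nat t) gchoose t) * c ^ t) \<cdot>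
      rat_mode (sq_mode V (U (e(Y1 := 0, Y0 := e Y0 - of_nat t)))) (- e Y1 - of_nat t - 1) v)"
proof -
  let ?g = "\<lambda>t::nat. e(Y1 := 0, Y0 := e Y0 - of_nat t)"
  let ?f = "\<lambda>d. Ysq V (U d) (\<lambda>k. fbinom (vscale V) Y1 c Y0 (of_int k)) (fconst v) (e - d)"
  have Y: "Ysq V u (\<lambda>k. fbinom (vscale V) Y1 c Y0 (of_int k)) (fconst v) e =
    (\<Sum>l::nat. ((of_rat (e Y1 + of_nat l) gchoose l) * c ^ l) \<cdot>
      rat_mode (sq_mode V u) (- e Y1 - of_nat l - 1) (fconst v (e(Y1 := 0, Y0 := e Y0 - of_nat l))))" for u e
    unfolding Ysq_def
  proof (rule fvertex_fbinom)
    have sub: "{l::nat. fconst v (e(Y1 := 0, Y0 := e Y0 - of_nat l)) \<noteq> 0} \<subseteq> {l. of_nat l = e Y0}"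
    proof
      fix l assume "l \<in> {l::nat. fconst v (e(Y1 := 0, Y0 := e Y0 - of_nat l)) \<noteq> 0}"
      then have "e(Y1 := 0, Y0 := e Y0 - of_nat l) = 0" by (simp add: fconst_def split: if_splits)
      then have "(e(Y1 := 0, Y0 := e Y0 - of_nat l)) Y0 = 0" by (simp only: zero_fun_apply)
      then show "l \<in> {l. of_nat l = e Y0}" by simp
    qed
    have "finite {l::nat. of_nat l = e Y0}"
    proof (cases "\<exists>k. e Y0 = of_nat k")
      case True
      then obtain k where "e Y0 = of_nat k" by blast
      then have "{l::nat. of_nat l = e Y0} = {k}" by auto
      then show ?thesis by simp
    next
      case False
      then have "{l::nat. of_nat l = e Y0} = {}" by (metis (mono_tags, lifting) empty_Collect_eq)
      then show ?thesis by (simp only: finite.emptyI)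
    qed
    then show "finite {l::nat. fconst v (e(Y1 := 0, Y0 := e Y0 - of_nat l)) \<noteq> 0}"
      by (rule finite_subset[OF sub])
  qed (auto simp: fconst_def)
  have Y1: "Ysq V u (\<lambda>k. fbinom (vscale V) Y1 c Y0 (of_int k)) (fconst v) e = 0"
    if "\<And>t::nat. e(Y1 := 0, Y0 := e Y0 - of_nat t) \<noteq> 0" for u e
  proof -
    have fc: "fconst v (e(Y1 := 0, Y0 := e Y0 - of_nat t)) = 0" for t
      using that[of t] by (simp only: fconst_def if_False)
    show ?thesis unfolding Y fc by (simp add: rat_mode_0)
  qed
  have "Ysq_series V U (\<lambda>k. fbinom (vscale V) Y1 c Y0 (of_int k)) v e = Sum_any ?f"
    unfolding Ysq_series_def flin_def fsum_def ..
  also have "\<dots> = (\<Sum>t. ?f (?g t))"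
  proof (rule Sum_any_reindex)
    show "inj ?g"
    proof (rule injI)
      fix m n assume "?g m = ?g n"
      then have "?g m Y0 = ?g n Y0" by (rule fun_cong)
      then show "m = n" by simp
    qed
  next
    fix d assume d: "d \<notin> range ?g"
    show "?f d = 0"
    proof (cases "d Y1 = 0")
      case True
      show ?thesis
      proof (rule Y1)
        fix t :: nat
        show "(e - d)(Y1 := 0, Y0 := (e - d) Y0 - of_nat t) \<noteq> 0"
        proof
          assume "(e - d)(Y1 := 0, Y0 := (e - d) Y0 - of_nat t) = 0"
          then have z: "((e - d)(Y1 := 0, Y0 := (e - d) Y0 - of_nat t)) z = 0" for z
            by (simp only: zero_fun_apply)
          have "d z = ?g t z" for z
            using z[of z] True by (cases z) auto
          then have "d = ?g t" by (rule ext)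
          then show False using d by blast
        qed
      qed
    next
      case False
      then have "U d = 0" by (rule U)
      moreover have "rat_mode (sq_mode V 0) q x = 0" for q x by (simp add: rat_mode_def)
      ultimately show ?thesis unfolding Y by simp
    qed
  qed
  also have "\<dots> = (\<Sum>t::nat. ((of_rat (e Y1 + of_nat t) gchoose t) * c ^ t) \<cdot>
      rat_mode (sq_mode V (U (?g t))) (- e Y1 - of_nat t - 1) v)"
  proof (rule Sum_any.cong)
    fix t
    let ?d = "e - ?g t"
    have dd: "?d Y1 = e Y1" "?d Y0 = of_nat t" by simp_all
    have fc: "fconst v (?d(Y1 := 0, Y0 := of_nat t - of_nat l)) = (if l = t then v else 0)" for l
    proof (cases "l = t")
      case True
      have "(?d(Y1 := 0, Y0 := of_nat t - of_nat l)) z = 0" for z using True by (cases z) simp_all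
      then have "?d(Y1 := 0, Y0 := of_nat t - of_nat l) = 0" by (simp add: fun_eq_iff)
      then show ?thesis using True by (simp only: fconst_def simp_thms if_True)
    next
      case False
      then have "(?d(Y1 := 0, Y0 := of_nat t - of_nat l)) Y0 \<noteq> 0" by simp
      then have "?d(Y1 := 0, Y0 := of_nat t - of_nat l) \<noteq> 0" by (metis zero_fun_apply)
      then show ?thesis using False by (simp only: fconst_def if_False)
    qed
    have "?f (?g t) = (\<Sum>l::nat. ((of_rat (e Y1 + of_nat l) gchoose l) * c ^ l) \<cdot>
      rat_mode (sq_mode V (U (?g t))) (- e Y1 - of_nat l - 1) (if l = t then v else 0))"
      unfolding Y dd fc ..
    also have "\<dots> = ((of_rat (e Y1 + of_nat t) gchoose t) * c ^ t) \<cdot>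
      rat_mode (sq_mode V (U (?g t))) (- e Y1 - of_nat t - 1) (if t = t then v else 0)"
      by (rule Sum_any_single) (simp add: rat_mode_0)
    finally show "?f (?g t) = ((of_rat (e Y1 + of_nat t) gchoose t) * c ^ t) \<cdot>
      rat_mode (sq_mode V (U (?g t))) (- e Y1 - of_nat t - 1) v" by simp
  qed
  finally show ?thesis .
qed

lemma inner_series:
  fixes a :: "int \<Rightarrow> 'v \<Rightarrow> 'v"
  assumes a: "\<And>n. a n 0 = 0"
  shows "fvertex a (fmono_int Y2) (Ysq V v (fmono_int Y0) (fconst b)) e =
    (if e X0 = 0 \<and> e X1 = 0 \<and> e X2 = 0 \<and> e Y1 = 0
     then rat_mode a (- e Y2 - 1) (rat_mode (sq_mode V v) (- e Y0 - 1) b) else 0)"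
proof -
  have "(\<forall>z. z \<noteq> Y2 \<and> z \<noteq> Y0 \<longrightarrow> e z = 0) \<longleftrightarrow> e X0 = 0 \<and> e X1 = 0 \<and> e X2 = 0 \<and> e Y1 = 0"
    by (metis fvar.exhaust fvar.distinct)
  then show ?thesis
    unfolding Ysq_def fvertex_fmono_int
    by (subst fvertex_fvertex_fconst) (simp_all add: rat_mode_0 a)
qed

lemma outer_series:
  fixes a :: "int \<Rightarrow> 'v \<Rightarrow> 'v"
  assumes a: "\<And>n. a n 0 = 0"
  shows "Ysq V u (\<lambda>k. fbinom (vscale V) Y1 c Y0 (of_int k)) (fvertex a (fmono_int Y2) (Ysq V v (fmono_int Y0) (fconst b))) e =
    (if e X0 = 0 \<and> e X1 = 0 \<and> e X2 = 0 then
      (\<Sum>l::nat. ((of_rat (e Y1 + of_nat l) gchoose l) * c ^ l) \<cdot> rat_mode (sq_mode V u) (- e Y1 - of_nat l - 1)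
        (rat_mode a (- e Y2 - 1) (rat_mode (sq_mode V v) (of_nat l - e Y0 - 1) b)))
     else 0)"
proof -
  let ?F = "fvertex a (fmono_int Y2) (Ysq V v (fmono_int Y0) (fconst b))"
  have F: "?F (e(Y1 := 0, Y0 := e Y0 - of_nat l)) =
    (if e X0 = 0 \<and> e X1 = 0 \<and> e X2 = 0 then rat_mode a (- e Y2 - 1) (rat_mode (sq_mode V v) (of_nat l - e Y0 - 1) b) else 0)" for l
    unfolding inner_series[of a, OF a] by (simp add: algebra_simps)
  \<comment> \<open>Expanding in powers of y raises the mode index of v with l, so truncation on b
    bounds l. The ceiling appears because the exponent of y may be any rational number.\<close>
  have fin: "finite {l::nat. rat_mode (sq_mode V v) (of_nat l - e Y0 - 1) b \<noteq> 0}"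
  proof -
    obtain N :: nat where N: "\<forall>n\<ge>int N. sq_mode V v n b = 0" using sq_mode_truncation by blast
    have "rat_mode (sq_mode V v) (of_nat l - e Y0 - 1) b = 0" if "l \<ge> N + nat (\<lceil>e Y0\<rceil> + 1)" for l
    proof -
      have "of_nat l - e Y0 - 1 \<ge> of_nat N"
      proof -
        have "int l \<ge> int N + (\<lceil>e Y0\<rceil> + 1)" using that by linarith
        then have "(of_int (int l) :: rat) \<ge> of_int (int N + (\<lceil>e Y0\<rceil> + 1))" by (simp only: of_int_le_iff)
        then have "(of_nat l :: rat) \<ge> of_nat N + of_int \<lceil>e Y0\<rceil> + 1" by simp
        then show ?thesis using le_of_int_ceiling[of "e Y0"] by linarith
      qed
      then have "\<lfloor>of_nat l - e Y0 - 1\<rfloor> \<ge> int N" by (simp only: le_floor_iff of_int_of_nat_eq)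
      then show ?thesis using N by (simp add: rat_mode_def)
    qed
    then have "{l::nat. rat_mode (sq_mode V v) (of_nat l - e Y0 - 1) b \<noteq> 0} \<subseteq> {..<N + nat (\<lceil>e Y0\<rceil> + 1)}"
      by (metis (mono_tags, lifting) lessThan_iff mem_Collect_eq not_le subsetI)
    then show ?thesis by (rule finite_subset) simp
  qed
  have "Ysq V u (\<lambda>k. fbinom (vscale V) Y1 c Y0 (of_int k)) ?F e =
    (\<Sum>l::nat. ((of_rat (e Y1 + of_nat l) gchoose l) * c ^ l) \<cdot> rat_mode (sq_mode V u) (- e Y1 - of_nat l - 1) (?F (e(Y1 := 0, Y0 := e Y0 - of_nat l))))"
    unfolding Ysq_def[of _ u]
  proof (rule fvertex_fbinom)
    show "finite {l::nat. ?F (e(Y1 := 0, Y0 := e Y0 - of_nat l)) \<noteq> 0}"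
      unfolding F using fin by (rule rev_finite_subset) (auto simp: rat_mode_0 a)
  qed (simp_all add: inner_series[of a, OF a])
  then show ?thesis
    unfolding F by (auto simp: rat_mode_0)
qed

text \<open>The X_M-factor of the first two summands; \<open>left_series\<close> is that of the last
  two. The family \<open>a\<close> is left open so that it can be the modes of a square-bracket
  operator in y_2 or in -y_2.\<close>

definition right_series :: "(int \<Rightarrow> 'v \<Rightarrow> 'v) \<Rightarrow> 'v \<Rightarrow> 'v \<Rightarrow> 'v \<Rightarrow> 'm \<Rightarrow> 'm fseries"
  where "right_series a u v b w = XM_series V M
    (Ysq V u (\<lambda>k. fbinom (vscale V) Y1 1 Y0 (of_int k)) (fvertex a (fmono_int Y2) (Ysq V v (fmono_int Y0) (fconst b))))
    expP (fconst w)"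

definition left_series :: "(int \<Rightarrow> 'v \<Rightarrow> 'v) \<Rightarrow> 'v \<Rightarrow> 'v \<Rightarrow> 'v \<Rightarrow> 'm \<Rightarrow> 'm fseries"
  where "left_series a u v b w = XM_series V M
    (Ysq_series V (fvertex a (fmono_int Y2) (Ysq V u (fmono_int Y0) (fconst b))) (\<lambda>k. fbinom (vscale V) Y1 (-1) Y0 (of_int k)) v)
    (fmono X1) (fconst w)"

lemma right_series_eval:
  assumes a: "\<And>n. a n 0 = 0"
  shows "right_series a u v b w e = (if e X0 = 0 \<and> e X2 = 0 then
      (\<Sum>n::nat. ((- of_rat (e X1)) ^ n / fact n) \<odot> xmode (e X1)
        (\<Sum>l::nat. ((of_rat (e Y1 + of_nat l) gchoose l) * 1 ^ l) \<cdot> rat_mode (sq_mode V u) (- e Y1 - of_nat l - 1)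
          (rat_mode a (- e Y2 - 1) (rat_mode (sq_mode V v) (of_nat l - (e Y0 - of_nat n) - 1) b))) w)
    else 0)"
proof -
  let ?W = "Ysq V u (\<lambda>k. fbinom (vscale V) Y1 1 Y0 (of_int k)) (fvertex a (fmono_int Y2) (Ysq V v (fmono_int Y0) (fconst b)))"
  have W0: "?W d = 0" if "d X0 \<noteq> 0 \<or> d X1 \<noteq> 0 \<or> d X2 \<noteq> 0" for d
    using that unfolding outer_series[of a, OF a] by auto
  have X: "XM_series V M ?W expP (fconst w) e =
    (if e X0 = 0 \<and> e X2 = 0 then
      (\<Sum>n::nat. ((- of_rat (e X1)) ^ n / fact n) \<odot> xmode (e X1) (?W (e(X1 := 0, Y0 := e Y0 - of_nat n))) w)
     else 0)"
    by (rule XM_series_expP) (erule W0)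
  show ?thesis
  proof (cases "e X0 = 0 \<and> e X2 = 0")
    case True
    have "?W (e(X1 := 0, Y0 := e Y0 - of_nat n)) =
      (\<Sum>l::nat. ((of_rat (e Y1 + of_nat l) gchoose l) * 1 ^ l) \<cdot> rat_mode (sq_mode V u) (- e Y1 - of_nat l - 1)
          (rat_mode a (- e Y2 - 1) (rat_mode (sq_mode V v) (of_nat l - (e Y0 - of_nat n) - 1) b)))" for n :: nat
    proof -
      let ?e = "e(X1 := 0, Y0 := e Y0 - of_nat n)"
      have c: "?e X0 = 0 \<and> ?e X1 = 0 \<and> ?e X2 = 0" using True by simp
      have v: "?e Y1 = e Y1" "?e Y2 = e Y2" "?e Y0 = e Y0 - of_nat n" by simp_all
      show ?thesis unfolding outer_series[of a, OF a] if_P[OF c] unfolding v ..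
    qed
    then show ?thesis unfolding right_series_def X by (simp only:)
  next
    case False
    then show ?thesis unfolding right_series_def X by (simp only: if_False)
  qed
qed

lemma left_series_eval:
  assumes a: "\<And>n. a n 0 = 0"
  shows "left_series a u v b w e = (if e X0 = 0 \<and> e X2 = 0 then xmode (e X1)
      (\<Sum>t::nat. ((of_rat (e Y1 + of_nat t) gchoose t) * (-1) ^ t) \<cdot>
        rat_mode (sq_mode V (rat_mode a (- e Y2 - 1) (rat_mode (sq_mode V u) (- (e Y0 - of_nat t) - 1) b))) (- e Y1 - of_nat t - 1) v) w
    else 0)"
proof -
  let ?U = "fvertex a (fmono_int Y2) (Ysq V u (fmono_int Y0) (fconst b))"
  let ?F = "Ysq_series V ?U (\<lambda>k. fbinom (vscale V) Y1 (-1) Y0 (of_int k)) v"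
  have U1: "?U d = 0" if "d Y1 \<noteq> 0" for d
    unfolding inner_series[of a, OF a] using that by simp
  have sq0: "rat_mode (sq_mode V 0) q x = 0" for q x by (simp add: rat_mode_def)
  have U: "?U (d(Y1 := 0, Y0 := d Y0 - of_nat t)) = (if d X0 = 0 \<and> d X1 = 0 \<and> d X2 = 0 then
      rat_mode a (- d Y2 - 1) (rat_mode (sq_mode V u) (- (d Y0 - of_nat t) - 1) b) else 0)" for d and t :: nat
    unfolding inner_series[of a, OF a] by simp
  have Y: "?F d = (\<Sum>t::nat. ((of_rat (d Y1 + of_nat t) gchoose t) * (-1) ^ t) \<cdot>
      rat_mode (sq_mode V (?U (d(Y1 := 0, Y0 := d Y0 - of_nat t)))) (- d Y1 - of_nat t - 1) v)" for d
    by (rule Ysq_series_eval) (erule U1)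
  have F: "?F d = (if d X0 = 0 \<and> d X1 = 0 \<and> d X2 = 0 then
      (\<Sum>t::nat. ((of_rat (d Y1 + of_nat t) gchoose t) * (-1) ^ t) \<cdot>
        rat_mode (sq_mode V (rat_mode a (- d Y2 - 1) (rat_mode (sq_mode V u) (- (d Y0 - of_nat t) - 1) b))) (- d Y1 - of_nat t - 1) v)
      else 0)" for d
  proof (cases "d X0 = 0 \<and> d X1 = 0 \<and> d X2 = 0")
    case True
    show ?thesis unfolding Y U if_P[OF True] ..
  next
    case False
    show ?thesis unfolding Y U if_not_P[OF False] sq0 by simp
  qed
  have F1: "?F d = 0" if "d X1 \<noteq> 0" for d
    unfolding F using that by simp
  have X: "XM_series V M ?F (fmono X1) (fconst w) e = xmode (e X1) (?F (e(X1 := 0))) w"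
    by (rule XM_series_fmono) (erule F1)
  let ?e = "e(X1 := 0)"
  have v: "?e Y1 = e Y1" "?e Y2 = e Y2" "?e Y0 = e Y0" "?e X0 = e X0" "?e X2 = e X2" "?e X1 = 0" by simp_all
  show ?thesis
    unfolding left_series_def X unfolding F v by simp
qed

text \<open>Upper negation at the exponent -i-1 of y_1. The sign survives for y_1 + y and cancels
  for y_1 - y, as in the alternating and plain sums of the four-term expansion.\<close>

lemma gbinomial_shift:
  "of_rat (- of_int i - 1 + of_nat l) gchoose l = (-1) ^ l * (of_int i gchoose l :: complex)"
proof -
  have eq: "of_rat (- of_int i - 1 + of_nat l) = (of_nat l - of_int i - 1 :: complex)"
    by (simp add: of_rat_add of_rat_diff of_rat_minus)
  have "(-1) ^ l * (of_int i gchoose l) = ((-1) ^ l * (-1) ^ l) * (of_nat l - of_int i - 1 gchoose l :: complex)"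
    by (subst gbinomial_negated_upper) (simp only: mult.assoc)
  also have "(-1) ^ l * (-1) ^ l = (1 :: complex)" by (simp flip: power_mult_distrib)
  finally show ?thesis unfolding eq by simp
qed

text \<open>The exponent of y is -1 - m because the residue asks for y^(-1) while the exponential in
  the delta function supplies y^m.\<close>

lemma right_series_int:
  assumes a: "\<And>n. a n 0 = 0" and e: "e X0 = 0" "e X2 = 0" "e X1 = \<gamma>"
    "e Y1 = - of_int i - 1" "e Y2 = - of_int j - 1" "e Y0 = - 1 - of_nat m"
  shows "right_series a u v b w e = (\<Sum>n::nat. ((- of_rat \<gamma>) ^ n / fact n) \<odot> xmode \<gamma>
    (\<Sum>l::nat. ((-1) ^ l * (of_int i gchoose l)) \<cdot> sq_mode V u (i - int l) (a j (sq_mode V v (int (m + n + l)) b))) w)"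
proof -
  have c: "e X0 = 0 \<and> e X2 = 0" using e by simp
  have i: "- e Y1 - of_nat l - 1 = of_int (i - int l)" for l by (simp add: e)
  have j: "- e Y2 - 1 = of_int j" by (simp add: e)
  have k: "of_nat l - (e Y0 - of_nat n) - 1 = of_int (int (m + n + l))" for l n by (simp add: e)
  have g: "of_rat (e Y1 + of_nat l) gchoose l = (-1) ^ l * (of_int i gchoose l :: complex)" for l
    unfolding e by (rule gbinomial_shift)
  show ?thesis
    unfolding right_series_eval[of a, OF a] if_P[OF c] i j k g rat_mode_of_int e(3) by simp
qed

lemma left_series_int:
  assumes a: "\<And>n. a n 0 = 0" and e: "e X0 = 0" "e X2 = 0" "e X1 = \<gamma>"
    "e Y1 = - of_int i - 1" "e Y2 = - of_int j - 1" "e Y0 = - 1 - of_nat n"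
  shows "left_series a u v b w e = xmode \<gamma>
    (\<Sum>l::nat. (of_int i gchoose l) \<cdot> sq_mode V (a j (sq_mode V u (int (n + l)) b)) (i - int l) v) w"
proof -
  have c: "e X0 = 0 \<and> e X2 = 0" using e by simp
  have i: "- e Y1 - of_nat l - 1 = of_int (i - int l)" for l by (simp add: e)
  have j: "- e Y2 - 1 = of_int j" by (simp add: e)
  have k: "- (e Y0 - of_nat l) - 1 = of_int (int (n + l))" for l by (simp add: e)
  have g: "(of_rat (e Y1 + of_nat l) gchoose l) * (-1) ^ l = (of_int i gchoose l :: complex)" for l
    unfolding e gbinomial_shift by (simp flip: power_mult_distrib)
  show ?thesis
    unfolding left_series_eval[of a, OF a] if_P[OF c] i j k g rat_mode_of_int e(3) ..
qed

text \<open>Series are indexed by all rational exponents; this confines the support to the exponents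
  treated in \<open>right_series_int\<close>, up to the exponent of y.\<close>

lemma right_series_eq_0:
  assumes a: "\<And>n. a n 0 = 0" and e: "e X0 \<noteq> 0 \<or> e X2 \<noteq> 0 \<or> of_nat p * e X1 \<notin> \<int> \<or> e Y1 \<notin> \<int> \<or> e Y2 \<notin> \<int>"
  shows "right_series a u v b w e = 0"
proof (cases "e X0 = 0 \<and> e X2 = 0")
  case True
  have i: "rat_mode (sq_mode V u) (- e Y1 - of_nat l - 1) x = 0" if "e Y1 \<notin> \<int>" for l x
  proof -
    have "- e Y1 - of_nat l - 1 \<notin> \<int>"
    proof
      assume "- e Y1 - of_nat l - 1 \<in> \<int>"
      then have "- (- e Y1 - of_nat l - 1) - of_nat l - 1 \<in> \<int>" by (intro Ints_diff Ints_minus) auto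
      then show False using that by simp
    qed
    then show ?thesis by (simp add: rat_mode_def)
  qed
  have j: "rat_mode a (- e Y2 - 1) x = 0" if "e Y2 \<notin> \<int>" for x
  proof -
    have "- e Y2 - 1 \<notin> \<int>"
    proof
      assume "- e Y2 - 1 \<in> \<int>"
      then have "- (- e Y2 - 1) - 1 \<in> \<int>" by (intro Ints_diff Ints_minus) auto
      then show False using that by simp
    qed
    then show ?thesis by (simp add: rat_mode_def)
  qed
  have "rat_mode (sq_mode V u) (- e Y1 - of_nat l - 1) (rat_mode a (- e Y2 - 1) x) = 0"
    if "e Y1 \<notin> \<int> \<or> e Y2 \<notin> \<int>" for l x
    using that i j by (auto simp: rat_mode_0)
  moreover have "xmode (e X1) x w = 0" if "of_nat p * e X1 \<notin> \<int>" for x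
    using that by (rule xmode_fractional)
  ultimately show ?thesis
    unfolding right_series_eval[of a, OF a] using e True by (auto simp: rat_mode_0)
next
  case False
  show ?thesis unfolding right_series_eval[of a, OF a] if_not_P[OF False] ..
qed

lemma left_series_eq_0:
  assumes a: "\<And>n. a n 0 = 0" and e: "e X0 \<noteq> 0 \<or> e X2 \<noteq> 0 \<or> of_nat p * e X1 \<notin> \<int> \<or> e Y1 \<notin> \<int> \<or> e Y2 \<notin> \<int>"
  shows "left_series a u v b w e = 0"
proof (cases "e X0 = 0 \<and> e X2 = 0")
  case True
  have i: "rat_mode (sq_mode V y) (- e Y1 - of_nat l - 1) x = 0" if "e Y1 \<notin> \<int>" for l x y
  proof -
    have "- e Y1 - of_nat l - 1 \<notin> \<int>"
    proof
      assume "- e Y1 - of_nat l - 1 \<in> \<int>"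
      then have "- (- e Y1 - of_nat l - 1) - of_nat l - 1 \<in> \<int>" by (intro Ints_diff Ints_minus) auto
      then show False using that by simp
    qed
    then show ?thesis by (simp add: rat_mode_def)
  qed
  have j: "rat_mode a (- e Y2 - 1) x = 0" if "e Y2 \<notin> \<int>" for x
  proof -
    have "- e Y2 - 1 \<notin> \<int>"
    proof
      assume "- e Y2 - 1 \<in> \<int>"
      then have "- (- e Y2 - 1) - 1 \<in> \<int>" by (intro Ints_diff Ints_minus) auto
      then show False using that by simp
    qed
    then show ?thesis by (simp add: rat_mode_def)
  qed
  have sq0: "rat_mode (sq_mode V 0) q x = 0" for q x by (simp add: rat_mode_def)
  have "rat_mode (sq_mode V (rat_mode a (- e Y2 - 1) x)) (- e Y1 - of_nat l - 1) y = 0"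
    if "e Y1 \<notin> \<int> \<or> e Y2 \<notin> \<int>" for l x y
    using that i j sq0 by auto
  moreover have "xmode (e X1) x w = 0" if "of_nat p * e X1 \<notin> \<int>" for x
    using that by (rule xmode_fractional)
  ultimately show ?thesis
    unfolding left_series_eval[of a, OF a] using e True by auto
next
  case False
  show ?thesis unfolding left_series_eval[of a, OF a] if_not_P[OF False] ..
qed

lemma XM_series_product:
  assumes "\<And>n. a n 0 = 0" "\<And>n. b n 0 = 0" "x \<noteq> y" "x \<noteq> z" "x \<noteq> t" "y \<noteq> z" "y \<noteq> t" "z \<noteq> t"
  shows "XM_series V M (fvertex a (fmono_int z) (fconst u)) (fmono x)
      (XM_series V M (fvertex b (fmono_int t) (fconst v)) (fmono y) (fconst w)) e =
    (if \<forall>s. s \<notin> {x, y, z, t} \<longrightarrow> e s = 0 then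
      xmode (e x) (rat_mode a (- e z - 1) u) (xmode (e y) (rat_mode b (- e t - 1) v) w) else 0)"
proof -
  have F: "fvertex a (fmono_int z) (fconst u) d = (if \<forall>s. s \<noteq> z \<longrightarrow> d s = 0 then rat_mode a (- d z - 1) u else 0)"
    if "\<And>n. a n 0 = 0" for a u z d
    unfolding fvertex_fmono_int using that by (simp add: fvertex_fmono_fconst rat_mode_0)
  let ?G = "XM_series V M (fvertex b (fmono_int t) (fconst v)) (fmono y) (fconst w)"
  have G: "?G e = (if \<forall>s. s \<noteq> y \<and> s \<noteq> t \<longrightarrow> e s = 0 then xmode (e y) (rat_mode b (- e t - 1) v) w else 0)" for e
  proof -
    have "?G e = xmode (e y) (rat_mode b (- e t - 1) v) (fconst w (e(y := 0, t := 0)))"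
    proof (rule XM_series_single[where f = "\<lambda>q. rat_mode b (- q - 1) v"])
      show "fconst w e = 0" if "e y \<noteq> 0 \<or> e t \<noteq> 0" for e
        using that by (auto simp: fconst_def)
    qed (use F[of b, OF assms(2)] assms in auto)
    moreover have "e(y := 0, t := 0) = 0 \<longleftrightarrow> (\<forall>s. s \<noteq> y \<and> s \<noteq> t \<longrightarrow> e s = 0)"
      by (auto simp: fun_eq_iff)
    then have "fconst w (e(y := 0, t := 0)) = (if \<forall>s. s \<noteq> y \<and> s \<noteq> t \<longrightarrow> e s = 0 then w else 0)"
      by (simp only: fconst_def)
    ultimately show ?thesis by (simp only: xmode_0_right if_distrib[of "xmode _ _"])
  qed
  have "XM_series V M (fvertex a (fmono_int z) (fconst u)) (fmono x) ?G e =
    xmode (e x) (rat_mode a (- e z - 1) u) (?G (e(x := 0, z := 0)))"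
  proof (rule XM_series_single[where f = "\<lambda>q. rat_mode a (- q - 1) u"])
    show "?G e = 0" if "e x \<noteq> 0 \<or> e z \<noteq> 0" for e
    proof -
      have "x \<noteq> y \<and> x \<noteq> t \<and> z \<noteq> y \<and> z \<noteq> t" using assms by auto
      then have "\<not> (\<forall>s. s \<noteq> y \<and> s \<noteq> t \<longrightarrow> e s = 0)" using that by metis
      then show ?thesis unfolding G by (rule if_not_P)
    qed
  qed (use F[of a, OF assms(1)] assms in auto)
  also have "?G (e(x := 0, z := 0)) = (if \<forall>s. s \<notin> {x, y, z, t} \<longrightarrow> e s = 0 then xmode (e y) (rat_mode b (- e t - 1) v) w else 0)"
  proof -
    have 1: "(\<forall>s. s \<noteq> y \<and> s \<noteq> t \<longrightarrow> (e(x := 0, z := 0)) s = 0) \<longleftrightarrow> (\<forall>s. s \<notin> {x, y, z, t} \<longrightarrow> e s = 0)"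
      by auto
    have 2: "(e(x := 0, z := 0)) y = e y" "(e(x := 0, z := 0)) t = e t" using assms by simp_all
    show ?thesis unfolding G 1 2 ..
  qed
  finally show ?thesis by (simp only: xmode_0_right if_distrib[of "xmode _ _"])
qed

section \<open>The delta functions of the four summands\<close>

abbreviation delta1 :: "rat \<Rightarrow> 'm fseries \<Rightarrow> 'm fseries"
  where "delta1 \<equiv> \<lambda>q F. fexp (mscale M) (- q) Y2 (fexp (mscale M) (- q) Y0 (fmono X1 q (fmono X2 (- q) F)))"

abbreviation delta2 :: "rat \<Rightarrow> 'm fseries \<Rightarrow> 'm fseries"
  where "delta2 \<equiv> \<lambda>q F. fexp (mscale M) (- q) Y0 (fmono X1 q (fmono X2 (- q) F))"

abbreviation delta3 :: "rat \<Rightarrow> 'm fseries \<Rightarrow> 'm fseries"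
  where "delta3 \<equiv> \<lambda>q F. fexp (mscale M) q Y1 (fexp (mscale M) (- q) Y2 (fexp (mscale M) (- q) Y0 (fmono X1 q (fmono X2 (- q) F))))"

abbreviation delta4 :: "rat \<Rightarrow> 'm fseries \<Rightarrow> 'm fseries"
  where "delta4 \<equiv> \<lambda>q F. fexp (mscale M) q Y1 (fexp (mscale M) (- q) Y0 (fmono X1 q (fmono X2 (- q) F)))"

text \<open>Each expression multiplies by x_1^q x_2^(-q) and by nonnegative powers of the
  y-variables. The exponent of y is left free, since in the applications the reason for vanishing
  never depends on it.\<close>

lemma delta_eq_0:
  assumes "\<And>(n::nat) (m::nat) a. F (e(X1 := e X1 - q, X2 := e X2 + q, Y1 := e Y1 - of_nat n, Y2 := e Y2 - of_nat m, Y0 := a)) = 0"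
  shows "delta1 q F e = 0" "delta2 q F e = 0" "delta3 q F e = 0" "delta4 q F e = 0"
proof -
  let ?x = "\<lambda>e. e(X1 := e X1 - q, X2 := e X2 + q)"
  have 0: "fmono X1 q (fmono X2 (- q) F) e = F (?x e)" for e
    by (simp add: fmono_def)
  have F: "F e' = 0" if "e' X0 = e X0" "e' X1 = e X1 - q" "e' X2 = e X2 + q" "e' Y1 = e Y1 - of_nat n" "e' Y2 = e Y2 - of_nat m"
    for e' and n m :: nat
  proof -
    have "e' z = (e(X1 := e X1 - q, X2 := e X2 + q, Y1 := e Y1 - of_nat n, Y2 := e Y2 - of_nat m, Y0 := e' Y0)) z" for z
      using that by (cases z) simp_all
    then have "e' = e(X1 := e X1 - q, X2 := e X2 + q, Y1 := e Y1 - of_nat n, Y2 := e Y2 - of_nat m, Y0 := e' Y0)"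
      by (rule ext)
    then show ?thesis using assms by metis
  qed
  have 1: "F (?x (e(Y2 := e Y2 - of_nat m, Y0 := a))) = 0" "F (?x (e(Y0 := a))) = 0"
     "F (?x (e(Y1 := e Y1 - of_nat n, Y2 := e Y2 - of_nat m, Y0 := a))) = 0" "F (?x (e(Y1 := e Y1 - of_nat n, Y0 := a))) = 0"
    for n m :: nat and a
    by (rule F[of _ 0 m] F[of _ 0 0] F[of _ n m] F[of _ n 0]; simp)+
  show "delta1 q F e = 0" "delta2 q F e = 0" "delta3 q F e = 0" "delta4 q F e = 0"
    unfolding fexp_eval 0 by (simp_all add: 1[simplified])
qed

text \<open>The delta function depends on x_1 / x_2 and has to supply the whole power of x_2, so X_M
  receives the sum of the two exponents. This explains the condition on
  \<open>e X1 + e X2\<close>.\<close>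

lemma fdelta_terms_eq_0:
  assumes p: "p > 0"
    and F: "\<And>e. e X0 \<noteq> 0 \<or> e X2 \<noteq> 0 \<or> of_nat p * e X1 \<notin> \<int> \<or> e Y1 \<notin> \<int> \<or> e Y2 \<notin> \<int> \<Longrightarrow> F e = 0"
    and e: "e X0 \<noteq> 0 \<or> of_nat p * e X2 \<notin> \<int> \<or> of_nat p * (e X1 + e X2) \<notin> \<int> \<or> e Y1 \<notin> \<int> \<or> e Y2 \<notin> \<int>"
  shows "fdelta (mscale M) c p delta1 F e = 0" "fdelta (mscale M) c p delta2 F e = 0"
    "fdelta (mscale M) c p delta3 F e = 0" "fdelta (mscale M) c p delta4 F e = 0"
proof -
  let ?e = "\<lambda>q n m a. e(X1 := e X1 - q, X2 := e X2 + q, Y1 := e Y1 - of_nat n, Y2 := e Y2 - of_nat m, Y0 := a)"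
  have q0: "F (?e q n m a) = 0" if "q \<noteq> - e X2" for q a and n m :: nat
    using that by (intro F) (simp add: add_eq_0_iff2)
  have shift: "y - of_nat n \<notin> \<int>" if "y \<notin> \<int>" for y :: rat and n :: nat
  proof
    assume "y - of_nat n \<in> \<int>"
    then have "(y - of_nat n) + of_nat n \<in> \<int>" by (intro Ints_add) auto
    then show False using that by simp
  qed
  have zero: "fdelta (mscale M) c p P F e = 0"
    if P: "\<And>q. (\<And>(n::nat) (m::nat) a. F (?e q n m a) = 0) \<Longrightarrow> P q F e = 0" for P
  proof (cases "of_nat p * e X2 \<in> \<int>")
    case True
    have "F (?e q n m a) = 0" for q a and n m :: nat
    proof (cases "q = - e X2")
      case True
      show ?thesis
        using e \<open>of_nat p * e X2 \<in> \<int>\<close> by (intro F) (auto simp: True intro: shift)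
    next
      case False
      then show ?thesis by (rule q0)
    qed
    then have "P q F e = 0" for q by (rule P)
    then show ?thesis by (simp add: fdelta_def fsum_def fscale_def)
  next
    case False
    have "P q F e = 0" if "q \<noteq> - e X2" for q
      using that by (intro P q0)
    then show ?thesis using p False by (rule mod.fdelta_eq_0)
  qed
  show "fdelta (mscale M) c p delta1 F e = 0" "fdelta (mscale M) c p delta2 F e = 0"
    "fdelta (mscale M) c p delta3 F e = 0" "fdelta (mscale M) c p delta4 F e = 0"
    by (rule zero, erule delta_eq_0)+
qed

lemma fdelta_terms_eval:
  assumes p: "p > 0" and k: "of_nat p * e X2 = of_int \<kappa>" and F: "\<And>e. e X2 \<noteq> 0 \<Longrightarrow> F e = 0"
  shows "fdelta (mscale M) c p delta1 F e = (c powi (- \<kappa>)) \<odot> delta1 (- e X2) F e"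
    "fdelta (mscale M) c p delta2 F e = (c powi (- \<kappa>)) \<odot> delta2 (- e X2) F e"
    "fdelta (mscale M) c p delta3 F e = (c powi (- \<kappa>)) \<odot> delta3 (- e X2) F e"
    "fdelta (mscale M) c p delta4 F e = (c powi (- \<kappa>)) \<odot> delta4 (- e X2) F e"
proof -
  have q0: "F (e(X1 := e X1 - q, X2 := e X2 + q, Y1 := e Y1 - of_nat n, Y2 := e Y2 - of_nat m, Y0 := a)) = 0"
    if "q \<noteq> - e X2" for q a and n m :: nat
    using that by (intro F) (simp add: add_eq_0_iff2)
  have eval: "fdelta (mscale M) c p P F e = (c powi (- \<kappa>)) \<odot> P (- e X2) F e"
    if P: "\<And>q. (\<And>(n::nat) (m::nat) a. F (e(X1 := e X1 - q, X2 := e X2 + q, Y1 := e Y1 - of_nat n, Y2 := e Y2 - of_nat m, Y0 := a)) = 0) \<Longrightarrow> P q F e = 0"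
    for P
  proof (rule mod.fdelta_eval)
    show "P q F e = 0" if "q \<noteq> - e X2" for q
      using that by (intro P q0)
  qed (rule p, rule k)
  show "fdelta (mscale M) c p delta1 F e = (c powi (- \<kappa>)) \<odot> delta1 (- e X2) F e"
    "fdelta (mscale M) c p delta2 F e = (c powi (- \<kappa>)) \<odot> delta2 (- e X2) F e"
    "fdelta (mscale M) c p delta3 F e = (c powi (- \<kappa>)) \<odot> delta3 (- e X2) F e"
    "fdelta (mscale M) c p delta4 F e = (c powi (- \<kappa>)) \<odot> delta4 (- e X2) F e"
    by (rule eval, erule delta_eq_0)+
qed

text \<open>The modes of \<open>Y[v, - y]\<close>.\<close>

definition neg_sq_mode :: "'v \<Rightarrow> int \<Rightarrow> 'v \<Rightarrow> 'v"
  where "neg_sq_mode v n x = (-1) powi (- n - 1) \<cdot> sq_mode V v n x"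

lemma neg_sq_mode_0 [simp]: "neg_sq_mode v n 0 = 0"
  by (simp add: neg_sq_mode_def)

lemma neg_sq_mode_shift:
  "neg_sq_mode v (j + int q) x = (-1) powi (j + 1 + int q) \<cdot> sq_mode V v (j + int q) x"
proof -
  have "(-1) powi (- (j + int q) - 1) = ((-1) powi (j + 1 + int q) :: complex)"
    by (simp add: power_int_minus_left)
  then show ?thesis by (simp only: neg_sq_mode_def)
qed

lemma Ysq_minus:
  "Ysq V v (\<lambda>k F. fscale (vscale V) ((-1) powi k) (fmono_int Y2 k F)) G = fvertex (neg_sq_mode v) (fmono_int Y2) G"
  unfolding Ysq_def fvertex_def neg_sq_mode_def fscale_def fmono_int_def fmono_def ..

text \<open>The theorem for one fixed r, before averaging and without automorphisms: every
  exponential in a delta function becomes an exponential sum in \<beta>, the exponent of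
  x_2.\<close>

lemma fdelta_terms_sum:
  assumes p: "p > 0" and k: "of_nat p * e X2 = of_int \<kappa>"
    and e: "e X0 = 0" "e Y0 = - 1" "e Y1 = - of_int i - 1" "e Y2 = - of_int j - 1"
  shows "fdelta (mscale M) c p delta1 (right_series (neg_sq_mode v2) u1 v1 u2 w) e
    + fdelta (mscale M) c p delta2 (right_series (sq_mode V u2) u1 v1 v2 w) e
    + fdelta (mscale M) c p delta3 (left_series (neg_sq_mode v2) u1 v1 u2 w) e
    + fdelta (mscale M) c p delta4 (left_series (sq_mode V u2) u1 v1 v2 w) e
    = (c powi (- \<kappa>)) \<odot> xmode (e X1 + e X2) (sq_psi (- of_rat (e X1)) (sq_mode V u1 i v1) (sq_mode V u2 j v2)) w"
proof -
  define \<beta> where "\<beta> = e X2"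
  define \<gamma> where "\<gamma> = e X1 + e X2"
  let ?x = "\<lambda>e. e(X1 := e X1 + \<beta>, X2 := 0)"
  have 0: "fmono X1 (- \<beta>) (fmono X2 \<beta> F) e' = F (?x e')" if "e' X2 = \<beta>" for F :: "'m fseries" and e'
    using that by (simp add: fmono_def)
  have right: "right_series a u1 v1 b w e' = (\<Sum>n::nat. ((- of_rat \<gamma>) ^ n / fact n) \<odot> xmode \<gamma>
    (\<Sum>l::nat. ((-1) ^ l * (of_int i gchoose l)) \<cdot> sq_mode V u1 (i - int l) (a (j + int q) (sq_mode V v1 (int (m + n + l)) b))) w)"
    if "\<And>n. a n 0 = 0" "e' X0 = 0" "e' X2 = 0" "e' X1 = \<gamma>" "e' Y1 = e Y1" "e' Y2 = e Y2 - of_nat q" "e' Y0 = e Y0 - of_nat m"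
    for a b e' and q m :: nat
    by (rule right_series_int) (use that e in auto)
  have left: "left_series a u1 v1 b w e' = xmode \<gamma>
    (\<Sum>t::nat. (of_int (i + int l) gchoose t) \<cdot> sq_mode V (a (j + int q) (sq_mode V u1 (int (n + t)) b)) (i + int l - int t) v1) w"
    if "\<And>n. a n 0 = 0" "e' X0 = 0" "e' X2 = 0" "e' X1 = \<gamma>" "e' Y1 = e Y1 - of_nat l" "e' Y2 = e Y2 - of_nat q" "e' Y0 = e Y0 - of_nat n"
    for a b e' and q n l :: nat
    by (rule left_series_int) (use that e in auto)
  have rX2: "right_series a u v b w e' = 0" "left_series a u v b w e' = 0" if "\<And>n. a n 0 = 0" "e' X2 \<noteq> 0" for a u v b e'
    using right_series_eq_0[of a e' u v b w] left_series_eq_0[of a e' u v b w] that by auto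
  let ?b = "of_rat \<beta> :: complex" and ?c = "of_rat \<gamma> :: complex"
  have E: "fdelta (mscale M) c p delta1 F e = (c powi (- \<kappa>)) \<odot> delta1 (- \<beta>) F e"
    "fdelta (mscale M) c p delta2 F e = (c powi (- \<kappa>)) \<odot> delta2 (- \<beta>) F e"
    "fdelta (mscale M) c p delta3 F e = (c powi (- \<kappa>)) \<odot> delta3 (- \<beta>) F e"
    "fdelta (mscale M) c p delta4 F e = (c powi (- \<kappa>)) \<odot> delta4 (- \<beta>) F e"
    if "\<And>e. e X2 \<noteq> 0 \<Longrightarrow> F e = 0" for F
    unfolding \<beta>_def by (rule fdelta_terms_eval[where e = e and \<kappa> = \<kappa>]; (rule p k | erule that))+
  have t1: "fdelta (mscale M) c p delta1 (right_series (neg_sq_mode v2) u1 v1 u2 w) e = (c powi (- \<kappa>)) \<odot>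
    (\<Sum>q::nat. (?b ^ q / fact q) \<odot> (\<Sum>m::nat. (?b ^ m / fact m) \<odot> (\<Sum>n::nat. ((- ?c) ^ n / fact n) \<odot> xmode \<gamma>
      (\<Sum>l::nat. ((-1) ^ l * (of_int i gchoose l)) \<cdot> sq_mode V u1 (i - int l)
        ((-1) powi (j + 1 + int q) \<cdot> sq_mode V v2 (j + int q) (sq_mode V v1 (int (m + n + l)) u2))) w)))"
  proof -
    have "right_series (neg_sq_mode v2) u1 v1 u2 w (?x (e(Y2 := e Y2 - of_nat q, Y0 := e Y0 - of_nat m))) =
      (\<Sum>n::nat. ((- ?c) ^ n / fact n) \<odot> xmode \<gamma> (\<Sum>l::nat. ((-1) ^ l * (of_int i gchoose l)) \<cdot> sq_mode V u1 (i - int l)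
        (neg_sq_mode v2 (j + int q) (sq_mode V v1 (int (m + n + l)) u2))) w)" for q m :: nat
      by (rule right) (simp_all add: e \<gamma>_def \<beta>_def)
    moreover have "fdelta (mscale M) c p delta1 (right_series (neg_sq_mode v2) u1 v1 u2 w) e = (c powi (- \<kappa>)) \<odot> delta1 (- \<beta>) (right_series (neg_sq_mode v2) u1 v1 u2 w) e"
      by (rule E, rule rX2) simp_all
    ultimately show ?thesis
      unfolding fexp_eval minus_minus by (simp add: 0 \<beta>_def[symmetric] neg_sq_mode_shift)
  qed
  have t2: "fdelta (mscale M) c p delta2 (right_series (sq_mode V u2) u1 v1 v2 w) e = (c powi (- \<kappa>)) \<odot>
    (\<Sum>m::nat. (?b ^ m / fact m) \<odot> (\<Sum>n::nat. ((- ?c) ^ n / fact n) \<odot> xmode \<gamma>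
      (\<Sum>l::nat. ((-1) ^ l * (of_int i gchoose l)) \<cdot> sq_mode V u1 (i - int l)
        (sq_mode V u2 j (sq_mode V v1 (int (m + n + l)) v2))) w))"
  proof -
    have "right_series (sq_mode V u2) u1 v1 v2 w (?x (e(Y0 := e Y0 - of_nat m))) =
      (\<Sum>n::nat. ((- ?c) ^ n / fact n) \<odot> xmode \<gamma> (\<Sum>l::nat. ((-1) ^ l * (of_int i gchoose l)) \<cdot> sq_mode V u1 (i - int l)
        (sq_mode V u2 (j + int 0) (sq_mode V v1 (int (m + n + l)) v2))) w)" for m :: nat
      by (rule right) (simp_all add: e \<gamma>_def \<beta>_def)
    moreover have "fdelta (mscale M) c p delta2 (right_series (sq_mode V u2) u1 v1 v2 w) e = (c powi (- \<kappa>)) \<odot> delta2 (- \<beta>) (right_series (sq_mode V u2) u1 v1 v2 w) e"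
      by (rule E, rule rX2) simp_all
    ultimately show ?thesis
      unfolding fexp_eval minus_minus by (simp add: 0 \<beta>_def[symmetric])
  qed
  have t3: "fdelta (mscale M) c p delta3 (left_series (neg_sq_mode v2) u1 v1 u2 w) e = (c powi (- \<kappa>)) \<odot>
    (\<Sum>l::nat. ((- ?b) ^ l / fact l) \<odot> (\<Sum>q::nat. (?b ^ q / fact q) \<odot> (\<Sum>n::nat. (?b ^ n / fact n) \<odot> xmode \<gamma>
      (\<Sum>t::nat. (of_int (i + int l) gchoose t) \<cdot> sq_mode V
        ((-1) powi (j + 1 + int q) \<cdot> sq_mode V v2 (j + int q) (sq_mode V u1 (int (n + t)) u2)) (i + int l - int t) v1) w)))"
  proof -
    have "left_series (neg_sq_mode v2) u1 v1 u2 w (?x (e(Y1 := e Y1 - of_nat l, Y2 := e Y2 - of_nat q, Y0 := e Y0 - of_nat n))) =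
      xmode \<gamma> (\<Sum>t::nat. (of_int (i + int l) gchoose t) \<cdot> sq_mode V
        (neg_sq_mode v2 (j + int q) (sq_mode V u1 (int (n + t)) u2)) (i + int l - int t) v1) w" for q n l :: nat
      by (rule left) (simp_all add: e \<gamma>_def \<beta>_def)
    moreover have "fdelta (mscale M) c p delta3 (left_series (neg_sq_mode v2) u1 v1 u2 w) e = (c powi (- \<kappa>)) \<odot> delta3 (- \<beta>) (left_series (neg_sq_mode v2) u1 v1 u2 w) e"
      by (rule E, rule rX2) simp_all
    ultimately show ?thesis
      unfolding fexp_eval minus_minus by (simp add: 0 \<beta>_def[symmetric] neg_sq_mode_shift of_rat_minus)
  qed
  have t4: "fdelta (mscale M) c p delta4 (left_series (sq_mode V u2) u1 v1 v2 w) e = (c powi (- \<kappa>)) \<odot>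
    (\<Sum>l::nat. ((- ?b) ^ l / fact l) \<odot> (\<Sum>n::nat. (?b ^ n / fact n) \<odot> xmode \<gamma>
      (\<Sum>t::nat. (of_int (i + int l) gchoose t) \<cdot> sq_mode V
        (sq_mode V u2 j (sq_mode V u1 (int (n + t)) v2)) (i + int l - int t) v1) w))"
  proof -
    have "left_series (sq_mode V u2) u1 v1 v2 w (?x (e(Y1 := e Y1 - of_nat l, Y0 := e Y0 - of_nat n))) =
      xmode \<gamma> (\<Sum>t::nat. (of_int (i + int l) gchoose t) \<cdot> sq_mode V
        (sq_mode V u2 (j + int 0) (sq_mode V u1 (int (n + t)) v2)) (i + int l - int t) v1) w" for n l :: nat
      by (rule left) (simp_all add: e \<gamma>_def \<beta>_def)
    moreover have "fdelta (mscale M) c p delta4 (left_series (sq_mode V u2) u1 v1 v2 w) e = (c powi (- \<kappa>)) \<odot> delta4 (- \<beta>) (left_series (sq_mode V u2) u1 v1 v2 w) e"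
      by (rule E, rule rX2) simp_all
    ultimately show ?thesis
      unfolding fexp_eval minus_minus by (simp add: 0 \<beta>_def[symmetric] of_rat_minus)
  qed
  \<comment> \<open>Brings the parameter into the form \<gamma> - \<beta> on which the four-term
    expansion is stated.\<close>
  have ab: "of_rat (e X1) = ?c - ?b" by (simp add: \<gamma>_def \<beta>_def of_rat_add)
  show ?thesis
    unfolding t1 t2 t3 t4 ab \<gamma>_def[symmetric] xmode_sq_psi_sq_mode
    by (simp only: mod.scale_right_distrib)
qed

end

theorem theorem5p1:
  fixes V :: "'v::ab_group_add voa"
    and M :: "('v, 'm::ab_group_add) tmodule"
    and \<nu> :: "'v \<Rightarrow> 'v" and p :: nat and \<omega>\<^sub>p :: complex
    and u1 v1 u2 v2 :: 'v and w :: 'm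
  assumes "vertex_operator_algebra V"
    and "p > 0"
    and "voa_automorphism V \<nu> p"
    and "primitive_unity_root p \<omega>\<^sub>p"
    and "twisted_module V \<nu> p \<omega>\<^sub>p M"
  shows "let S = vscale V; T = mscale M;
      y = fmono_int Y0; y1 = fmono_int Y1; y2 = fmono_int Y2;
      minus_y2 = (\<lambda>k F. fscale S ((-1) powi k) (fmono_int Y2 k F));
      y1_plus_y = (\<lambda>k. fbinom S Y1 1 Y0 (of_int k));
      y1_minus_y = (\<lambda>k. fbinom S Y1 (-1) Y0 (of_int k));
      x1 = fmono X1; x2 = fmono X2;
      exp_minus_y_x1 = (\<lambda>q F. fexp T (- q) Y0 (fmono X1 q F));
      x1_over_x2 = (\<lambda>q F. fmono X1 q (fmono X2 (- q) F));
      inv_pow = (\<lambda>r. inv \<nu> ^^ r);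
      A = Ysq V u1 y1 (fconst v1);
      B = Ysq V u2 y2 (fconst v2)
    in
      XM_series V M A x1 (XM_series V M B x2 (fconst w))
      - XM_series V M B x2 (XM_series V M A x1 (fconst w))
      = fres Y0 (fscale T (1 / of_nat p) (\<Sum>r<p.
          fdelta T (\<omega>\<^sub>p ^ r) p
            (\<lambda>q F. fexp T (- q) Y2 (fexp T (- q) Y0 (x1_over_x2 q F)))
            (XM_series V M
              (Ysq V u1 y1_plus_y (Ysq V (inv_pow r v2) minus_y2
                (Ysq V v1 y (fconst (inv_pow r u2)))))
              exp_minus_y_x1 (fconst w))
          + fdelta T (\<omega>\<^sub>p ^ r) p
            (\<lambda>q F. fexp T (- q) Y0 (x1_over_x2 q F))
            (XM_series V M
              (Ysq V u1 y1_plus_y (Ysq V (inv_pow r u2) y2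
                (Ysq V v1 y (fconst (inv_pow r v2)))))
              exp_minus_y_x1 (fconst w))
          + fdelta T (\<omega>\<^sub>p ^ r) p
            (\<lambda>q F. fexp T q Y1 (fexp T (- q) Y2 (fexp T (- q) Y0 (x1_over_x2 q F))))
            (XM_series V M
              (Ysq_series V (Ysq V (inv_pow r v2) minus_y2
                (Ysq V u1 y (fconst (inv_pow r u2)))) y1_minus_y v1)
              x1 (fconst w))
          + fdelta T (\<omega>\<^sub>p ^ r) p
            (\<lambda>q F. fexp T q Y1 (fexp T (- q) Y0 (x1_over_x2 q F)))
            (XM_series V M
              (Ysq_series V (Ysq V (inv_pow r u2) y2
                (Ysq V u1 y (fconst (inv_pow r v2)))) y1_minus_y v1)
              x1 (fconst w))))"
proof -
  interpret twisted_module V \<nu> p \<omega>\<^sub>p M by fact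
  have root: "\<omega>\<^sub>p ^ p = 1" using assms(4) by (simp add: primitive_unity_root_def)
  note p = assms(2)
  let ?A = "Ysq V u1 (fmono_int Y1) (fconst v1)" and ?B = "Ysq V u2 (fmono_int Y2) (fconst v2)"
  let ?n = "\<lambda>r. inv \<nu> ^^ r"
  let ?T = "\<lambda>r. fdelta (mscale M) (\<omega>\<^sub>p ^ r) p delta1 (right_series (neg_sq_mode (?n r v2)) u1 v1 (?n r u2) w)
    + fdelta (mscale M) (\<omega>\<^sub>p ^ r) p delta2 (right_series (sq_mode V (?n r u2)) u1 v1 (?n r v2) w)
    + fdelta (mscale M) (\<omega>\<^sub>p ^ r) p delta3 (left_series (neg_sq_mode (?n r v2)) u1 v1 (?n r u2) w)
    + fdelta (mscale M) (\<omega>\<^sub>p ^ r) p delta4 (left_series (sq_mode V (?n r u2)) u1 v1 (?n r v2) w)"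
  have "XM_series V M ?A (fmono X1) (XM_series V M ?B (fmono X2) (fconst w))
      - XM_series V M ?B (fmono X2) (XM_series V M ?A (fmono X1) (fconst w))
      = fres Y0 (fscale (mscale M) (1 / of_nat p) (\<Sum>r<p. ?T r))"
  proof
    fix e :: "fvar \<Rightarrow> rat"
    define \<alpha> \<beta> where "\<alpha> = e X1" and "\<beta> = e X2"
    define a b where "a = rat_mode (sq_mode V u1) (- e Y1 - 1) v1" and "b = rat_mode (sq_mode V u2) (- e Y2 - 1) v2"
    have vars: "(\<forall>s. s \<notin> {X1, X2, Y1, Y2} \<longrightarrow> e s = 0) \<longleftrightarrow> e X0 = 0 \<and> e Y0 = 0"
      "(\<forall>s. s \<notin> {X2, X1, Y2, Y1} \<longrightarrow> e s = 0) \<longleftrightarrow> e X0 = 0 \<and> e Y0 = 0"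
      by (auto, (metis fvar.exhaust)+)
    have lhs: "(XM_series V M ?A (fmono X1) (XM_series V M ?B (fmono X2) (fconst w))
      - XM_series V M ?B (fmono X2) (XM_series V M ?A (fmono X1) (fconst w))) e =
      (if e X0 = 0 \<and> e Y0 = 0 then xmode \<alpha> a (xmode \<beta> b w) - xmode \<beta> b (xmode \<alpha> a w) else 0)"
    proof -
      have "XM_series V M ?A (fmono X1) (XM_series V M ?B (fmono X2) (fconst w)) e =
        (if \<forall>s. s \<notin> {X1, X2, Y1, Y2} \<longrightarrow> e s = 0 then xmode \<alpha> a (xmode \<beta> b w) else 0)"
        unfolding Ysq_def a_def b_def \<alpha>_def \<beta>_def by (rule XM_series_product) simp_all
      moreover have "XM_series V M ?B (fmono X2) (XM_series V M ?A (fmono X1) (fconst w)) e =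
        (if \<forall>s. s \<notin> {X2, X1, Y2, Y1} \<longrightarrow> e s = 0 then xmode \<beta> b (xmode \<alpha> a w) else 0)"
        unfolding Ysq_def a_def b_def \<alpha>_def \<beta>_def by (rule XM_series_product) simp_all
      ultimately show ?thesis
        unfolding minus_apply vars by (cases "e X0 = 0 \<and> e Y0 = 0") (simp_all only: if_True if_False diff_self simp_thms)
    qed
    \<comment> \<open>\<open>fres\<close> places the coefficient of y^(-1) at exponent 0 of y, which
      matches a left-hand side not involving y.\<close>
    let ?e = "e(Y0 := - 1)"
    have rhs: "fres Y0 (fscale (mscale M) (1 / of_nat p) (\<Sum>r<p. ?T r)) e =
      (if e Y0 = 0 then (1 / of_nat p) \<odot> (\<Sum>r<p. ?T r ?e) else 0)"
      by (simp only: fres_def fscale_def sum_fun_apply)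
    show "(XM_series V M ?A (fmono X1) (XM_series V M ?B (fmono X2) (fconst w))
      - XM_series V M ?B (fmono X2) (XM_series V M ?A (fmono X1) (fconst w))) e =
      fres Y0 (fscale (mscale M) (1 / of_nat p) (\<Sum>r<p. ?T r)) e"
    proof (cases "e X0 = 0 \<and> e Y0 = 0 \<and> of_nat p * \<alpha> \<in> \<int> \<and> of_nat p * \<beta> \<in> \<int> \<and> e Y1 \<in> \<int> \<and> e Y2 \<in> \<int>")
      case True
      then obtain \<sigma> \<kappa> where \<sigma>: "of_nat p * \<alpha> = of_int \<sigma>" and \<kappa>: "of_nat p * \<beta> = of_int \<kappa>"
        by (auto elim!: Ints_cases)
      obtain y1 y2 where y: "e Y1 = of_int y1" "e Y2 = of_int y2" using True by (auto elim!: Ints_cases)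
      define i j where "i = - y1 - 1" and "j = - y2 - 1"
      have Y: "e Y1 = - of_int i - 1" "e Y2 = - of_int j - 1" by (simp_all add: i_def j_def y)
      have ab: "a = sq_mode V u1 i v1" "b = sq_mode V u2 j v2"
        by (simp_all add: a_def b_def Y)
      have \<gamma>: "of_nat p * (\<alpha> + \<beta>) = of_int (\<sigma> + \<kappa>)" using \<sigma> \<kappa> by (simp add: distrib_left)
      have summand: "?T r ?e = ((\<omega>\<^sub>p ^ r) powi \<sigma>) \<odot> xmode (\<alpha> + \<beta>) (sq_psi (- of_rat \<alpha>) ((\<nu> ^^ r) a) b) w" for r
      proof -
        have "?T r ?e = ((\<omega>\<^sub>p ^ r) powi (- \<kappa>)) \<odot> xmode (?e X1 + ?e X2)
          (sq_psi (- of_rat (?e X1)) (sq_mode V u1 i v1) (sq_mode V (?n r u2) j (?n r v2))) w"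
          unfolding plus_fun_apply by (rule fdelta_terms_sum[OF p]) (use True \<kappa> Y in \<open>simp_all add: \<beta>_def\<close>)
        also have "\<dots> = ((\<omega>\<^sub>p ^ r) powi (- \<kappa>)) \<odot> xmode (\<alpha> + \<beta>) (sq_psi (- of_rat \<alpha>) a (sq_mode V (?n r u2) j (?n r v2))) w"
          by (simp add: \<alpha>_def \<beta>_def ab)
        finally have 1: "?T r ?e = \<dots>" .
        \<comment> \<open>The power \<nu>^r is pulled out of the whole product, so it disappears
          from a and leaves \<nu>^(-r) on b. Its phase has exponent -(\<sigma> + \<kappa>); with
          \<sigma> from the commutator formula there remains -\<kappa>, the phase of the delta
          function.\<close>
        have "(\<nu> ^^ r) (sq_mode V (?n r u2) j (?n r v2)) = b"
          by (simp add: aut_power_sq_mode aut_power_inv_power ab)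
        then have "sq_psi (- of_rat \<alpha>) ((\<nu> ^^ r) a) b = (\<nu> ^^ r) (sq_psi (- of_rat \<alpha>) a (sq_mode V (?n r u2) j (?n r v2)))"
          by (simp add: aut_power_sq_psi)
        then have 2: "xmode (\<alpha> + \<beta>) (sq_psi (- of_rat \<alpha>) ((\<nu> ^^ r) a) b) w = ((\<omega>\<^sub>p ^ r) powi (- (\<sigma> + \<kappa>))) \<odot>
          xmode (\<alpha> + \<beta>) (sq_psi (- of_rat \<alpha>) a (sq_mode V (?n r u2) j (?n r v2))) w"
          by (simp only: xmode_aut[OF p root \<gamma>])
        have "\<omega>\<^sub>p \<noteq> 0" using root p by (metis power_eq_0_iff zero_neq_one zero_power)
        then have "(\<omega>\<^sub>p ^ r) powi \<sigma> * (\<omega>\<^sub>p ^ r) powi (- (\<sigma> + \<kappa>)) = (\<omega>\<^sub>p ^ r) powi (\<sigma> + - (\<sigma> + \<kappa>))"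
          by (subst power_int_add) auto
        then show ?thesis unfolding 1 2 by simp
      qed
      show ?thesis
        unfolding lhs rhs summand using True xmode_commutator[OF p root \<sigma>, of a \<beta> b w] by simp
    next
      case False
      note zero = fdelta_terms_eq_0[OF p right_series_eq_0] fdelta_terms_eq_0[OF p left_series_eq_0]
      have r0: "?T r ?e = 0" if "\<not> (e X0 = 0 \<and> of_nat p * \<alpha> \<in> \<int> \<and> of_nat p * \<beta> \<in> \<int> \<and> e Y1 \<in> \<int> \<and> e Y2 \<in> \<int>)" for r
      proof -
        \<comment> \<open>\<open>fdelta_terms_eq_0\<close> refers to the exponent \<alpha> + \<beta>
          left for X_M, so a failure of integrality at \<alpha> has to be transferred to the
          sum.\<close>
        have "of_nat p * \<alpha> \<in> \<int>" if "of_nat p * \<beta> \<in> \<int>" "of_nat p * (\<alpha> + \<beta>) \<in> \<int>"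
          using Ints_diff[OF that(2) that(1)] by (simp add: algebra_simps)
        then have bad: "?e X0 \<noteq> 0 \<or> of_nat p * ?e X2 \<notin> \<int> \<or> of_nat p * (?e X1 + ?e X2) \<notin> \<int> \<or> ?e Y1 \<notin> \<int> \<or> ?e Y2 \<notin> \<int>"
          using that by (auto simp: \<alpha>_def \<beta>_def)
        have "fdelta (mscale M) (\<omega>\<^sub>p ^ r) p delta1 (right_series (neg_sq_mode (?n r v2)) u1 v1 (?n r u2) w) ?e = 0"
          "fdelta (mscale M) (\<omega>\<^sub>p ^ r) p delta2 (right_series (sq_mode V (?n r u2)) u1 v1 (?n r v2) w) ?e = 0"
          "fdelta (mscale M) (\<omega>\<^sub>p ^ r) p delta3 (left_series (neg_sq_mode (?n r v2)) u1 v1 (?n r u2) w) ?e = 0"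
          "fdelta (mscale M) (\<omega>\<^sub>p ^ r) p delta4 (left_series (sq_mode V (?n r u2)) u1 v1 (?n r v2) w) ?e = 0"
          by (rule fdelta_terms_eq_0(1)[OF p _ bad] fdelta_terms_eq_0(2)[OF p _ bad]
              fdelta_terms_eq_0(3)[OF p _ bad] fdelta_terms_eq_0(4)[OF p _ bad];
              rule right_series_eq_0 left_series_eq_0; simp)+
        then show ?thesis by (simp only: plus_fun_apply add_0_left)
      qed
      have "xmode \<alpha> a (xmode \<beta> b w) - xmode \<beta> b (xmode \<alpha> a w) = 0"
        if "\<not> (of_nat p * \<alpha> \<in> \<int> \<and> of_nat p * \<beta> \<in> \<int> \<and> e Y1 \<in> \<int> \<and> e Y2 \<in> \<int>)"
      proof -
        have y: "- y - 1 \<notin> \<int>" if "y \<notin> \<int>" for y :: rat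
        proof
          assume "- y - 1 \<in> \<int>"
          then have "- (- y - 1) - 1 \<in> \<int>" by (intro Ints_diff Ints_minus) auto
          then show False using that by simp
        qed
        have "a = 0" if "e Y1 \<notin> \<int>" using y[OF that] by (simp add: a_def rat_mode_def)
        moreover have "b = 0" if "e Y2 \<notin> \<int>" using y[OF that] by (simp add: b_def rat_mode_def)
        ultimately show ?thesis
          using that by (auto simp: xmode_fractional)
      qed
      then show ?thesis
        unfolding lhs rhs using False r0 by auto
    qed
  qed
  then show ?thesis
    unfolding Let_def Ysq_minus right_series_def left_series_def Ysq_def[of V "(inv \<nu> ^^ _) u2" "fmono_int Y2"] .
qed

end
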